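(* Let $X(n,k)$ denote the number of random cuts needed to isolate $k$ vertices $U_1,\dots,U_k$, sampled uniformly at random with replacement from $[n]$, in a uniform Cayley tree $\mathbf{t}_n$ on $[n]$. For every integer $k\ge1$, $$\lim_{n\to\infty}\frac{1}{\sqrt n}X(n,k)=\chi(2k)\qquad\text{in distribution},$$ where $\chi(2k)$ is a chi-variable with $2k$ degrees of freedom, viz. $$\mathbb{P}(\chi(2k)\in\mathrm{d}x)=\frac{2^{1-k}}{(k-1)!}x^{2k-1}\exp(-x^2/2)\,\mathrm{d}x,\qquad x\ge0.$$
   Context: For $n\ge1$, $[n]=\{1,\dots,n\}$. A uniform Cayley tree $\mathbf{t}_n$ is a tree picked uniformly at random among the $n^{n-2}$ trees on the labeled vertex set $[n]$. The vertices $U_1,\dots,U_k$ are i.i.d. uniform on $[n]$ and independent of $\mathbf{t}_n$. Definition of $X(n,k)$ via the cutting algorithm: start from $\mathbf{t}_n$ and remove an edge chosen uniformly at random given the preceding variables. This disconnects $\mathbf{t}_n$ into two subtrees. If one of these contains none of the vertices $U_1,\dots,U_k$, it is discarded; otherwise both are kept. Iterate: at each step, remove an edge chosen uniformly at random among all edges of the current forest (which consists of subtrees each containing at least one of the sampled vertices), and then discard the new subtree containing none of the sampled vertices, if there is one. The algorithm terminates when all of $U_1,\dots,U_k$ have been isolated, that is, when the forest reduces to the singletons $\{U_i\}$, $i=1,\dots,k$. $X(n,k)$ is the number of steps (edge removals) performed until termination. *)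

theory Defs
  imports "HOL-Probability.Probability"
begin

text \<open>
  Finite simple graphs are given by a vertex set and a set of edges, an edge being an
  unordered pair of distinct vertices.
\<close>

definition simple_graph :: "'a set \<Rightarrow> 'a set set \<Rightarrow> bool" where
  "simple_graph V E \<longleftrightarrow> finite V \<and> (\<forall>e\<in>E. e \<subseteq> V \<and> card e = 2)"

definition adjacent :: "'a set set \<Rightarrow> 'a \<Rightarrow> 'a \<Rightarrow> bool" where
  "adjacent E u v \<longleftrightarrow> {u, v} \<in> E"

definition joined :: "'a set set \<Rightarrow> 'a \<Rightarrow> 'a \<Rightarrow> bool" where
  "joined E = (adjacent E)\<^sup>*\<^sup>*"

definition is_cycle :: "'a set set \<Rightarrow> 'a list \<Rightarrow> bool" where
  "is_cycle E xs \<longleftrightarrow>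
     length xs \<ge> 3 \<and> distinct xs \<and> successively (adjacent E) xs \<and> adjacent E (last xs) (hd xs)"

definition is_tree :: "'a set \<Rightarrow> 'a set set \<Rightarrow> bool" where
  "is_tree V E \<longleftrightarrow>
     simple_graph V E \<and> V \<noteq> {} \<and> (\<forall>u\<in>V. \<forall>v\<in>V. joined E u v) \<and> (\<nexists>xs. is_cycle E xs)"

definition cayley_trees :: "nat \<Rightarrow> nat set set set" where
  "cayley_trees n = {E. is_tree {1..n} E}"

text \<open>\<open>S\<close> is the set of sampled vertices; components that do not meet \<open>S\<close> are discarded.\<close>

definition prune :: "'a set \<Rightarrow> 'a set \<Rightarrow> 'a set set \<Rightarrow> 'a set \<times> 'a set set" where
  "prune S V E =
     (let V' = {v \<in> V. \<exists>s\<in>S. joined E s v} in (V', {e \<in> E. e \<subseteq> V'}))"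

text \<open>
  The law of the number of cuts, starting from the forest \<open>(V, E)\<close>, each of whose components
  meets \<open>S\<close>. For such a forest \<open>E = {}\<close> means that the forest consists of the singletons
  \<open>{s}\<close> with \<open>s \<in> S\<close>; see the lemma \<open>prune_edgeless\<close> below. Infinite edge sets do not occur
  and are only excluded for termination.
\<close>

function num_cuts :: "'a set \<Rightarrow> 'a set \<Rightarrow> 'a set set \<Rightarrow> nat pmf" where
  "num_cuts S V E =
     (if E = {} \<or> infinite E then return_pmf 0
      else bind_pmf (pmf_of_set E)
             (\<lambda>e. case prune S V (E - {e}) of (V', E') \<Rightarrow> map_pmf Suc (num_cuts S V' E')))"
  by auto
termination
proof (relation "Wellfounded.measure (\<lambda>(S, V, E). card E)", goal_cases)
  case prems: (2 S V E e V' E')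
  from prems have "e \<in> E" "finite E" "E' \<subseteq> E - {e}"
    by (auto simp: prune_def Let_def)
  then have "card E' < card E"
    by (metis card_mono card_Diff1_less finite_Diff order_le_less_trans)
  then show ?case by simp
qed simp

declare num_cuts.simps [simp del]

lemma prune_edgeless:
  assumes "simple_graph V E" "S \<subseteq> V" "prune S V E = (V', {})"
  shows "V' = S"
proof
  have V': "V' = {v \<in> V. \<exists>s\<in>S. joined E s v}" and E': "{e \<in> E. e \<subseteq> V'} = {}"
    using assms(3) by (auto simp: prune_def Let_def)
  show "S \<subseteq> V'"
    using assms(2) by (auto simp: V' joined_def)
  show "V' \<subseteq> S"
  proof
    fix v assume "v \<in> V'"
    then obtain s where s: "s \<in> S" "joined E s v"
      by (auto simp: V')
    from s(2) show "v \<in> S"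
      unfolding joined_def
    proof (cases rule: converse_rtranclpE)
      case base
      then show ?thesis using s by simp
    next
      case (step w)
      then have e: "{s, w} \<in> E" by (simp add: adjacent_def)
      then have "s \<in> V" "w \<in> V"
        using assms(1) by (auto simp: simple_graph_def)
      moreover have "joined E s w" "joined E s s"
        using step(1) by (auto simp: joined_def)
      ultimately have "{s, w} \<subseteq> V'"
        using s(1) by (auto simp: V')
      then show ?thesis using e E' by blast
    qed
  qed
qed

text \<open>
  The law of \<open>X(n,k)\<close>: the tree and the samples \<open>U 1, \<dots>, U k\<close> are independent, the samples
  being i.i.d. (hence drawn with replacement).
\<close>

definition X_pmf :: "nat \<Rightarrow> nat \<Rightarrow> nat pmf" where
  "X_pmf n k =
     bind_pmf
       (pair_pmf (pmf_of_set (cayley_trees n)) (Pi_pmf {1..k} undefined (\<lambda>_. pmf_of_set {1..n})))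
       (\<lambda>(T, U). num_cuts (U ` {1..k}) {1..n} T)"

definition chi_density :: "nat \<Rightarrow> real \<Rightarrow> real" where
  "chi_density d x =
     (if x < 0 then 0
      else x ^ (d - 1) * exp (- x\<^sup>2 / 2) / (2 powr (real d / 2 - 1) * Gamma (real d / 2)))"

definition chi_distribution :: "nat \<Rightarrow> real measure" where
  "chi_distribution d = density lborel (\<lambda>x. ennreal (chi_density d x))"

end

theory Submission
  imports Defs "HOL-Real_Asymp.Real_Asymp"
begin

text \<open>
  Fix \<open>0 \<le> s \<le> 1\<close>. The numbers of cuts in disjoint components are independent, and cutting a uniform
  edge of a uniform tree leaves two uniform trees; so the values \<open>E (s ^ X)\<close> for \<open>k\<close> distinct marked
  vertices, weighted by the number of trees, satisfy a quadratic recursion in \<open>n\<close> and \<open>k\<close>. The left-hand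
  side of this recursion carries the factor \<open>n - 1\<close>, the number of edges. Replacing it by \<open>n\<close>
  (a killing with probability \<open>1 / n\<close> at each cut) gives an algebraic equation for the generating
  function, whose solution \<open>s ^ (k - 1) T ^ k (1 - s T) powr (1 - 2 k)\<close>, up to a constant, has coefficients
  in closed form, because the tree function \<open>T\<close> satisfies
  \<open>[x\<^sup>n] T ^ m = m (1 - 1/n) \<dots> (1 - (m - 1)/n) [x\<^sup>n] T\<close>. With \<open>m\<close> of order \<open>sqrt n\<close> these
  coefficients produce the chi density directly. Killing changes \<open>E (s ^ X)\<close> by \<open>o(1)\<close> when
  \<open>s = exp (- c / sqrt n)\<close>, which gives convergence of Laplace transforms and hence, by approximating
  with polynomials in \<open>exp (- x)\<close>, convergence in distribution.
\<close>

section \<open>Generating functions of the number of cuts\<close>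

text \<open>With the factor \<open>n - 1\<close> the recursion becomes a differential equation for
  the generating function; with \<open>n\<close> this factor cancels against the factor
  \<open>n\<close> on the other side, and the equation left over is algebraic. The price is that a
  stopped component with one mark counts as a success although its mark is not yet isolated, so the
  killed weights bound the true ones from neither side without a correction. From above the
  correction is the mass on which killing fails; it is negligible because the killed law already has
  the full chi mass 1 in the limit. From below it is the number of cuts that a single mark on
  \<open>m\<close> vertices still needs. For this a sublinear mean is enough: a cut takes away, on
  average, an unbounded number of vertices from the part of the mark as \<open>m\<close> grows,
  which gives a mean of at most \<open>\<epsilon> * m + N\<close>. The tree function enters only
  through the recursion for unmarked trees, that is \<open>x T' (1 - T) = T\<close>; neither
  Cayley's formula nor Lagrange inversion is used. Samples with replacement differ from
  \<open>k\<close>-subsets only on an event whose probability tends to 0.\<close>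

lemma joined_refl [simp]: "joined E x x"
  by (simp add: joined_def)

lemma joined_trans: "joined E x y \<Longrightarrow> joined E y z \<Longrightarrow> joined E x z"
  by (simp add: joined_def)

lemma joined_sym: "joined E x y \<Longrightarrow> joined E y x"
  unfolding joined_def
proof (induction rule: rtranclp_induct)
  case (step y z)
  then have "adjacent E z y" by (simp add: adjacent_def insert_commute)
  with step show ?case by (meson converse_rtranclp_into_rtranclp)
qed simp

lemma joined_mono: "joined E x y \<Longrightarrow> E \<subseteq> E' \<Longrightarrow> joined E' x y"
  unfolding joined_def by (erule rtranclp_mono[THEN predicate2D, rotated]) (auto simp: adjacent_def)

lemma joined_edge: "{x, y} \<in> E \<Longrightarrow> joined E x y"
  by (auto simp: joined_def adjacent_def)

lemma joined_in_edge:
  assumes "e \<in> E" "card e = 2" "x \<in> e" "y \<in> e"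
  shows "joined E x y"
proof -
  from assms(2) obtain a b where "e = {a, b}" by (auto simp: card_2_iff)
  then show ?thesis using assms joined_edge[of a b E] joined_edge[of b a E]
    by (auto simp: insert_commute)
qed

lemma joined_map:
  assumes "joined E x y" "\<And>a b. {a, b} \<in> E \<Longrightarrow> joined F (p a) (p b)"
  shows "joined F (p x) (p y)"
  using assms(1) unfolding joined_def[of E]
proof (induction rule: rtranclp_induct)
  case (step y z)
  then show ?case using assms(2)[of y z] joined_trans by (auto simp: adjacent_def)
qed simp

lemma joined_preserves:
  assumes "joined E x y" "x \<in> A" "\<And>a b. {a, b} \<in> E \<Longrightarrow> a \<in> A \<Longrightarrow> b \<in> A"
  shows "y \<in> A"
  using assms(1) unfolding joined_def
proof (induction rule: rtranclp_induct)
  case (step y z)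
  then show ?case using assms(3)[of y z] by (auto simp: adjacent_def)
qed (rule assms(2))

lemma joined_isolated:
  assumes "joined E x y" "x \<notin> \<Union>E"
  shows "y = x"
  using joined_preserves[OF assms(1), of "{x}"] assms(2) by blast

text \<open>From here on the vertex set is dropped: it affects \<open>num_cuts\<close> only through
  the edges that survive pruning, see \<open>num_cuts_irrelevant_vertices\<close>.\<close>

definition edges2 :: "'a set set \<Rightarrow> bool" where
  "edges2 E \<longleftrightarrow> finite E \<and> (\<forall>e\<in>E. card e = 2)"

text \<open>The effect of \<open>prune\<close> on the edge set. An isolated mark carries no edge and
  leaves no trace here, so the empty set is the terminal state.\<close>

definition alive :: "'a set \<Rightarrow> 'a set set \<Rightarrow> 'a set set" where
  "alive S E = {e \<in> E. \<exists>s\<in>S. \<exists>v\<in>e. joined E s v}"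

lemma alive_subset: "alive S E \<subseteq> E"
  by (auto simp: alive_def)

lemma edges2_subset: "edges2 E \<Longrightarrow> F \<subseteq> E \<Longrightarrow> edges2 F"
  by (auto simp: edges2_def finite_subset)

lemma edges2_alive: "edges2 E \<Longrightarrow> edges2 (alive S E)"
  using edges2_subset alive_subset by metis

text \<open>The endpoints of an edge are joined to each other, so an edge lies inside the kept
  vertex set as soon as one endpoint is joined to a mark.\<close>

lemma prune_edges:
  assumes "edges2 E" "\<Union>E \<subseteq> V"
  shows "snd (prune S V E) = alive S E"
proof -
  have "e \<subseteq> {v \<in> V. \<exists>s\<in>S. joined E s v} \<longleftrightarrow> (\<exists>s\<in>S. \<exists>v\<in>e. joined E s v)" if "e \<in> E" for e
  proof
    assume "e \<subseteq> {v \<in> V. \<exists>s\<in>S. joined E s v}"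
    moreover have "e \<noteq> {}" using assms that by (auto simp: edges2_def)
    ultimately show "\<exists>s\<in>S. \<exists>v\<in>e. joined E s v" by blast
  next
    assume "\<exists>s\<in>S. \<exists>v\<in>e. joined E s v"
    then obtain s v where sv: "s \<in> S" "v \<in> e" "joined E s v" by blast
    have "joined E v w" if "w \<in> e" for w
      using assms \<open>e \<in> E\<close> sv that by (intro joined_in_edge) (auto simp: edges2_def)
    then show "e \<subseteq> {v \<in> V. \<exists>s\<in>S. joined E s v}"
      using sv that assms(2) joined_trans[OF sv(3)] by auto
  qed
  then show ?thesis
    unfolding prune_def alive_def Let_def snd_conv by (intro Collect_cong conj_cong refl)
qed

lemma prune_edges_subset: "\<Union>(snd (prune S V E)) \<subseteq> fst (prune S V E)"
  by (auto simp: prune_def Let_def)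

lemma num_cuts_irrelevant_vertices:
  assumes "edges2 E" "\<Union>E \<subseteq> V" "\<Union>E \<subseteq> W"
  shows "num_cuts S V E = num_cuts S W E"
  using assms
proof (induction "card E" arbitrary: E V W rule: less_induct)
  case less
  show ?case
  proof (cases "E = {} \<or> infinite E")
    case False
    have "(case prune S V (E - {e}) of (V', E') \<Rightarrow> map_pmf Suc (num_cuts S V' E')) =
          (case prune S W (E - {e}) of (V', E') \<Rightarrow> map_pmf Suc (num_cuts S V' E'))"
      if e: "e \<in> E" for e
    proof -
      have e2: "edges2 (E - {e})" using less.prems edges2_subset by blast
      have p: "snd (prune S V (E - {e})) = alive S (E - {e})" 
              "snd (prune S W (E - {e})) = alive S (E - {e})"
        using less.prems by (auto intro!: prune_edges e2)
      have "card (alive S (E - {e})) < card E"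
        using False e alive_subset[of S "E - {e}"] by (auto intro!: psubset_card_mono)
      moreover have "\<Union>(alive S (E - {e})) \<subseteq> fst (prune S V (E - {e}))"
                    "\<Union>(alive S (E - {e})) \<subseteq> fst (prune S W (E - {e}))"
        using p prune_edges_subset by metis+
      ultimately have "num_cuts S (fst (prune S V (E - {e}))) (alive S (E - {e})) =
                       num_cuts S (fst (prune S W (E - {e}))) (alive S (E - {e}))"
        using edges2_alive[OF e2] by (intro less.hyps) auto
      with p show ?thesis by (simp add: case_prod_beta)
    qed
    moreover have "set_pmf (pmf_of_set E) = E" using False by simp
    ultimately show ?thesis
      using False
      by (subst (1 2) num_cuts.simps) (simp, intro bind_pmf_cong, simp_all)
  qed (simp add: num_cuts.simps)
qed

lemma finite_set_num_cuts: "finite (set_pmf (num_cuts S V E))"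
proof (induction S V E rule: num_cuts.induct)
  case (1 S V E)
  show ?case
  proof (cases "E = {} \<or> infinite E")
    case False
    have "finite (set_pmf (case prune S V (E - {e}) of (V', E') \<Rightarrow> map_pmf Suc (num_cuts S V' E')))"
      if e: "e \<in> E" for e
    proof -
      obtain V' E' where p: "prune S V (E - {e}) = (V', E')" by fastforce
      have "finite (set_pmf (num_cuts S V' E'))"
        by (rule 1) (use False e p in auto)
      then show ?thesis by (simp add: p)
    qed
    moreover have "set_pmf (pmf_of_set E) = E" using False by simp
    ultimately show ?thesis
      using False by (subst num_cuts.simps) simp
  qed (simp add: num_cuts.simps)
qed

text \<open>Taking \<open>\<Union>E\<close> as vertex set leaves a function of marks and edges
  alone. By \<open>finite_set_num_cuts\<close> every expectation is a finite sum.\<close>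

definition cut_pgf :: "real \<Rightarrow> 'a set \<Rightarrow> 'a set set \<Rightarrow> real" where
  "cut_pgf s S E = measure_pmf.expectation (num_cuts S (\<Union>E) E) (\<lambda>m. s ^ m)"

lemma cut_pgf_eq:
  assumes "edges2 E" "\<Union>E \<subseteq> V"
  shows "measure_pmf.expectation (num_cuts S V E) (\<lambda>m. s ^ m) = cut_pgf s S E"
  unfolding cut_pgf_def using num_cuts_irrelevant_vertices[OF assms order_refl] by simp

lemma cut_pgf_empty [simp]: "cut_pgf s S {} = 1"
  by (simp add: cut_pgf_def num_cuts.simps)

lemma cut_pgf_rec:
  assumes "edges2 E" "E \<noteq> {}"
  shows "cut_pgf s S E = s / card E * (\<Sum>e\<in>E. cut_pgf s S (alive S (E - {e})))"
proof -
  have fin: "finite E" using assms by (simp add: edges2_def)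
  have "cut_pgf s S E = (\<Sum>e\<in>E. measure_pmf.expectation
     (case prune S (\<Union>E) (E - {e}) of (V', E') \<Rightarrow> map_pmf Suc (num_cuts S V' E')) (\<lambda>m. s ^ m)) / real (card E)"
  proof -
    let ?f = "\<lambda>e. case prune S (\<Union>E) (E - {e}) of (V', E') \<Rightarrow> map_pmf Suc (num_cuts S V' E')"
    have "num_cuts S (\<Union>E) E = bind_pmf (pmf_of_set E) ?f"
      using assms fin by (subst num_cuts.simps) simp
    moreover have "finite (set_pmf (?f e))" for e
      by (cases "prune S (\<Union>E) (E - {e})") (simp add: finite_set_num_cuts)
    ultimately show ?thesis
      unfolding cut_pgf_def using pmf_expectation_bind_pmf_of_set[of E ?f "\<lambda>m. s ^ m"] assms fin
      by (simp only: real_scaleR_def divide_inverse sum_distrib_right sum_distrib_left mult.commute) simp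
  qed
  also have "(\<Sum>e\<in>E. measure_pmf.expectation
     (case prune S (\<Union>E) (E - {e}) of (V', E') \<Rightarrow> map_pmf Suc (num_cuts S V' E')) (\<lambda>m. s ^ m)) =
     (\<Sum>e\<in>E. s * cut_pgf s S (alive S (E - {e})))"
  proof (rule sum.cong[OF refl])
    fix e assume e: "e \<in> E"
    have e2: "edges2 (E - {e})" by (rule edges2_subset[OF assms(1)]) auto
    have p: "snd (prune S (\<Union>E) (E - {e})) = alive S (E - {e})" 
      by (rule prune_edges[OF e2]) blast
    have "\<Union>(alive S (E - {e})) \<subseteq> fst (prune S (\<Union>E) (E - {e}))"
      unfolding p[symmetric] by (rule prune_edges_subset)
    from cut_pgf_eq[OF edges2_alive[OF e2] this]
    show "measure_pmf.expectation
     (case prune S (\<Union>E) (E - {e}) of (V', E') \<Rightarrow> map_pmf Suc (num_cuts S V' E')) (\<lambda>m. s ^ m) =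
      s * cut_pgf s S (alive S (E - {e}))"
      by (simp add: case_prod_beta p)
  qed
  finally show ?thesis
    by (simp add: sum_distrib_left sum_divide_distrib)
qed

lemma cut_pgf_bounds:
  assumes "0 \<le> s" "s \<le> 1"
  shows "0 \<le> cut_pgf s S E" "cut_pgf s S E \<le> 1"
proof -
  show "0 \<le> cut_pgf s S E"
    unfolding cut_pgf_def using assms by (intro Bochner_Integration.integral_nonneg) auto
  have "cut_pgf s S E \<le> measure_pmf.expectation (num_cuts S (\<Union>E) E) (\<lambda>m. 1)"
    unfolding cut_pgf_def using assms
    by (intro integral_mono integrable_measure_pmf_finite finite_set_num_cuts) (auto intro: power_le_one)
  then show "cut_pgf s S E \<le> 1" by simp
qed

section \<open>Multiplicativity over disjoint forests\<close>

lemma joined_disjoint_union: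
  assumes "\<Union>E \<inter> \<Union>F = {}" "v \<in> \<Union>E" "joined (E \<union> F) s v"
  shows "joined E s v"
proof -
  have *: "joined (E \<union> F) v s" using assms(3) by (rule joined_sym)
  have "s \<in> {w. joined E v w}"
  proof (rule joined_preserves[OF *])
    fix a b assume ab: "{a, b} \<in> E \<union> F" "a \<in> {w. joined E v w}"
    then have "joined E v a" by simp
    moreover have "a \<in> \<Union>E"
    proof (rule joined_preserves[of E v a])
      show "joined E v a" by fact
      show "v \<in> \<Union>E" by fact
    qed auto
    then have "{a, b} \<in> E" using ab(1) assms(1) by blast
    ultimately show "b \<in> {w. joined E v w}"
      using joined_trans joined_edge by (metis mem_Collect_eq)
  qed auto
  then show ?thesis using joined_sym[of E v s] by simp
qed

lemma alive_union:
  assumes "\<Union>E \<inter> \<Union>F = {}"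
  shows "alive S (E \<union> F) = alive S E \<union> alive S F"
proof -
  have "joined (E \<union> F) s v \<longleftrightarrow> joined E s v" if "v \<in> e" "e \<in> E" for e v s
    using joined_disjoint_union[OF assms, of v s] that joined_mono[of E s v "E \<union> F"] by blast
  moreover have "joined (E \<union> F) s v \<longleftrightarrow> joined F s v" if "v \<in> e" "e \<in> F" for e v s
    using joined_disjoint_union[of F E v s] assms that joined_mono[of F s v "E \<union> F"]
    by (auto simp: Int_commute Un_commute)
  ultimately show ?thesis
    unfolding alive_def by blast
qed

lemma alive_alive:
  assumes "edges2 E"
  shows "alive S (alive S E) = alive S E"
proof
  show "alive S E \<subseteq> alive S (alive S E)"
  proof
    fix e assume e: "e \<in> alive S E"
    then obtain s v where sv: "s \<in> S" "v \<in> e" "joined E s v" "e \<in> E"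
      by (auto simp: alive_def)
    have "v \<in> {w. joined (alive S E) s w}"
    proof (rule joined_preserves[of "E" s v])
      fix a b assume ab: "{a, b} \<in> E" "a \<in> {w. joined (alive S E) s w}"
      then have "joined E s a" using joined_mono[OF _ alive_subset] by simp
      then have "{a, b} \<in> alive S E" using ab sv by (auto simp: alive_def)
      then show "b \<in> {w. joined (alive S E) s w}"
        using ab joined_trans joined_edge by (metis mem_Collect_eq)
    qed (use sv in auto)
    then show "e \<in> alive S (alive S E)"
      using sv e by (auto simp: alive_def[of S "alive S E"])
  qed
qed (rule alive_subset)

text \<open>A uniform edge of the union falls into \<open>E\<close> or \<open>F\<close> with
  probability proportional to the number of edges, and by \<open>cut_pgf_rec\<close> the sum over
  the edges of \<open>E\<close>, times \<open>s\<close>, is \<open>card E\<close> times the value at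
  \<open>E\<close>. The two contributions therefore add up to \<open>card E + card F\<close> times
  the product, and the normalisation cancels. By \<open>alive S E = E\<close> and
  \<open>alive S F = F\<close>, a cut in one forest leaves the other unchanged.\<close>

lemma cut_pgf_union:
  assumes "edges2 E" "edges2 F" "\<Union>E \<inter> \<Union>F = {}" "alive S E = E" "alive S F = F"
  shows "cut_pgf s S (E \<union> F) = cut_pgf s S E * cut_pgf s S F"
  using assms
proof (induction "card E + card F" arbitrary: E F rule: less_induct)
  case less
  show ?case
  proof (cases "E = {} \<or> F = {}")
    case False
    have fin: "finite E" "finite F" using less.prems by (auto simp: edges2_def)
    have disj: "E \<inter> F = {}"
    proof (rule ccontr)
      assume "E \<inter> F \<noteq> {}"
      then obtain e where "e \<in> E" "e \<in> F" by blast
      moreover from this have "e \<noteq> {}" using less.prems by (auto simp: edges2_def)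
      ultimately show False using less.prems by blast
    qed
    have e2: "edges2 (E \<union> F)" using less.prems by (auto simp: edges2_def)
    have L: "cut_pgf s S (alive S (E \<union> F - {e})) = cut_pgf s S (alive S (E - {e})) * cut_pgf s S F"
      if "e \<in> E" for e
    proof -
      have "E \<union> F - {e} = (E - {e}) \<union> F" using disj that by blast
      moreover have "alive S ((E - {e}) \<union> F) = alive S (E - {e}) \<union> F"
        using less.prems by (subst alive_union) auto
      moreover have "cut_pgf s S (alive S (E - {e}) \<union> F) = cut_pgf s S (alive S (E - {e})) * cut_pgf s S F"
      proof (rule less.hyps)
        show "card (alive S (E - {e})) + card F < card E + card F"
          using fin that alive_subset[of S "E - {e}"] by (auto intro!: psubset_card_mono)
        show "edges2 (alive S (E - {e}))" "alive S (alive S (E - {e})) = alive S (E - {e})"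
          using less.prems by (auto intro!: edges2_alive alive_alive intro: edges2_subset)
        show "\<Union> (alive S (E - {e})) \<inter> \<Union> F = {}"
          using less.prems alive_subset[of S "E - {e}"] by blast
      qed (use less.prems in auto)
      ultimately show ?thesis by simp
    qed
    have R: "cut_pgf s S (alive S (E \<union> F - {e})) = cut_pgf s S E * cut_pgf s S (alive S (F - {e}))"
      if "e \<in> F" for e
    proof -
      have "E \<union> F - {e} = E \<union> (F - {e})" using disj that by blast
      moreover have "alive S (E \<union> (F - {e})) = E \<union> alive S (F - {e})"
        using less.prems by (subst alive_union) auto
      moreover have "cut_pgf s S (E \<union> alive S (F - {e})) = cut_pgf s S E * cut_pgf s S (alive S (F - {e}))"
      proof (rule less.hyps)
        show "card E + card (alive S (F - {e})) < card E + card F"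
          using fin that alive_subset[of S "F - {e}"] by (auto intro!: psubset_card_mono)
        show "edges2 (alive S (F - {e}))" "alive S (alive S (F - {e})) = alive S (F - {e})"
          using less.prems by (auto intro!: edges2_alive alive_alive intro: edges2_subset)
        show "\<Union> E \<inter> \<Union> (alive S (F - {e})) = {}"
          using less.prems alive_subset[of S "F - {e}"] by blast
      qed (use less.prems in auto)
      ultimately show ?thesis by simp
    qed
    have cE: "s * (\<Sum>e\<in>E. cut_pgf s S (alive S (E - {e}))) = card E * cut_pgf s S E"
      using cut_pgf_rec[of E s S] less.prems False fin by simp
    have cF: "s * (\<Sum>e\<in>F. cut_pgf s S (alive S (F - {e}))) = card F * cut_pgf s S F"
      using cut_pgf_rec[of F s S] less.prems False fin by simp
    have "cut_pgf s S (E \<union> F) = s / card (E \<union> F) * (\<Sum>e\<in>E \<union> F. cut_pgf s S (alive S (E \<union> F - {e})))"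
      using False by (intro cut_pgf_rec e2) auto
    also have "(\<Sum>e\<in>E \<union> F. cut_pgf s S (alive S (E \<union> F - {e}))) =
       (\<Sum>e\<in>E. cut_pgf s S (alive S (E - {e}))) * cut_pgf s S F +
       cut_pgf s S E * (\<Sum>e\<in>F. cut_pgf s S (alive S (F - {e})))"
      by (subst sum.union_disjoint) (use fin disj L R in \<open>auto simp: sum_distrib_left sum_distrib_right\<close>)
    also have "s / card (E \<union> F) * \<dots> = (s * (\<Sum>e\<in>E. cut_pgf s S (alive S (E - {e}))) * cut_pgf s S F +
       cut_pgf s S E * (s * (\<Sum>e\<in>F. cut_pgf s S (alive S (F - {e}))))) / (card E + card F)"
      using fin disj by (simp add: card_Un_disjoint field_simps)
    also have "\<dots> = cut_pgf s S E * cut_pgf s S F"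
      unfolding cE cF using False fin
      by (simp add: divide_simps add_nonneg_eq_0_iff) (auto simp: algebra_simps)
    finally show ?thesis .
  qed auto
qed

section \<open>Splitting a tree at an edge\<close>

lemma joined_path:
  assumes "joined E x y"
  shows "\<exists>xs. xs \<noteq> [] \<and> distinct xs \<and> successively (adjacent E) xs \<and> hd xs = x \<and> last xs = y"
  using assms unfolding joined_def
proof (induction rule: rtranclp_induct)
  case base
  show ?case by (rule exI[of _ "[x]"]) simp
next
  case (step y z)
  then obtain xs where xs: "xs \<noteq> []" "distinct xs" "successively (adjacent E) xs" "hd xs = x" "last xs = y"
    by blast
  show ?case
  \<comment> \<open>If the new end already lies on the path, the path is cut off there, which keeps
    it free of repetitions.\<close>
  proof (cases "z \<in> set xs")
    case True
    then obtain ys zs where "xs = ys @ z # zs" by (meson split_list)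
    then have "distinct (ys @ [z])" "successively (adjacent E) (ys @ [z])" "hd (ys @ [z]) = x"
      using xs by (auto simp: successively_append_iff hd_append)
    then show ?thesis by (intro exI[of _ "ys @ [z]"]) simp
  next
    case False
    then show ?thesis
      using xs step by (intro exI[of _ "xs @ [z]"]) (simp add: successively_append_iff)
  qed
qed

lemma path_joined:
  "successively (adjacent E) xs \<Longrightarrow> xs \<noteq> [] \<Longrightarrow> joined E (hd xs) (last xs)"
proof (induction xs rule: induct_list012)
  case (3 x y zs)
  then have "joined E x y" "joined E y (last (y # zs))"
    by (auto simp: joined_def adjacent_def)
  then show ?case using joined_trans by (metis last_ConsR list.distinct(1) list.sel(1))
qed auto

lemma acyclic_edge_bridge:
  assumes "\<nexists>xs. is_cycle E xs" "{u, v} \<in> E" "u \<noteq> v"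
  shows "\<not> joined (E - {{u, v}}) u v"
proof
  assume "joined (E - {{u, v}}) u v"
  from joined_path[OF this] obtain xs where
    xs: "xs \<noteq> []" "distinct xs" "successively (adjacent (E - {{u, v}})) xs" "hd xs = u" "last xs = v"
    by blast
  have "length xs \<ge> 3"
  proof (rule ccontr)
    assume "\<not> length xs \<ge> 3"
    then have "length xs = 1 \<or> length xs = 2" using xs(1) length_greater_0_conv[of xs] by linarith
    then show False
      using xs assms(3) by (auto simp: length_Suc_conv numeral_2_eq_2 adjacent_def)
  qed
  moreover have "successively (adjacent E) xs"
    using xs(3) by (rule successively_mono) (auto simp: adjacent_def)
  ultimately have "is_cycle E xs"
    using xs assms(2) by (auto simp: is_cycle_def adjacent_def insert_commute)
  then show False using assms(1) by blast
qed

text \<open>With \<open>acyclic_edge_bridge\<close> this turns acyclicity into a statement about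
  \<open>joined\<close>: every edge is a bridge. In this form it can be checked for a joined tree
  without handling lists.\<close>

lemma cycle_edge_not_bridge:
  assumes "is_cycle E xs"
  obtains u v where "{u, v} \<in> E" "joined (E - {{u, v}}) u v"
proof
  let ?e = "{hd xs, last xs}"
  have c: "length xs \<ge> 3" "distinct xs" "successively (adjacent E) xs" "adjacent E (last xs) (hd xs)"
    using assms by (auto simp: is_cycle_def)
  then have ne: "xs \<noteq> []" by auto
  show "?e \<in> E" using c by (simp add: adjacent_def insert_commute)
  have "successively (adjacent (E - {?e})) xs"
    unfolding successively_conv_nth
  proof (intro allI impI)
    fix i assume i: "Suc i < length xs"
    then have "{xs ! i, xs ! Suc i} \<in> E"
      using c(3) by (simp add: successively_conv_nth adjacent_def)
    moreover have "{xs ! i, xs ! Suc i} \<noteq> ?e"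
      using c(1,2) i ne 
      by (auto simp: doubleton_eq_iff hd_conv_nth last_conv_nth nth_eq_iff_index_eq)
    ultimately show "adjacent (E - {?e}) (xs ! i) (xs ! Suc i)"
      by (simp add: adjacent_def)
  qed
  then show "joined (E - {?e}) (hd xs) (last xs)"
    using ne by (rule path_joined)
qed

lemma is_tree_edges2: "is_tree V E \<Longrightarrow> edges2 E"
proof -
  assume "is_tree V E"
  then have "finite V" "\<forall>e\<in>E. e \<subseteq> V \<and> card e = 2" by (auto simp: is_tree_def simple_graph_def)
  then have "E \<subseteq> Pow V" "finite (Pow V)" by auto
  then show ?thesis using \<open>\<forall>e\<in>E. _\<close> by (auto simp: edges2_def intro: finite_subset)
qed

lemma is_tree_Union: "is_tree V E \<Longrightarrow> \<Union>E \<subseteq> V"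
  by (auto simp: is_tree_def simple_graph_def)

definition component :: "'a set \<Rightarrow> 'a set set \<Rightarrow> 'a \<Rightarrow> 'a set" where
  "component V E u = {x \<in> V. joined E u x}"

definition edges_within :: "'a set set \<Rightarrow> 'a set \<Rightarrow> 'a set set" where
  "edges_within E V = {e \<in> E. e \<subseteq> V}"

lemma component_closed:
  assumes "\<Union>E \<subseteq> V" "{a, b} \<in> E" "a \<in> component V E u"
  shows "b \<in> component V E u"
proof -
  have "joined E u b" using assms joined_trans joined_edge
    by (metis (no_types, lifting) component_def mem_Collect_eq)
  moreover have "b \<in> V" using assms by blast
  ultimately show ?thesis by (simp add: component_def)
qed

lemma joined_edges_within_component:
  assumes "\<Union>E \<subseteq> V" "x \<in> component V E u"
  shows "joined (edges_within E (component V E u)) u x"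
proof -
  have uV: "joined E u x" using assms by (auto simp: component_def)
  show ?thesis
  proof (cases "u \<in> V")
    case True
    have "x \<in> {y \<in> component V E u. joined (edges_within E (component V E u)) u y}"
    proof (rule joined_preserves[OF uV])
      show "u \<in> {y \<in> component V E u. joined (edges_within E (component V E u)) u y}"
        using True by (simp add: component_def)
    next
      fix a b assume ab: "{a, b} \<in> E" "a \<in> {y \<in> component V E u. joined (edges_within E (component V E u)) u y}"
      then have b: "b \<in> component V E u" using component_closed assms(1) by (metis (no_types, lifting) mem_Collect_eq)
      then have "{a, b} \<in> edges_within E (component V E u)" using ab by (simp add: edges_within_def)
      then show "b \<in> {y \<in> component V E u. joined (edges_within E (component V E u)) u y}"
        using b ab joined_trans joined_edge by (metis (no_types, lifting) mem_Collect_eq)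
    qed
    then show ?thesis by simp
  next
    case False
    then have "x = u" using uV assms(1) joined_isolated[of E u x] by blast
    then show ?thesis by simp
  qed
qed

lemma component_is_tree:
  assumes "is_tree V E" "F \<subseteq> E" "u \<in> V"
  shows "is_tree (component V F u) (edges_within F (component V F u))"
proof -
  let ?C = "component V F u" and ?F = "edges_within F (component V F u)"
  have UF: "\<Union>F \<subseteq> V" using assms is_tree_Union by blast
  have "simple_graph ?C ?F"
    using assms(1,2) by (auto simp: is_tree_def simple_graph_def component_def edges_within_def)
  moreover have "u \<in> ?C" using assms by (simp add: component_def)
  moreover have "joined ?F x y" if "x \<in> ?C" "y \<in> ?C" for x y
    using joined_edges_within_component[OF UF that(1)] joined_edges_within_component[OF UF that(2)]
      joined_sym joined_trans by metis
  moreover have "\<nexists>xs. is_cycle ?F xs"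
  proof
    assume "\<exists>xs. is_cycle ?F xs"
    then obtain xs where xs: "is_cycle ?F xs" by blast
    then have "successively (adjacent E) xs"
      using assms(2) unfolding is_cycle_def
      by (elim conjE) (erule successively_mono, auto simp: adjacent_def edges_within_def)
    then have "is_cycle E xs" using xs assms(2) by (auto simp: is_cycle_def adjacent_def edges_within_def)
    then show False using assms(1) by (auto simp: is_tree_def)
  qed
  ultimately show ?thesis unfolding is_tree_def by blast
qed

text \<open>A walk from \<open>u\<close> can leave the component of \<open>u\<close> only through
  the deleted edge and then enters that of \<open>v\<close>, so the two components cover
  \<open>V\<close>. They are disjoint because the edge is a bridge.\<close>

lemma tree_edge_split:
  assumes "is_tree V E" "{u, v} \<in> E"
  defines "F \<equiv> E - {{u, v}}"
  shows "u \<in> V" "v \<in> V" "u \<noteq> v"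
    "component V F u \<inter> component V F v = {}" "component V F u \<union> component V F v = V"
    "edges_within F (component V F u) \<union> edges_within F (component V F v) = F"
proof -
  have tr: "simple_graph V E" "\<nexists>xs. is_cycle E xs" "\<And>x y. x \<in> V \<Longrightarrow> y \<in> V \<Longrightarrow> joined E x y"
    using assms(1) by (auto simp: is_tree_def)
  have uv: "{u, v} \<subseteq> V" "card {u, v} = 2" using tr(1) assms(2) by (auto simp: simple_graph_def)
  then show uV: "u \<in> V" "v \<in> V" "u \<noteq> v" by auto
  have UF: "\<Union>F \<subseteq> V" using tr(1) by (auto simp: simple_graph_def F_def)
  have nj: "\<not> joined F u v" using acyclic_edge_bridge[OF tr(2) assms(2)] uV by (simp add: F_def)
  then show "component V F u \<inter> component V F v = {}"
    using joined_sym joined_trans unfolding component_def by (metis (no_types, lifting) disjoint_iff mem_Collect_eq)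
  show UV: "component V F u \<union> component V F v = V"
  proof
    show "V \<subseteq> component V F u \<union> component V F v"
    proof
      fix x assume x: "x \<in> V"
      have "x \<in> component V F u \<union> component V F v"
      proof (rule joined_preserves[OF tr(3)[OF uV(1) x]])
        show "u \<in> component V F u \<union> component V F v" using uV by (simp add: component_def)
        fix a b assume ab: "{a, b} \<in> E" "a \<in> component V F u \<union> component V F v"
        show "b \<in> component V F u \<union> component V F v"
        proof (cases "{a, b} = {u, v}")
          case True
          then have "b = u \<or> b = v" by (auto simp: doubleton_eq_iff)
          then show ?thesis using uV by (auto simp: component_def)
        next
          case False
          then have "{a, b} \<in> F" using ab by (simp add: F_def)
          then show ?thesis using ab component_closed[OF UF] by blast
        qed
      qed
      then show "x \<in> component V F u \<union> component V F v" .
    qed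
  qed (auto simp: component_def)
  show "edges_within F (component V F u) \<union> edges_within F (component V F v) = F"
  proof
    show "F \<subseteq> edges_within F (component V F u) \<union> edges_within F (component V F v)"
    proof
      fix e assume e: "e \<in> F"
      then have "card e = 2" using tr(1) by (auto simp: simple_graph_def F_def)
      then obtain a b where ab: "e = {a, b}" by (auto simp: card_2_iff)
      have "a \<in> V" using e ab UF by blast
      then consider "a \<in> component V F u" | "a \<in> component V F v" using UV by blast
      then show "e \<in> edges_within F (component V F u) \<union> edges_within F (component V F v)"
        by cases (use e ab component_closed[OF UF, of a b] in \<open>auto simp: edges_within_def\<close>)
    qed
  qed (auto simp: edges_within_def)
qed

text \<open>Splitting undoes \<open>tree_join\<close>: both halves can be recovered from the joined
  tree and the chosen edge. This is one half of the bijection in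
  \<open>tree_sum_rec\<close>.\<close>

lemma component_join:
  assumes "is_tree V1 E1" "is_tree V2 E2" "V1 \<inter> V2 = {}" "u \<in> V1" "V1 \<subseteq> V"
  shows "component V (E1 \<union> E2) u = V1" 
    and "edges_within (E1 \<union> E2) V1 = E1"
proof -
  have U: "\<Union>E1 \<subseteq> V1" "\<Union>E2 \<subseteq> V2" using assms is_tree_Union by blast+
  show "component V (E1 \<union> E2) u = V1"
  proof
    show "component V (E1 \<union> E2) u \<subseteq> V1"
    proof
      fix x assume "x \<in> component V (E1 \<union> E2) u"
      then have "joined (E1 \<union> E2) u x" by (simp add: component_def)
      then show "x \<in> V1"
        by (rule joined_preserves) (use U assms in blast)+
    qed
    show "V1 \<subseteq> component V (E1 \<union> E2) u"
    proof
      fix x assume "x \<in> V1"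
      then have "joined E1 u x" using assms by (auto simp: is_tree_def)
      then have "joined (E1 \<union> E2) u x" by (rule joined_mono) simp
      then show "x \<in> component V (E1 \<union> E2) u" using \<open>x \<in> V1\<close> assms(5) by (auto simp: component_def)
    qed
  qed
  have "e \<noteq> {}" if "e \<in> E2" for e using is_tree_edges2[OF assms(2)] that by (auto simp: edges2_def)
  then show "edges_within (E1 \<union> E2) V1 = E1"
    using U assms(3) unfolding edges_within_def by blast
qed

lemma tree_join:
  assumes "is_tree V1 E1" "is_tree V2 E2" "V1 \<inter> V2 = {}" "u \<in> V1" "v \<in> V2"
  shows "is_tree (V1 \<union> V2) (insert {u, v} (E1 \<union> E2))" "{u, v} \<notin> E1 \<union> E2"
proof -
  let ?E = "insert {u, v} (E1 \<union> E2)"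
  have U: "\<Union>E1 \<subseteq> V1" "\<Union>E2 \<subseteq> V2" using assms is_tree_Union by blast+
  show new: "{u, v} \<notin> E1 \<union> E2" using U assms by auto
  have uv: "u \<noteq> v" using assms by auto
  have ac: "\<nexists>xs. is_cycle E1 xs" "\<nexists>xs. is_cycle E2 xs" using assms by (auto simp: is_tree_def)
  have c2: "card e = 2" if "e \<in> E1 \<or> e \<in> E2" for e
    using that is_tree_edges2[OF assms(1)] is_tree_edges2[OF assms(2)] by (auto simp: edges2_def)
  have "simple_graph (V1 \<union> V2) ?E"
    using assms uv by (auto simp: is_tree_def simple_graph_def)
  moreover have "V1 \<union> V2 \<noteq> {}" using assms by auto
  moreover have "joined ?E x y" if xy: "x \<in> V1 \<union> V2" "y \<in> V1 \<union> V2" for x y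
  proof -
    have "joined ?E u z" if "z \<in> V1 \<union> V2" for z
    proof (cases "z \<in> V1")
      case True
      then have "joined E1 u z" using assms by (auto simp: is_tree_def)
      then show ?thesis by (rule joined_mono) auto
    next
      case False
      then have "joined E2 v z" using assms that by (auto simp: is_tree_def)
      then have "joined ?E v z" by (rule joined_mono) auto
      moreover have "joined ?E u v" by (rule joined_edge) simp
      ultimately show ?thesis using joined_trans by metis
    qed
    then show ?thesis using xy joined_sym joined_trans by metis
  qed
  moreover have "\<nexists>xs. is_cycle ?E xs"
  proof
    assume "\<exists>xs. is_cycle ?E xs"
    then obtain xs where "is_cycle ?E xs" by blast
    then obtain a b where ab: "{a, b} \<in> ?E" "joined (?E - {{a, b}}) a b"
      by (rule cycle_edge_not_bridge)
    consider "{a, b} = {u, v}" | "{a, b} \<in> E1" | "{a, b} \<in> E2" using ab by blast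
    then show False
    proof cases
      case 1
      have "?E - {{a, b}} = E1 \<union> E2" using 1 new by auto
      then have "joined (E1 \<union> E2) a b" using ab by simp
      then have "joined (E1 \<union> E2) u v" using 1 joined_sym by (metis doubleton_eq_iff)
      then have "v \<in> V1" by (rule joined_preserves) (use U assms in blast)+
      then show False using assms by blast
    next
      case 2
      then have abV: "a \<in> V1" "b \<in> V1" "a \<noteq> b" using U c2[of "{a, b}"] by auto
      \<comment> \<open>Retraction onto \<open>V1\<close> that collapses everything outside
        \<open>V1\<close> to \<open>u\<close>. Edges of \<open>E2\<close> and the new edge become
        trivial, so a walk avoiding \<open>{a, b}\<close> turns into a walk in \<open>E1\<close>
        avoiding \<open>{a, b}\<close>, although this edge is a bridge of \<open>E1\<close>.\<close>
      have "joined (E1 - {{a, b}}) (if a \<in> V1 then a else u) (if b \<in> V1 then b else u)"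
        using ab(2)
      proof (rule joined_map[where p = "\<lambda>z. if z \<in> V1 then z else u"])
        fix c d assume "{c, d} \<in> ?E - {{a, b}}"
        then consider "{c, d} = {u, v}" | "{c, d} \<in> E1 - {{a, b}}" | "{c, d} \<in> E2" by blast
        then show "joined (E1 - {{a, b}}) (if c \<in> V1 then c else u) (if d \<in> V1 then d else u)"
        proof cases
          case 1
          then show ?thesis using assms by (auto simp: doubleton_eq_iff)
        next
          case 2
          then have "c \<in> V1" "d \<in> V1" using U by auto
          then show ?thesis using joined_edge[OF 2] by simp
        next
          case 3
          then have "c \<notin> V1" "d \<notin> V1" using U assms(3) by auto
          then show ?thesis by simp
        qed
      qed
      then show False using acyclic_edge_bridge[OF ac(1) 2 abV(3)] abV by simp
    next
      case 3
      then have abV: "a \<in> V2" "b \<in> V2" "a \<noteq> b" using U c2[of "{a, b}"] by auto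
      have "joined (E2 - {{a, b}}) (if a \<in> V2 then a else v) (if b \<in> V2 then b else v)"
        using ab(2)
      proof (rule joined_map[where p = "\<lambda>z. if z \<in> V2 then z else v"])
        fix c d assume "{c, d} \<in> ?E - {{a, b}}"
        then consider "{c, d} = {u, v}" | "{c, d} \<in> E2 - {{a, b}}" | "{c, d} \<in> E1" by blast
        then show "joined (E2 - {{a, b}}) (if c \<in> V2 then c else v) (if d \<in> V2 then d else v)"
        proof cases
          case 1
          then show ?thesis using assms by (auto simp: doubleton_eq_iff)
        next
          case 2
          then have "c \<in> V2" "d \<in> V2" using U by auto
          then show ?thesis using joined_edge[OF 2] by simp
        next
          case 3
          then have "c \<notin> V2" "d \<notin> V2" using U assms(3) by auto
          then show ?thesis by simp
        qed
      qed
      then show False using acyclic_edge_bridge[OF ac(2) 3 abV(3)] abV by simp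
    qed
  qed
  ultimately show "is_tree (V1 \<union> V2) ?E" unfolding is_tree_def by blast
qed

lemma is_tree_card_edges:
  assumes "is_tree V E"
  shows "card E + 1 = card V"
  using assms
proof (induction "card E" arbitrary: V E rule: less_induct)
  case less
  have fin: "finite E" "finite V" using is_tree_edges2[OF less.prems] less.prems 
    by (auto simp: edges2_def is_tree_def simple_graph_def)
  show ?case
  proof (cases "E = {}")
    case True
    then have "x = y" if "x \<in> V" "y \<in> V" for x y
      using less.prems that joined_isolated[of E x y] by (auto simp: is_tree_def)
    moreover obtain x where "x \<in> V" using less.prems by (auto simp: is_tree_def)
    ultimately have "V = {x}" by blast
    then show ?thesis using True by simp
  next
    case False
    then obtain e where e: "e \<in> E" by blast
    then have "card e = 2" using is_tree_edges2[OF less.prems] by (auto simp: edges2_def)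
    then obtain u v where uv: "e = {u, v}" by (auto simp: card_2_iff)
    define F where "F = E - {{u, v}}"
    define A B where "A = component V F u" and "B = component V F v"
    note sp = tree_edge_split[OF less.prems e[unfolded uv], folded F_def, folded A_def B_def]
    have FE: "F \<subseteq> E" by (auto simp: F_def)
    have tA: "is_tree A (edges_within F A)" and tB: "is_tree B (edges_within F B)"
      unfolding A_def B_def using component_is_tree[OF less.prems FE] sp(1,2) by auto
    have F1: "Suc (card F) = card E" 
      using card.remove[OF fin(1) e] uv by (simp add: F_def)
    then have F: "card F < card E" "card F + 1 = card E" by simp_all
    have "edges_within F A \<inter> edges_within F B = {}"
    proof -
      have "f = {}" if "f \<in> edges_within F A" "f \<in> edges_within F B" for f
        using that sp(4) by (auto simp: edges_within_def)
      moreover have "{} \<notin> F" using is_tree_edges2[OF less.prems] FE unfolding edges2_def by fastforce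
      ultimately show ?thesis by (auto simp: edges_within_def)
    qed
    moreover have "finite (edges_within F A)" "finite (edges_within F B)"
      using fin FE by (auto simp: edges_within_def intro: finite_subset)
    ultimately have "card F = card (edges_within F A) + card (edges_within F B)"
      using sp(6) by (metis card_Un_disjoint)
    moreover have "card V = card A + card B"
      using sp(4,5) fin(2) by (metis card_Un_disjoint finite_Un)
    moreover have "card (edges_within F A) \<le> card F" "card (edges_within F B) \<le> card F"
      using fin FE by (auto simp: edges_within_def intro!: card_mono intro: finite_subset)
    ultimately show ?thesis
      using less.hyps[OF _ tA] less.hyps[OF _ tB] F by simp
  qed
qed

section \<open>Sums over all trees and all sets of marks\<close>

definition trees :: "'a set \<Rightarrow> 'a set set set" where
  "trees V = {E. is_tree V E}"

definition ksubsets :: "'a set \<Rightarrow> nat \<Rightarrow> 'a set set" where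
  "ksubsets V k = {S. S \<subseteq> V \<and> card S = k}"

text \<open>
  In contrast to \<open>cut_pgf\<close>, unmarked components are discarded first and contribute the factor 1.
\<close>

definition forest_pgf :: "real \<Rightarrow> 'a set \<Rightarrow> 'a set set \<Rightarrow> real" where
  "forest_pgf s S E = cut_pgf s S (alive S E)"

definition tree_sum :: "real \<Rightarrow> 'a set \<Rightarrow> nat \<Rightarrow> real" where
  "tree_sum s V k = (\<Sum>E\<in>trees V. \<Sum>S\<in>ksubsets V k. forest_pgf s S E)"

lemma finite_trees: "finite V \<Longrightarrow> finite (trees V)"
  by (rule finite_subset[of _ "Pow (Pow V)"]) (auto simp: trees_def is_tree_def simple_graph_def)

lemma finite_ksubsets: "finite V \<Longrightarrow> finite (ksubsets V k)"
  by (simp add: ksubsets_def)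

lemma alive_restrict:
  assumes "S \<inter> \<Union>E = S' \<inter> \<Union>E"
  shows "alive S E = alive S' E"
proof -
  have "(\<exists>s\<in>S. joined E s v) \<longleftrightarrow> (\<exists>s\<in>S'. joined E s v)" if "v \<in> \<Union>E" for v
  proof -
    have "s \<in> \<Union>E" if "joined E s v" for s
      using joined_isolated[OF that] \<open>v \<in> \<Union>E\<close> by metis
    then show ?thesis using assms by (metis Int_iff)
  qed
  then show ?thesis unfolding alive_def by blast
qed

text \<open>After a tree has been split, each factor must depend only on the marks in its own half;
  this removes the others from \<open>S\<close>.\<close>

lemma cut_pgf_restrict:
  assumes "edges2 E" "S \<inter> \<Union>E = S' \<inter> \<Union>E"
  shows "cut_pgf s S E = cut_pgf s S' E"
  using assms
proof (induction "card E" arbitrary: E rule: less_induct)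
  case less
  show ?case
  proof (cases "E = {}")
    case False
    have fin: "finite E" using less.prems by (simp add: edges2_def)
    have "cut_pgf s S (alive S (E - {e})) = cut_pgf s S' (alive S' (E - {e}))" if "e \<in> E" for e
    proof -
      have "alive S (E - {e}) = alive S' (E - {e})"
        using less.prems by (intro alive_restrict) blast
      moreover have "cut_pgf s S (alive S (E - {e})) = cut_pgf s S' (alive S (E - {e}))"
      proof (rule less.hyps)
        show "card (alive S (E - {e})) < card E"
          using fin that alive_subset[of S "E - {e}"] by (auto intro!: psubset_card_mono)
        show "edges2 (alive S (E - {e}))"
          using less.prems(1) by (rule edges2_subset) (use alive_subset in fastforce)
        show "S \<inter> \<Union>(alive S (E - {e})) = S' \<inter> \<Union>(alive S (E - {e}))"
          using less.prems(2) alive_subset[of S "E - {e}"] by blast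
      qed
      ultimately show ?thesis by simp
    qed
    then show ?thesis
      using False less.prems(1) by (simp add: cut_pgf_rec)
  qed simp
qed

lemma forest_pgf_restrict:
  assumes "edges2 E" "S \<inter> \<Union>E = S' \<inter> \<Union>E"
  shows "forest_pgf s S E = forest_pgf s S' E"
proof -
  have "cut_pgf s S (alive S' E) = cut_pgf s S' (alive S' E)"
  proof (rule cut_pgf_restrict)
    show "edges2 (alive S' E)" using assms(1) by (rule edges2_alive)
    show "S \<inter> \<Union> (alive S' E) = S' \<inter> \<Union> (alive S' E)"
      using assms(2) alive_subset[of S' E] by blast
  qed
  then show ?thesis using alive_restrict[OF assms(2)] by (simp add: forest_pgf_def)
qed

lemma forest_pgf_union:
  assumes "edges2 E" "edges2 F" "\<Union>E \<inter> \<Union>F = {}"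
  shows "forest_pgf s S (E \<union> F) = forest_pgf s S E * forest_pgf s S F"
  unfolding forest_pgf_def alive_union[OF assms(3)]
proof (rule cut_pgf_union)
  show "\<Union>(alive S E) \<inter> \<Union>(alive S F) = {}"
    using assms(3) alive_subset[of S E] alive_subset[of S F] by blast
qed (simp_all add: assms edges2_alive alive_alive)

lemma forest_pgf_no_marks [simp]: "forest_pgf s {} E = 1"
  by (simp add: forest_pgf_def alive_def)

lemma forest_pgf_bounds:
  assumes "0 \<le> s" "s \<le> 1"
  shows "0 \<le> forest_pgf s S E" "forest_pgf s S E \<le> 1"
  using cut_pgf_bounds[OF assms] by (auto simp: forest_pgf_def)

lemma alive_tree:
  assumes "is_tree V E" "S \<subseteq> V" "S \<noteq> {}"
  shows "alive S E = E"
proof -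
  have "\<exists>s\<in>S. \<exists>v\<in>e. joined E s v" if "e \<in> E" for e
  proof -
    obtain s where s: "s \<in> S" "s \<in> V" using assms by blast
    moreover have "e \<noteq> {}" using is_tree_edges2[OF assms(1)] that by (auto simp: edges2_def)
    then obtain v where "v \<in> e" by blast
    moreover have "v \<in> V" using is_tree_Union[OF assms(1)] that \<open>v \<in> e\<close> by blast
    moreover have "joined E s v" using assms(1) s(2) \<open>v \<in> V\<close> unfolding is_tree_def by simp
    ultimately show ?thesis by blast
  qed
  then show ?thesis by (auto simp: alive_def)
qed

text \<open>\<open>card V - 1\<close> is the number of edges. A tree without marks is discarded
  before any cut and has value 1, so the factor \<open>s\<close> of the first cut becomes 1. One
  recursion then serves all numbers of marks, and without marks it counts trees.\<close>

lemma forest_pgf_tree_rec: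
  assumes "is_tree V E" "S \<subseteq> V" "card V \<ge> 2"
  shows "real (card V - 1) * forest_pgf s S E = 
    (if card S = 0 then 1 else s) * (\<Sum>e\<in>E. forest_pgf s S (E - {e}))"
proof -
  have c: "card V - 1 = card E" using is_tree_card_edges[OF assms(1)] by simp
  have fin: "finite V" "finite S" using assms by (auto simp: is_tree_def simple_graph_def intro: finite_subset)
  have cE: "card E \<noteq> 0" using assms(3) c by linarith
  then have E: "E \<noteq> {}" by auto
  show ?thesis
  proof (cases "S = {}")
    case False
    have "forest_pgf s S E = cut_pgf s S E"
      using alive_tree[OF assms(1,2) False] by (simp add: forest_pgf_def)
    also have "\<dots> = s / card E * (\<Sum>e\<in>E. forest_pgf s S (E - {e}))"
      using cut_pgf_rec[OF is_tree_edges2[OF assms(1)] E] by (simp add: forest_pgf_def)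
    finally show ?thesis using cE c False fin by simp
  qed (use c in simp)
qed

lemma sum_edges_ordered:
  fixes h :: "'a set \<Rightarrow> real"
  assumes "edges2 E"
  shows "(\<Sum>(u, v)\<in>{(u, v). {u, v} \<in> E}. h {u, v}) = 2 * (\<Sum>e\<in>E. h e)"
proof -
  have finE: "finite E" using assms by (simp add: edges2_def)
  have 2: "\<exists>a b. a \<noteq> b \<and> e = {a, b}" if "e \<in> E" for e
    using assms that unfolding edges2_def by (metis card_2_iff)
  let ?P = "\<lambda>e. {(u, v). {u, v} = e}"
  have P: "finite (?P e)" "card (?P e) = 2" if e: "e \<in> E" for e
  proof -
    obtain a b where ab: "a \<noteq> b" "e = {a, b}" using 2[OF e] by blast
    then have "?P e = {(a, b), (b, a)}" by (auto simp: doubleton_eq_iff)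
    then show "finite (?P e)" "card (?P e) = 2" using ab by auto
  qed
  have "{(u, v). {u, v} \<in> E} = (\<Union>e\<in>E. ?P e)" by auto
  then have "(\<Sum>(u, v)\<in>{(u, v). {u, v} \<in> E}. h {u, v}) = (\<Sum>e\<in>E. \<Sum>(u, v)\<in>?P e. h {u, v})"
    using finE P(1) by (subst sum.UNION_disjoint[symmetric]) auto
  also have "\<dots> = (\<Sum>e\<in>E. \<Sum>p\<in>?P e. h e)"
    by (intro sum.cong refl) auto
  also have "\<dots> = (\<Sum>e\<in>E. 2 * h e)"
    using P(2) by (intro sum.cong refl) simp
  finally show ?thesis by (simp add: sum_distrib_left)
qed

lemma sum_ksubsets_split:
  fixes f g :: "'a set \<Rightarrow> real"
  assumes "finite V" "A \<subseteq> V"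
  shows "(\<Sum>S\<in>ksubsets V k. f (S \<inter> A) * g (S - A)) =
    (\<Sum>j\<le>k. (\<Sum>S\<in>ksubsets A j. f S) * (\<Sum>S\<in>ksubsets (V - A) (k - j). g S))"
proof -
  have fin: "finite A" "finite (V - A)" using assms finite_subset by auto
  have "(\<Sum>j\<le>k. (\<Sum>S\<in>ksubsets A j. f S) * (\<Sum>S\<in>ksubsets (V - A) (k - j). g S)) =
     (\<Sum>j\<le>k. \<Sum>(S, T)\<in>ksubsets A j \<times> ksubsets (V - A) (k - j). f S * g T)"
    by (simp add: sum_product sum.cartesian_product)
  also have "\<dots> = (\<Sum>(j, S, T)\<in>(SIGMA j:{..k}. ksubsets A j \<times> ksubsets (V - A) (k - j)). f S * g T)"
    using fin by (subst sum.Sigma) (auto simp: finite_ksubsets)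
  also have "\<dots> = (\<Sum>S\<in>ksubsets V k. f (S \<inter> A) * g (S - A))"
  proof (rule sum.reindex_bij_witness[where 
        i = "\<lambda>S. (card (S \<inter> A), S \<inter> A, S - A)" and j = "\<lambda>(j, S, T). S \<union> T"], goal_cases)
    case (1 a)
    then obtain S T where a: "a = (card S, S, T)" "S \<subseteq> A" "T \<subseteq> V - A"
      by (cases a) (auto simp: ksubsets_def)
    then have "(S \<union> T) \<inter> A = S" "(S \<union> T) - A = T" by auto
    then show ?case by (simp add: a(1))
  next
    case (2 a)
    then obtain j S T where a: "a = (j, S, T)" "j \<le> k" "S \<subseteq> A" "T \<subseteq> V - A" "card S = j" "card T = k - j"
      by (cases a) (auto simp: ksubsets_def)
    then have "finite S" "finite T" "S \<inter> T = {}"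
      using finite_subset[OF _ fin(1), of S] finite_subset[OF _ fin(2), of T] by auto
    then have "card (S \<union> T) = k" using a by (simp add: card_Un_disjoint)
    then show ?case using a assms by (auto simp: ksubsets_def)
  next
    case (3 S)
    then show ?case by auto
  next
    case (4 S)
    then have S: "S \<subseteq> V" "card S = k" "finite S" using assms finite_subset by (auto simp: ksubsets_def)
    have "card (S \<inter> A) + card (S - A) = k"
      using S by (metis Diff_Diff_Int card_Diff_subset_Int card_mono finite_Int inf_le1 le_add_diff_inverse)
    then show ?case using S by (auto simp: ksubsets_def)
  next
    case (5 a)
    then have "\<And>S T. S \<subseteq> A \<Longrightarrow> T \<subseteq> V - A \<Longrightarrow> (S \<union> T) \<inter> A = S \<and> (S \<union> T) - A = T"
      by auto
    moreover obtain j S T where a: "a = (j, S, T)" "S \<subseteq> A" "T \<subseteq> V - A"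
      using 5 by (cases a) (auto simp: ksubsets_def)
    ultimately show ?case by simp
  qed
  finally show ?thesis ..
qed

text \<open>Double counting of trees with an oriented edge from \<open>u\<close> to
  \<open>v\<close>: they correspond to a vertex set \<open>A\<close>, a tree on \<open>A\<close>
  with a vertex \<open>u\<close>, and a tree on the complement with a vertex \<open>v\<close>. The
  factor 2 counts orientations, the two cardinalities count the choices of \<open>u\<close> and
  \<open>v\<close>, and the generating function factorises by
  \<open>forest_pgf_union\<close>.\<close>

lemma tree_sum_rec:
  assumes "finite V" "card V \<ge> 2"
  shows "2 * real (card V - 1) * tree_sum s V k = (if k = 0 then 1 else s) *
    (\<Sum>A\<in>Pow V. real (card A) * real (card (V - A)) *
       (\<Sum>j\<le>k. tree_sum s A j * tree_sum s (V - A) (k - j)))"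
proof -
  let ?r = "if k = 0 then 1 else s"
  define G where "G = (\<lambda>F. \<Sum>S\<in>ksubsets V k. forest_pgf s S F)"
  define D1 where "D1 = (SIGMA E:trees V. {(u, v). {u, v} \<in> E})"
  define D2 where "D2 = (SIGMA A:Pow V. trees A \<times> trees (V - A) \<times> A \<times> (V - A))"
  define H where "H = (\<lambda>A E1 E2. \<Sum>S\<in>ksubsets V k. forest_pgf s (S \<inter> A) E1 * forest_pgf s (S - A) E2)"
  have pairs_fin: "finite {(u, v). {u, v} \<in> E}" if "E \<in> trees V" for E
  proof -
    have "{(u, v). {u, v} \<in> E} \<subseteq> V \<times> V"
      using is_tree_Union[of V E] that by (auto simp: trees_def)
    then show ?thesis using assms(1) by (meson finite_SigmaI finite_subset)
  qed
  have "2 * real (card V - 1) * tree_sum s V k = 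
     (\<Sum>E\<in>trees V. \<Sum>S\<in>ksubsets V k. 2 * (real (card V - 1) * forest_pgf s S E))"
    by (simp add: tree_sum_def sum_distrib_left mult.assoc)
  also have "\<dots> = (\<Sum>E\<in>trees V. \<Sum>S\<in>ksubsets V k. 2 * (?r * (\<Sum>e\<in>E. forest_pgf s S (E - {e}))))"
  proof (intro sum.cong refl)
    fix E S assume "E \<in> trees V" "S \<in> ksubsets V k"
    then show "2 * (real (card V - 1) * forest_pgf s S E) = 2 * (?r * (\<Sum>e\<in>E. forest_pgf s S (E - {e})))"
      using forest_pgf_tree_rec[of V E S s] assms by (auto simp: trees_def ksubsets_def)
  qed
  also have "\<dots> = ?r * (\<Sum>E\<in>trees V. 2 * (\<Sum>e\<in>E. G (E - {e})))"
    unfolding G_def by (subst sum.swap) (simp add: sum_distrib_left mult_ac)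
  also have "(\<Sum>E\<in>trees V. 2 * (\<Sum>e\<in>E. G (E - {e}))) = 
      (\<Sum>E\<in>trees V. \<Sum>(u, v)\<in>{(u, v). {u, v} \<in> E}. G (E - {{u, v}}))"
  proof (intro sum.cong refl)
    fix E assume "E \<in> trees V"
    then have "edges2 E" using is_tree_edges2 by (auto simp: trees_def)
    from sum_edges_ordered[OF this, of "\<lambda>e. G (E - {e})"]
    show "2 * (\<Sum>e\<in>E. G (E - {e})) = (\<Sum>(u, v)\<in>{(u, v). {u, v} \<in> E}. G (E - {{u, v}}))"
      by simp
  qed
  also have "\<dots> = (\<Sum>(E, u, v)\<in>D1. G (E - {{u, v}}))"
    unfolding D1_def using pairs_fin finite_trees[OF assms(1)]
    by (subst sum.Sigma) (auto simp: case_prod_beta)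
  also have "\<dots> = (\<Sum>(A, E1, E2, u, v)\<in>D2. H A E1 E2)"
  proof (rule sum.reindex_bij_witness[where 
      j = "\<lambda>(E, u, v). (component V (E - {{u, v}}) u,
              edges_within (E - {{u, v}}) (component V (E - {{u, v}}) u),
              edges_within (E - {{u, v}}) (component V (E - {{u, v}}) v), u, v)" and
      i = "\<lambda>(A, E1, E2, u, v). (insert {u, v} (E1 \<union> E2), u, v)"], goal_cases)
    case (1 a)
    then obtain E u v where a: "a = (E, u, v)" "is_tree V E" "{u, v} \<in> E"
      by (auto simp: D1_def trees_def)
    from tree_edge_split(6)[OF a(2,3)] a show ?case by (auto simp: insert_absorb)
  next
    case (2 a)
    then obtain E u v where a: "a = (E, u, v)" "is_tree V E" "{u, v} \<in> E"
      by (auto simp: D1_def trees_def)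
    define F where "F = E - {{u, v}}"
    note sp = tree_edge_split[OF a(2,3), folded F_def]
    have FE: "F \<subseteq> E" by (auto simp: F_def)
    have "component V F v = V - component V F u" using sp(4,5) by blast
    then show ?case
      using component_is_tree[OF a(2) FE sp(1)] component_is_tree[OF a(2) FE sp(2)] sp
      unfolding a(1) D2_def F_def[symmetric]
      by (auto simp: trees_def F_def[symmetric] component_def)
  next
    case (3 a)
    then obtain A E1 E2 u v where a: "a = (A, E1, E2, u, v)" "A \<subseteq> V" "is_tree A E1" "is_tree (V - A) E2" 
      "u \<in> A" "v \<in> V - A" by (auto simp: D2_def trees_def)
    have disj: "A \<inter> (V - A) = {}" "(V - A) \<inter> A = {}" by auto
    have F: "insert {u, v} (E1 \<union> E2) - {{u, v}} = E1 \<union> E2"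
      using tree_join(2)[OF a(3,4) disj(1) a(5,6)] by blast
    have "component V (E1 \<union> E2) u = A" "edges_within (E1 \<union> E2) A = E1"
      using component_join[OF a(3,4) disj(1) a(5) a(2)] by auto
    moreover have "component V (E1 \<union> E2) v = V - A" "edges_within (E1 \<union> E2) (V - A) = E2"
      using component_join[OF a(4,3) disj(2) a(6), of V] by (auto simp: Un_commute)
    ultimately show ?case by (simp add: a(1) F)
  next
    case (4 a)
    then obtain A E1 E2 u v where a: "a = (A, E1, E2, u, v)" "A \<subseteq> V" "is_tree A E1" "is_tree (V - A) E2" 
      "u \<in> A" "v \<in> V - A" by (auto simp: D2_def trees_def)
    have "is_tree (A \<union> (V - A)) (insert {u, v} (E1 \<union> E2))"
      using a by (intro tree_join) auto
    moreover have "A \<union> (V - A) = V" using a by blast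
    ultimately show ?case by (simp add: a(1) D1_def trees_def)
  next
    case (5 a)
    then obtain E u v where a: "a = (E, u, v)" "is_tree V E" "{u, v} \<in> E"
      by (auto simp: D1_def trees_def)
    define F A B where "F = E - {{u, v}}" and "A = component V F u" and "B = component V F v"
    note sp = tree_edge_split[OF a(2,3), folded F_def, folded A_def B_def]
    have FE: "F \<subseteq> E" by (auto simp: F_def)
    have tA: "is_tree A (edges_within F A)" and tB: "is_tree B (edges_within F B)"
      unfolding A_def B_def using component_is_tree[OF a(2) FE] sp(1,2) by auto
    have U: "\<Union>(edges_within F A) \<subseteq> A" "\<Union>(edges_within F B) \<subseteq> B" 
      using is_tree_Union[OF tA] is_tree_Union[OF tB] .
    have "forest_pgf s S F = forest_pgf s (S \<inter> A) (edges_within F A) * forest_pgf s (S - A) (edges_within F B)"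
      for S
    proof -
      have "forest_pgf s S F = forest_pgf s S (edges_within F A) * forest_pgf s S (edges_within F B)"
        by (subst sp(6)[symmetric], rule forest_pgf_union)
           (use is_tree_edges2[OF tA] is_tree_edges2[OF tB] U sp(4) in auto)
      also have "forest_pgf s S (edges_within F A) = forest_pgf s (S \<inter> A) (edges_within F A)"
        by (rule forest_pgf_restrict[OF is_tree_edges2[OF tA]]) (use U in blast)
      also have "forest_pgf s S (edges_within F B) = forest_pgf s (S - A) (edges_within F B)"
        by (rule forest_pgf_restrict[OF is_tree_edges2[OF tB]]) (use U sp(4) in blast)
      finally show ?thesis .
    qed
    then show ?case by (simp add: a(1) H_def G_def F_def A_def B_def)
  qed
  also have "\<dots> = (\<Sum>A\<in>Pow V. \<Sum>E1\<in>trees A. \<Sum>E2\<in>trees (V - A). \<Sum>u\<in>A. \<Sum>v\<in>V - A. H A E1 E2)"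
  proof -
    have fin: "finite (trees A \<times> trees (V - A) \<times> A \<times> (V - A))" if "A \<in> Pow V" for A
      using that assms(1) finite_subset[of A V] by (auto intro!: finite_cartesian_product finite_trees)
    have "(\<Sum>(A, E1, E2, u, v)\<in>D2. H A E1 E2) =
      (\<Sum>A\<in>Pow V. \<Sum>(E1, E2, u, v)\<in>trees A \<times> trees (V - A) \<times> A \<times> (V - A). H A E1 E2)"
      unfolding D2_def using fin assms(1) by (subst sum.Sigma) auto
    then show ?thesis
      by (simp only: sum.cartesian_product case_prod_unfold)
  qed
  also have "\<dots> = (\<Sum>A\<in>Pow V. real (card A) * real (card (V - A)) * (\<Sum>E1\<in>trees A. \<Sum>E2\<in>trees (V - A). H A E1 E2))"
    by (simp add: sum_distrib_left mult_ac)
  also have "\<dots> = (\<Sum>A\<in>Pow V. real (card A) * real (card (V - A)) *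
       (\<Sum>j\<le>k. tree_sum s A j * tree_sum s (V - A) (k - j)))"
  proof (intro sum.cong refl arg_cong2[where f = "(*)"])
    fix A assume A: "A \<in> Pow V"
    have "(\<Sum>E1\<in>trees A. \<Sum>E2\<in>trees (V - A). H A E1 E2) =
      (\<Sum>E1\<in>trees A. \<Sum>E2\<in>trees (V - A). \<Sum>j\<le>k. (\<Sum>S\<in>ksubsets A j. forest_pgf s S E1) *
          (\<Sum>S\<in>ksubsets (V - A) (k - j). forest_pgf s S E2))"
      unfolding H_def using sum_ksubsets_split[OF assms(1), of A "\<lambda>S. forest_pgf s S _" "\<lambda>S. forest_pgf s S _" k] A
      by (intro sum.cong refl) auto
    also have "\<dots> = (\<Sum>E1\<in>trees A. \<Sum>j\<le>k. \<Sum>E2\<in>trees (V - A). (\<Sum>S\<in>ksubsets A j. forest_pgf s S E1) *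
          (\<Sum>S\<in>ksubsets (V - A) (k - j). forest_pgf s S E2))"
      by (intro sum.cong refl sum.swap)
    also have "\<dots> = (\<Sum>j\<le>k. \<Sum>E1\<in>trees A. \<Sum>E2\<in>trees (V - A). (\<Sum>S\<in>ksubsets A j. forest_pgf s S E1) *
          (\<Sum>S\<in>ksubsets (V - A) (k - j). forest_pgf s S E2))"
      by (rule sum.swap)
    also have "\<dots> = (\<Sum>j\<le>k. tree_sum s A j * tree_sum s (V - A) (k - j))"
      by (simp add: tree_sum_def sum_product)
    finally show "(\<Sum>E1\<in>trees A. \<Sum>E2\<in>trees (V - A). H A E1 E2) = 
      (\<Sum>j\<le>k. tree_sum s A j * tree_sum s (V - A) (k - j))" .
  qed
  finally show ?thesis .
qed

section \<open>Recursion for the number of cuts in a uniform tree\<close>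

lemma trees_empty [simp]: "trees {} = {}"
  by (auto simp: trees_def is_tree_def)

lemma ksubsets_0: "finite V \<Longrightarrow> ksubsets V 0 = {{}}"
  by (auto simp: ksubsets_def dest: finite_subset)

lemma trees_singleton: "trees {x} = {{}}"
proof -
  have "E = {}" if "is_tree {x} E" for E
    using is_tree_card_edges[OF that] is_tree_edges2[OF that] by (auto simp: edges2_def)
  moreover have "is_tree {x} {}"
    by (auto simp: is_tree_def simple_graph_def is_cycle_def adjacent_def)
  ultimately show ?thesis by (auto simp: trees_def)
qed

lemma tree_sum_empty [simp]: "tree_sum s {} k = 0"
  by (simp add: tree_sum_def)

lemma tree_sum_singleton: "tree_sum s {x} k = real (1 choose k)"
proof -
  have "alive S {} = {}" for S :: "'a set" by (simp add: alive_def)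
  then have "tree_sum s {x} k = real (card (ksubsets {x} k))"
    by (simp add: tree_sum_def trees_singleton forest_pgf_def)
  also have "card (ksubsets {x} k) = 1 choose k"
    unfolding ksubsets_def by (subst n_subsets) auto
  finally show ?thesis .
qed

lemma sum_Pow_card:
  assumes "finite V"
  shows "(\<Sum>A\<in>Pow V. f (card A)) = (\<Sum>a\<le>card V. real (card V choose a) * f a)"
proof -
  have "(\<Sum>A\<in>Pow V. f (card A)) = (\<Sum>a\<le>card V. \<Sum>A\<in>{A \<in> Pow V. card A = a}. f (card A))"
    using assms by (intro sum.group[symmetric]) (auto intro: card_mono)
  also have "\<dots> = (\<Sum>a\<le>card V. real (card V choose a) * f a)"
    using assms by (intro sum.cong refl) (simp add: n_subsets Pow_def)
  finally show ?thesis .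
qed

text \<open>The normalisation turns the recursion into a Cauchy product.\<close>

definition tree_weight :: "real \<Rightarrow> nat \<Rightarrow> nat \<Rightarrow> real" where
  "tree_weight s n k = real n / fact n * tree_sum s {1..n} k"

text \<open>Invariance under relabelling follows from the recursion by induction on the size, which
  avoids transporting \<open>num_cuts\<close> along bijections. Terms with an empty half, where the
  other half is \<open>V\<close> itself, carry a factor 0.\<close>

lemma tree_sum_card:
  fixes V :: "nat set"
  assumes "finite V"
  shows "tree_sum s V k = tree_sum s {1..card V} k"
    and "card V \<ge> 2 \<Longrightarrow> 2 * real (card V - 1) * tree_sum s V k = (if k = 0 then 1 else s) *
      (\<Sum>a\<le>card V. real (card V choose a) * (real a * real (card V - a) *
       (\<Sum>j\<le>k. tree_sum s {1..a} j * tree_sum s {1..card V - a} (k - j))))"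
proof -
  have rec: "2 * real (card V - 1) * tree_sum s V k = (if k = 0 then 1 else s) *
      (\<Sum>a\<le>card V. real (card V choose a) * (real a * real (card V - a) *
       (\<Sum>j\<le>k. tree_sum s {1..a} j * tree_sum s {1..card V - a} (k - j))))"
    if V: "finite V" "card V \<ge> 2" 
      and IH: "\<And>(W :: nat set) k. finite W \<Longrightarrow> card W < card V \<Longrightarrow> tree_sum s W k = tree_sum s {1..card W} k" 
    for V :: "nat set" and k
  proof -
    have "real (card A) * real (card (V - A)) *
       (\<Sum>j\<le>k. tree_sum s A j * tree_sum s (V - A) (k - j)) = real (card A) * real (card V - card A) *
       (\<Sum>j\<le>k. tree_sum s {1..card A} j * tree_sum s {1..card V - card A} (k - j))" 
      if A: "A \<in> Pow V" for A
    proof -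
      have fin: "finite A" "card A \<le> card V" 
        using A V by (auto intro: finite_subset card_mono)
      have c: "card (V - A) = card V - card A" 
        using A by (intro card_Diff_subset fin) auto
      show ?thesis
      proof (cases "card A = 0 \<or> card A = card V")
        case False
        then have "card A < card V" "card (V - A) < card V" using fin(2) c by linarith+
        then show ?thesis using IH[of A] IH[of "V - A"] fin V c by simp
      qed (auto simp: c)
    qed
    then show ?thesis
      unfolding tree_sum_rec[OF V] sum_Pow_card[OF V(1), symmetric] by (auto intro!: sum.cong)
  qed
  have *: "tree_sum s V k = tree_sum s {1..card V} k" if "finite V" for V :: "nat set" and k
    using that
  proof (induction "card V" arbitrary: V k rule: less_induct)
    case less
    consider "card V = 0" | "card V = 1" | "card V \<ge> 2" by linarith
    then show ?case
    proof cases
      case 1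
      then show ?thesis using less.prems by simp
    next
      case 2
      then obtain x where "V = {x}" by (auto simp: card_1_singleton_iff)
      then show ?thesis by (simp add: tree_sum_singleton)
    next
      case 3
      have "2 * real (card V - 1) * tree_sum s V k = 2 * real (card {1..card V} - 1) * tree_sum s {1..card V} k"
      proof -
        have IH: "tree_sum s W k = tree_sum s {1..card W} k" if "finite W" "card W < card V" for W :: "nat set" and k
          using less.hyps that by blast
        have c: "card {1..card V} = card V" by simp
        show ?thesis
          unfolding c by (rule trans[OF rec[OF less.prems 3 IH] 
            rec[of "{1..card V}" k, unfolded c, OF finite_atLeastAtMost 3 IH, symmetric]])
      qed
      then show ?thesis using 3 by simp
    qed
  qed
  then show "tree_sum s V k = tree_sum s {1..card V} k" using assms .
  show "2 * real (card V - 1) * tree_sum s V k = (if k = 0 then 1 else s) *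
      (\<Sum>a\<le>card V. real (card V choose a) * (real a * real (card V - a) *
       (\<Sum>j\<le>k. tree_sum s {1..a} j * tree_sum s {1..card V - a} (k - j))))" if "card V \<ge> 2"
    by (rule rec[OF assms that *])
qed

lemma tree_weight_0 [simp]: "tree_weight s 0 k = 0"
  by (simp add: tree_weight_def)

lemma tree_weight_1: "tree_weight s (Suc 0) k = real (1 choose k)"
  by (simp add: tree_weight_def tree_sum_singleton)

lemma tree_weight_rec:
  "2 * (real n - 1) * tree_weight s n k = (if k = 0 then 1 else s) * real n *
     (\<Sum>a\<le>n. \<Sum>j\<le>k. tree_weight s a j * tree_weight s (n - a) (k - j))"
proof -
  consider "n = 0" | "n = 1" | "n \<ge> 2" by linarith
  then show ?thesis
  proof cases
    case 3
    have *: "real (n choose a) * (real a * real (n - a) *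
       (\<Sum>j\<le>k. tree_sum s {1..a} j * tree_sum s {1..n - a} (k - j))) / fact n =
       (\<Sum>j\<le>k. tree_weight s a j * tree_weight s (n - a) (k - j))" if "a \<le> n" for a
      using that by (simp add: tree_weight_def sum_distrib_left sum_divide_distrib binomial_fact mult_ac)
    have "2 * (real n - 1) * tree_weight s n k = 
        real n * (2 * real (card {1..n} - 1) * tree_sum s {1..n} k / fact n)"
      using 3 by (simp add: tree_weight_def of_nat_diff)
    also have "\<dots> = real n * ((if k = 0 then 1 else s) *
      (\<Sum>a\<le>n. real (n choose a) * (real a * real (n - a) *
       (\<Sum>j\<le>k. tree_sum s {1..a} j * tree_sum s {1..n - a} (k - j)))) / fact n)"
      using tree_sum_card(2)[of "{1..n}" s k] 3 by simp
    also have "\<dots> = real n * (if k = 0 then 1 else s) *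
      (\<Sum>a\<le>n. real (n choose a) * (real a * real (n - a) *
       (\<Sum>j\<le>k. tree_sum s {1..a} j * tree_sum s {1..n - a} (k - j))) / fact n)"
      by (simp only: sum_divide_distrib[symmetric] times_divide_eq_right mult.assoc)
    also have "(\<Sum>a\<le>n. real (n choose a) * (real a * real (n - a) *
       (\<Sum>j\<le>k. tree_sum s {1..a} j * tree_sum s {1..n - a} (k - j))) / fact n) = 
       (\<Sum>a\<le>n. \<Sum>j\<le>k. tree_weight s a j * tree_weight s (n - a) (k - j))"
      by (intro sum.cong refl *) auto
    finally show ?thesis by simp
  qed auto
qed

lemma tree_weight_nonneg: "0 \<le> s \<Longrightarrow> s \<le> 1 \<Longrightarrow> 0 \<le> tree_weight s n k"
  unfolding tree_weight_def tree_sum_def by (intro mult_nonneg_nonneg sum_nonneg forest_pgf_bounds) auto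

lemma tree_weight_unmarked: "tree_weight s n 0 = tree_weight 1 n 0"
proof -
  have "ksubsets {1..n} 0 = {{}}" by (rule ksubsets_0) simp
  then show ?thesis by (simp add: tree_weight_def tree_sum_def)
qed

lemma cut_pgf_1 [simp]: "cut_pgf 1 S E = 1"
  by (simp add: cut_pgf_def)

lemma tree_weight_marks: "tree_weight 1 n k = real (n choose k) * tree_weight 1 n 0"
proof -
  have "ksubsets {1..n} 0 = {{}}" by (rule ksubsets_0) simp
  moreover have "card (ksubsets {1..n} k) = n choose k" 
    unfolding ksubsets_def by (subst n_subsets) auto
  ultimately show ?thesis by (simp add: tree_weight_def tree_sum_def forest_pgf_def)
qed

lemma tree_weight_le: 
  assumes "0 \<le> s" "s \<le> 1"
  shows "tree_weight s n k \<le> tree_weight 1 n k"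
  unfolding tree_weight_def tree_sum_def
  by (intro mult_left_mono sum_mono) (use forest_pgf_bounds[OF assms] in \<open>auto simp: forest_pgf_def\<close>)

text \<open>One summand of the recursion, a single vertex cut off from the rest, is already
  positive. This also provides the existence of a tree on \<open>{1..n}\<close>.\<close>

lemma tree_weight_pos:
  assumes "n > 0"
  shows "tree_weight 1 n 0 > 0"
  using assms
proof (induction n rule: less_induct)
  case (less n)
  show ?case
  proof (cases "n = 1")
    case False
    then have n: "n \<ge> 2" using less.prems by simp
    have "tree_weight 1 1 0 * tree_weight 1 (n - 1) 0 \<le> (\<Sum>a\<le>n. tree_weight 1 a 0 * tree_weight 1 (n - a) 0)"
      using n by (intro member_le_sum) (auto intro!: mult_nonneg_nonneg tree_weight_nonneg)
    moreover have "tree_weight 1 1 0 * tree_weight 1 (n - 1) 0 > 0"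
      using less.IH[of "n - 1"] n by (simp add: tree_weight_1)
    ultimately have "2 * (real n - 1) * tree_weight 1 n 0 > 0"
      unfolding tree_weight_rec using n by simp
    then show ?thesis using n by (simp add: zero_less_mult_iff)
  qed (simp add: tree_weight_1)
qed

section \<open>The killed cutting process\<close>

unbundle no vec_syntax
unbundle fps_syntax

text \<open>The Taylor coefficients of \<open>1 - sqrt (1 - 2 x)\<close>.\<close>

definition cut_coeff :: "nat \<Rightarrow> real" where
  "cut_coeff k = (if k = 0 then 0 else fact (2 * k - 2) / (2 ^ (k - 1) * fact (k - 1) * fact k))"

lemma cut_coeff_Suc:
  assumes "k > 0"
  shows "real (k + 1) * cut_coeff (Suc k) = (2 * real k - 1) * cut_coeff k"
proof -
  obtain m where k: "k = Suc m" using assms by (cases k) auto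
  have "2 * Suc (Suc m) - 2 = Suc (Suc (2 * m))" "2 * Suc m - 2 = 2 * m" by simp_all
  then have f: "(fact (2 * Suc (Suc m) - 2) :: real) = (2 * m + 2) * (2 * m + 1) * fact (2 * Suc m - 2)"
    by (simp add: algebra_simps)
  show ?thesis
    unfolding cut_coeff_def k f
    by (simp add: divide_simps) (simp add: algebra_simps power2_eq_square)
qed

text \<open>The claim amounts to \<open>(1 - C)\<^sup>2 = 1 - 2 x\<close> for the generating
  function \<open>C\<close>. The ratio in \<open>cut_coeff_Suc\<close> gives
  \<open>(1 - 2 x) C' = 1 - C\<close>; hence the defect \<open>D\<close> solves
  \<open>(1 - 2 x) D' = - 2 D\<close> with zero constant term, and so it vanishes.\<close>

lemma cut_coeff_convolution:
  assumes "k \<ge> 2"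
  shows "cut_coeff k = (\<Sum>j\<le>k. cut_coeff j * cut_coeff (k - j)) / 2"
proof -
  define C where "C = Abs_fps cut_coeff"
  have "(1 - 2 * fps_X) * fps_deriv C = 1 - C"
  proof (rule fps_ext)
    fix n show "((1 - 2 * fps_X) * fps_deriv C) $ n = (1 - C) $ n"
    proof (cases n)
      case 0
      then show ?thesis by (simp add: C_def cut_coeff_def)
    next
      case (Suc m)
      have "((1 - 2 * fps_X) * fps_deriv C) $ n = fps_deriv C $ n - 2 * (fps_X * fps_deriv C) $ n"
        by (simp add: algebra_simps fps_numeral_fps_const)
      then show ?thesis using cut_coeff_Suc[of n] Suc
        by (simp add: C_def algebra_simps)
    qed
  qed
  then have C': "(1 - 2 * fps_X) * (1 - C) * fps_deriv C = (1 - C)\<^sup>2"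
    by (simp add: power2_eq_square mult_ac)
  define D where "D = (1 - C)\<^sup>2 - (1 - 2 * fps_X)"
  have "fps_deriv D = 2 - 2 * ((1 - C) * fps_deriv C)"
    unfolding D_def power2_eq_square by (simp add: algebra_simps)
  then have "(1 - 2 * fps_X) * fps_deriv D = (1 - 2 * fps_X) * (2 - 2 * ((1 - C) * fps_deriv C))"
    by simp
  also have "\<dots> = 2 * (1 - 2 * fps_X) - 2 * ((1 - 2 * fps_X) * (1 - C) * fps_deriv C)"
    by (simp add: algebra_simps)
  finally have "(1 - 2 * fps_X) * fps_deriv D = 2 * (1 - 2 * fps_X) - 2 * ((1 - 2 * fps_X) * (1 - C) * fps_deriv C)" .
  then have D': "(1 - 2 * fps_X) * fps_deriv D = - 2 * D"
    unfolding C' D_def by (simp add: algebra_simps)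
  have "D $ n = 0" for n
  proof (induction n)
    case 0
    show ?case by (simp add: D_def C_def cut_coeff_def power2_eq_square)
  next
    case (Suc n)
    have "((1 - 2 * fps_X) * fps_deriv D) $ n = fps_deriv D $ n - 2 * (fps_X * fps_deriv D) $ n"
      by (simp add: algebra_simps fps_numeral_fps_const)
    also have "\<dots> = real (n + 1) * D $ Suc n - 2 * (real n * D $ n)"
      by (cases n) (auto simp: algebra_simps)
    finally have "(- 2 * D) $ n = real (n + 1) * D $ Suc n - 2 * (real n * D $ n)"
      unfolding D' .
    then show ?case using Suc by (simp add: fps_numeral_fps_const)
  qed
  then have "D = 0" by (simp add: fps_eq_iff)
  then have "C * C = 2 * C - 2 * fps_X" unfolding D_def by (simp add: power2_eq_square algebra_simps)
  then have "(C * C) $ k = (2 * C - 2 * fps_X) $ k" by simp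
  moreover have "(2 * C - 2 * fps_X) $ k = 2 * cut_coeff k"
    using assms by (simp add: C_def fps_numeral_fps_const)
  ultimately show ?thesis
    by (simp add: fps_mult_nth C_def atMost_atLeast0)
qed

lemma fps_const_sum: "fps_const (sum f A) = (\<Sum>i\<in>A. fps_const (f i))"
  by (rule fps_ext) (simp add: fps_sum_nth fps_const_def)

section \<open>The tree function and its powers\<close>

locale tree_function =
  fixes \<tau> :: "nat \<Rightarrow> real"
  assumes tau_0: "\<tau> 0 = 0" and tau_1: "\<tau> 1 = 1"
    and tau_rec: "2 * (real n - 1) * \<tau> n = real n * (\<Sum>a\<le>n. \<tau> a * \<tau> (n - a))"
begin

text \<open>In the application \<open>\<tau> n = tree_weight 1 n 0\<close>, the number of rooted
  trees on \<open>n\<close> labels divided by \<open>fact n\<close>, so that this is the tree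
  function.\<close>

definition T :: "real fps" where "T = Abs_fps \<tau>"

lemma T_nth [simp]: "T $ n = \<tau> n"
  by (simp add: T_def)

lemma fps_X_deriv_nth: "(fps_X * fps_deriv F) $ n = real n * F $ n" for F :: "real fps"
  by (cases n) auto

lemma of_nat_fps_mult_nth: "(of_nat c * F) $ n = real c * F $ n" for F :: "real fps"
  by (simp add: fps_of_nat[symmetric])

text \<open>The recursion reads \<open>2 (x T' - T) = x (T\<^sup>2)'\<close>. This equation takes
  the place of \<open>T = x exp T\<close>.\<close>

lemma T_deriv: "fps_X * fps_deriv T * (1 - T) = T"
proof -
  have "2 * (fps_X * fps_deriv T - T) = fps_X * fps_deriv (T * T)"
  proof (rule fps_ext)
    fix n
    have "(2 * (fps_X * fps_deriv T - T)) $ n = 2 * (real n - 1) * \<tau> n"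
      using fps_X_deriv_nth[of T n] by (simp add: fps_numeral_fps_const algebra_simps)
    also have "\<dots> = (fps_X * fps_deriv (T * T)) $ n"
      unfolding fps_X_deriv_nth tau_rec by (simp add: fps_mult_nth atMost_atLeast0)
    finally show "(2 * (fps_X * fps_deriv T - T)) $ n = (fps_X * fps_deriv (T * T)) $ n" .
  qed
  then have "2 * (fps_X * fps_deriv T * (1 - T)) = 2 * T"
    by (simp add: algebra_simps)
  then show ?thesis by simp
qed

text \<open>Multiply \<open>T_deriv\<close> by \<open>m T ^ (m - 1)\<close> and note that
  \<open>x (T ^ m)' T\<close> is \<open>m / (m + 1)\<close> times
  \<open>x (T ^ (m + 1))'\<close>.\<close>

lemma T_power_Suc_nth:
  assumes "m > 0"
  shows "real m * real n * (T ^ Suc m) $ n = real (m + 1) * (real n - real m) * (T ^ m) $ n"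
proof -
  have dp: "fps_deriv (T ^ j) = of_nat j * fps_deriv T * T ^ (j - 1)" for j
    by (simp only: fps_deriv_power fps_of_nat)
  have m: "T ^ (m - 1) * T = T ^ m" using power_minus_mult[of m T] assms by simp
  have "fps_X * fps_deriv (T ^ m) * (1 - T) = of_nat m * T ^ (m - 1) * (fps_X * fps_deriv T * (1 - T))"
    unfolding dp by (simp only: mult_ac)
  also have "\<dots> = of_nat m * T ^ m"
    unfolding T_deriv m[symmetric] by (simp only: mult_ac)
  finally have "fps_X * fps_deriv (T ^ m) * (1 - T) = of_nat m * T ^ m" .
  then have "of_nat (m + 1) * (fps_X * fps_deriv (T ^ m) - of_nat m * T ^ m) = 
      of_nat (m + 1) * (fps_X * (fps_deriv (T ^ m) * T))"
    by (simp add: algebra_simps)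
  also have "\<dots> = of_nat m * (fps_X * fps_deriv (T ^ Suc m))"
  proof -
    have "of_nat (m + 1) * (fps_X * (fps_deriv (T ^ m) * T)) = 
        of_nat (m + 1) * of_nat m * (fps_X * fps_deriv T * (T ^ (m - 1) * T))"
      unfolding dp by (simp only: mult_ac)
    also have "\<dots> = of_nat m * (fps_X * fps_deriv (T ^ Suc m))"
      unfolding m dp by (simp add: mult_ac)
    finally show ?thesis .
  qed
  finally have "(of_nat (m + 1) * (fps_X * fps_deriv (T ^ m) - of_nat m * T ^ m)) $ n =
      (of_nat m * (fps_X * fps_deriv (T ^ Suc m))) $ n" by simp
  then show ?thesis
    by (simp only: of_nat_fps_mult_nth fps_sub_nth fps_X_deriv_nth) (simp add: algebra_simps)
qed

lemma T_power_nth: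
  assumes "n > 0"
  shows "(T ^ Suc i) $ n = real (i + 1) * (\<Prod>l=1..i. 1 - real l / real n) * \<tau> n"
proof (induction i)
  case (Suc i)
  have "real (Suc i) * real n * (T ^ Suc (Suc i)) $ n = 
      real (i + 2) * (real n - real (Suc i)) * (real (i + 1) * (\<Prod>l=1..i. 1 - real l / real n) * \<tau> n)"
    using T_power_Suc_nth[of "Suc i" n] Suc by simp
  also have "\<dots> = real (Suc i) * real n * (real (Suc i + 1) * (\<Prod>l=1..Suc i. 1 - real l / real n) * \<tau> n)"
    using assms by (simp add: field_simps)
  finally show ?case using assms by simp
qed simp

text \<open>The coefficient of \<open>y ^ k\<close> in the solution of
  \<open>(1 - s x) Q - s Q\<^sup>2 / 2 = y x\<close> without constant term in \<open>y\<close>. This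
  solution is \<open>Q = (1 - s x) / s * C\<close> with \<open>C\<close> the value of
  \<open>1 - sqrt (1 - 2 z)\<close> at \<open>z = s x y / (1 - s x)\<^sup>2\<close>, whence
  \<open>cut_coeff\<close>. Later \<open>x\<close> is replaced by \<open>T\<close>.\<close>

definition cut_fps :: "real \<Rightarrow> nat \<Rightarrow> real fps" where
  "cut_fps s k = fps_const (cut_coeff k * s ^ (k - 1)) * fps_X ^ k * inverse ((1 - fps_const s * fps_X) ^ (2 * k - 1))"

lemma cut_fps_0 [simp]: "cut_fps s 0 = 0"
  by (simp add: cut_fps_def cut_coeff_def)

lemma cut_fps_rec:
  assumes "k > 0"
  shows "cut_fps s k = fps_const s * fps_X * cut_fps s k + 
    fps_const (s / 2) * (\<Sum>j\<le>k. cut_fps s j * cut_fps s (k - j)) + (if k = 1 then fps_X else 0)"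
proof -
  let ?L = "1 - fps_const s * fps_X :: real fps"
  have L: "?L * inverse ?L = 1" by (rule inverse_mult_eq_1') simp
  have 1: "?L * cut_fps s k = 
    fps_const (s / 2) * (\<Sum>j\<le>k. cut_fps s j * cut_fps s (k - j)) + (if k = 1 then fps_X else 0)"
  proof (cases "k = 1")
    case True
    then show ?thesis using L by (simp add: cut_fps_def cut_coeff_def atMost_Suc mult_ac)
  next
    case False
    then have k: "k \<ge> 2" using assms by simp
    have "cut_fps s j * cut_fps s (k - j) = fps_const (cut_coeff j * cut_coeff (k - j)) *
       (fps_const (s ^ (k - 2)) * fps_X ^ k * inverse ?L ^ (2 * k - 2))" if "j \<le> k" for j
    proof (cases "j = 0 \<or> j = k")
      case False
      then have j: "0 < j" "j < k" using that by auto
      have "(j - 1) + (k - j - 1) = k - 2" "j + (k - j) = k" "(2 * j - 1) + (2 * (k - j) - 1) = 2 * k - 2"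
        using j k by auto
      then have e: "s ^ (k - 2) = s ^ (j - 1) * s ^ (k - j - 1)" 
          "(fps_X :: real fps) ^ k = fps_X ^ j * fps_X ^ (k - j)"
          "inverse ?L ^ (2 * k - 2) = inverse ?L ^ (2 * j - 1) * inverse ?L ^ (2 * (k - j) - 1)"
        by (metis power_add)+
      show ?thesis
        unfolding cut_fps_def fps_inverse_power e by (simp add: fps_const_mult[symmetric] mult_ac del: fps_const_mult)
    qed (auto simp: cut_coeff_def)
    then have "(\<Sum>j\<le>k. cut_fps s j * cut_fps s (k - j)) = 
       fps_const (\<Sum>j\<le>k. cut_coeff j * cut_coeff (k - j)) * (fps_const (s ^ (k - 2)) * fps_X ^ k * inverse ?L ^ (2 * k - 2))"
      by (simp add: sum_distrib_right fps_const_sum)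
    also have "(\<Sum>j\<le>k. cut_coeff j * cut_coeff (k - j)) = 2 * cut_coeff k"
      using cut_coeff_convolution[OF k] by simp
    finally have "fps_const (s / 2) * (\<Sum>j\<le>k. cut_fps s j * cut_fps s (k - j)) =
      fps_const (s / 2 * (2 * cut_coeff k) * s ^ (k - 2)) * fps_X ^ k * inverse ?L ^ (2 * k - 2)"
      by (simp add: mult.assoc[symmetric])
    also have "s / 2 * (2 * cut_coeff k) * s ^ (k - 2) = cut_coeff k * s ^ (k - 1)"
    proof -
      have "k - 1 = Suc (k - 2)" using k by simp
      then show ?thesis by simp
    qed
    also have "fps_const (cut_coeff k * s ^ (k - 1)) * fps_X ^ k * inverse ?L ^ (2 * k - 2) = ?L * cut_fps s k"
    proof -
      have e: "2 * k - 1 = Suc (2 * k - 2)" using k by simp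
      have "?L * cut_fps s k = fps_const (cut_coeff k * s ^ (k - 1)) * fps_X ^ k * (?L * inverse ?L * inverse ?L ^ (2 * k - 2))"
      proof -
        have "inverse (?L ^ (2 * k - 1)) = inverse ?L * inverse ?L ^ (2 * k - 2)"
          using fps_inverse_power[of ?L "2 * k - 1"] unfolding e power_Suc .
        then show ?thesis unfolding cut_fps_def by (simp only: mult_ac)
      qed
      then show ?thesis by (simp only: L mult_1_left)
    qed
    finally show ?thesis using False by simp
  qed
  have "cut_fps s k = fps_const s * fps_X * cut_fps s k + ?L * cut_fps s k"
    by (simp add: algebra_simps)
  then show ?thesis unfolding 1 by (simp add: add.assoc)
qed

lemma cut_fps_nth:
  assumes "k > 0"
  shows "cut_fps s k $ i = (if i < k then 0 else 
    cut_coeff k * s ^ (i - 1) * real ((i + k - 2) choose (2 * k - 2)))"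
proof -
  have "cut_fps s k = fps_const (cut_coeff k * s ^ (k - 1)) * (fps_X ^ k * 
      Abs_fps (\<lambda>i. real ((2 * k - 1 + i - 1) choose i) * s ^ i))"
    unfolding cut_fps_def using one_minus_const_fps_X_neg_power'[of "2 * k - 1" s] assms
    by (simp add: mult.assoc)
  then have *: "cut_fps s k $ i = (if i < k then 0 else cut_coeff k * s ^ (k - 1) * (real ((2 * k - 1 + (i - k) - 1) choose (i - k)) * s ^ (i - k)))"
    by (simp add: fps_X_power_mult_nth)
  show ?thesis
  proof (cases "i < k")
    case False
    then have e: "2 * k - 1 + (i - k) - 1 = i + k - 2" "(k - 1) + (i - k) = i - 1" 
      using assms by auto
    have "(i + k - 2) choose (i - k) = (i + k - 2) choose (2 * k - 2)"
    proof -
      have "i + k - 2 - (i - k) = 2 * k - 2" "i - k \<le> i + k - 2" using False assms by auto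
      then show ?thesis using binomial_symmetric[of "i - k" "i + k - 2"] by simp
    qed
    moreover have "s ^ (i - 1) = s ^ (k - 1) * s ^ (i - k)"
      unfolding e(2)[symmetric] by (rule power_add)
    ultimately show ?thesis using False unfolding * e by simp
  qed (use * in simp)
qed

text \<open>
  The exactly solvable comparison model: in the recursion for the weights the factor \<open>n - 1\<close>, the
  number of edges, is replaced by \<open>n\<close>; with the remaining probability \<open>1 / n\<close> the component stops, and
  this counts as a success only if it contains exactly one mark. Summing over the number \<open>k\<close> of
  marks with a formal variable \<open>y\<close>, the generating function \<open>Q\<close> of the marked components solves
  \<open>(1 - s T) Q - s Q\<^sup>2 / 2 = y T\<close>, and \<open>killed_weight s n k\<close> is, for \<open>k > 0\<close>, the coefficient of \<open>x\<^sup>n y\<^sup>k\<close>.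
\<close>

definition killed_weight :: "real \<Rightarrow> nat \<Rightarrow> nat \<Rightarrow> real" where
  "killed_weight s n k = (if k = 0 then \<tau> n else (cut_fps s k oo T) $ n)"

lemma killed_weight_rec:
  assumes "k > 0"
  shows "killed_weight s n k = 
    s / 2 * (\<Sum>a\<le>n. \<Sum>j\<le>k. killed_weight s a j * killed_weight s (n - a) (k - j)) + (if k = 1 then \<tau> n else 0)"
proof -
  have T0: "T $ 0 = 0" by (simp add: tau_0)
  define G where "G = (\<lambda>k. if k = 0 then T else cut_fps s k oo T)"
  have Gn: "killed_weight s n k = G k $ n" for n k by (simp add: killed_weight_def G_def)
  have "cut_fps s k oo T = (fps_const s * fps_X * cut_fps s k + 
    fps_const (s / 2) * (\<Sum>j\<le>k. cut_fps s j * cut_fps s (k - j)) + (if k = 1 then fps_X else 0)) oo T"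
    using cut_fps_rec[OF assms, of s] by simp
  also have "\<dots> = fps_const s * T * G k + 
    fps_const (s / 2) * (\<Sum>j\<le>k. (cut_fps s j oo T) * (cut_fps s (k - j) oo T)) + (if k = 1 then T else 0)"
    using assms by (simp add: fps_compose_add_distrib fps_compose_mult_distrib[OF T0] fps_compose_sum_distrib G_def fps_X_fps_compose_startby0[OF T0])
  also have "(\<Sum>j\<le>k. (cut_fps s j oo T) * (cut_fps s (k - j) oo T)) = 
     (\<Sum>j\<in>{..k} - {0, k}. G j * G (k - j))"
    by (intro sum.mono_neutral_cong_right) (auto simp: G_def)
  \<comment> \<open>The terms \<open>j = 0\<close> and \<open>j = k\<close> belong to cuts that
    throw away an unmarked half. Each equals \<open>T * G k\<close>, and together they make up the
    linear term \<open>s T Q\<close> of the quadratic equation.\<close>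
  also have "\<dots> = (\<Sum>j\<le>k. G j * G (k - j)) - 2 * T * G k"
  proof -
    have "(\<Sum>j\<in>{..k} - {0, k}. G j * G (k - j)) = (\<Sum>j\<le>k. G j * G (k - j)) - (\<Sum>j\<in>{0, k}. G j * G (k - j))"
      by (intro sum_diff) auto
    then show ?thesis using assms by (simp add: G_def)
  qed
  finally have "cut_fps s k oo T = fps_const s * T * G k + fps_const (s / 2) * ((\<Sum>j\<le>k. G j * G (k - j)) - 2 * T * G k)
      + (if k = 1 then T else 0)" .
  moreover have "G k = cut_fps s k oo T" using assms by (simp add: G_def)
  ultimately have "G k = fps_const s * T * G k + fps_const (s / 2) * ((\<Sum>j\<le>k. G j * G (k - j)) - 2 * T * G k)
      + (if k = 1 then T else 0)" by (simp only: )
  also have "\<dots> = fps_const (s / 2) * (\<Sum>j\<le>k. G j * G (k - j)) + (if k = 1 then T else 0)"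
  proof -
    have "fps_const s = fps_const (s / 2) * 2" by (simp add: fps_numeral_fps_const)
    then show ?thesis by (simp add: algebra_simps)
  qed
  finally have "G k $ n = (fps_const (s / 2) * (\<Sum>j\<le>k. G j * G (k - j)) + (if k = 1 then T else 0)) $ n"
    by simp
  also have "\<dots> = s / 2 * (\<Sum>j\<le>k. \<Sum>a\<le>n. G j $ a * G (k - j) $ (n - a)) + (if k = 1 then \<tau> n else 0)"
    by (simp only: fps_add_nth fps_mult_left_const_nth fps_sum_nth) (simp add: fps_mult_nth atMost_atLeast0)
  finally show ?thesis
    unfolding Gn by (subst sum.swap)
qed

lemma killed_weight_0 [simp]: "killed_weight s n 0 = \<tau> n"
  by (simp add: killed_weight_def)

lemma killed_weight_eq:
  assumes "k > 0" "n > 0"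
  shows "killed_weight s n k = (\<Sum>j\<le>n. cut_coeff k * s ^ (j + k - 1) * real ((j + 2 * k - 2) choose (2 * k - 2)) *
     (real (j + k) * (\<Prod>l=1..j + k - 1. 1 - real l / real n))) * \<tau> n"
proof -
  have A: "(T ^ i) $ n = real i * (\<Prod>l=1..i - 1. 1 - real l / real n) * \<tau> n" if "i > 0" for i
    using T_power_nth[OF assms(2), of "i - 1"] that by simp
  define g where "g = (\<lambda>i. cut_fps s k $ i * (T ^ i) $ n)"
  have z: "(\<Prod>l=1..m. 1 - real l / real n) = 0" if "n \<le> m" for m
    using assms that by (intro prod_zero) (auto intro!: bexI[of _ n])
  have "killed_weight s n k = (\<Sum>i\<le>n. g i)"
    using assms by (simp add: killed_weight_def fps_compose_nth g_def atMost_atLeast0)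
  also have "\<dots> = (\<Sum>i\<in>{k..n + k}. g i)"
  proof (rule sum.mono_neutral_cong)
    fix i assume "i \<in> {k..n + k} - {..n}"
    then have "i > 0" "n \<le> i - 1" using assms by auto
    then show "g i = 0" using A[of i] z[of "i - 1"] by (simp add: g_def)
  next
    fix i assume "i \<in> {..n} - {k..n + k}"
    then show "g i = 0" using cut_fps_nth[OF assms(1), of s i] by (auto simp: g_def)
  qed auto
  also have "\<dots> = (\<Sum>j\<le>n. g (j + k))"
    using sum.shift_bounds_cl_nat_ivl[of g 0 k n] by (simp add: atMost_atLeast0)
  also have "\<dots> = (\<Sum>j\<le>n. cut_coeff k * s ^ (j + k - 1) * real ((j + 2 * k - 2) choose (2 * k - 2)) *
     (real (j + k) * (\<Prod>l=1..j + k - 1. 1 - real l / real n)) * \<tau> n)"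
  proof (intro sum.cong refl)
    fix j
    have "j + k > 0" "\<not> j + k < k" "j + k + k - 2 = j + 2 * k - 2" using assms by auto
    then show "g (j + k) = cut_coeff k * s ^ (j + k - 1) * real ((j + 2 * k - 2) choose (2 * k - 2)) *
     (real (j + k) * (\<Prod>l=1..j + k - 1. 1 - real l / real n)) * \<tau> n"
      unfolding g_def A[OF \<open>j + k > 0\<close>] cut_fps_nth[OF assms(1)] by simp
  qed
  finally show ?thesis by (simp add: sum_distrib_right)
qed

end

section \<open>Comparison of the two processes\<close>

lemma prod_ge_one_minus_sum:
  fixes f :: "nat \<Rightarrow> real"
  assumes "finite A" "\<And>i. i \<in> A \<Longrightarrow> 0 \<le> f i \<and> f i \<le> 1"
  shows "(\<Prod>i\<in>A. 1 - f i) \<ge> 1 - (\<Sum>i\<in>A. f i)"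
  using assms
proof (induction rule: finite_induct)
  case (insert x F)
  then have IH: "(\<Prod>i\<in>F. 1 - f i) \<ge> 1 - (\<Sum>i\<in>F. f i)" and f: "0 \<le> f x" "f x \<le> 1"
    and S: "0 \<le> (\<Sum>i\<in>F. f i)" by (auto intro: sum_nonneg)
  have "1 - (f x + (\<Sum>i\<in>F. f i)) \<le> (1 - f x) * (1 - (\<Sum>i\<in>F. f i))"
    using f S by (simp add: algebra_simps)
  also have "\<dots> \<le> (1 - f x) * (\<Prod>i\<in>F. 1 - f i)"
    using IH f by (intro mult_left_mono) auto
  finally show ?case using insert by simp
qed simp

context tree_function
begin

text \<open>With \<open>P = X T'\<close> the left-hand side is the coefficient of \<open>P\<^sup>2 = (T / (1 - T))\<^sup>2\<close>.\<close>

lemma weighted_split_eq: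
  assumes "n > 0"
  shows "(\<Sum>a\<le>n. real a * \<tau> a * (real (n - a) * \<tau> (n - a))) =
    (\<Sum>i<n. real i * (real (i + 1) * (\<Prod>l=1..i. 1 - real l / real n))) * \<tau> n"
proof -
  let ?P = "fps_X * fps_deriv T" and ?f = "fps_X\<^sup>2 * inverse ((1 - fps_X)\<^sup>2) :: real fps"
  have T0: "T $ 0 = 0" by (simp add: tau_0)
  have inv: "(1 - fps_X)\<^sup>2 * inverse ((1 - fps_X)\<^sup>2 :: real fps) = 1"
    by (rule inverse_mult_eq_1') (simp add: power2_eq_square)
  have "(1 - fps_X)\<^sup>2 * ?f = (fps_X\<^sup>2 :: real fps) * ((1 - fps_X)\<^sup>2 * inverse ((1 - fps_X)\<^sup>2))"
    by (simp only: mult_ac)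
  then have f: "(1 - fps_X)\<^sup>2 * ?f = fps_X\<^sup>2" unfolding inv by simp
  have "((1 - fps_X)\<^sup>2 * ?f) oo T = (1 - T)\<^sup>2 * (?f oo T)"
    unfolding fps_compose_mult_distrib[OF T0, of "(1 - fps_X)\<^sup>2"]
    by (simp add: power2_eq_square fps_compose_mult_distrib[OF T0] fps_compose_sub_distrib fps_X_fps_compose_startby0[OF T0])
  then have "(1 - T)\<^sup>2 * (?f oo T) = T\<^sup>2"
    unfolding f by (simp add: power2_eq_square fps_compose_mult_distrib[OF T0] fps_X_fps_compose_startby0[OF T0])
  also have "T\<^sup>2 = (1 - T)\<^sup>2 * ?P\<^sup>2"
    by (subst T_deriv[symmetric]) (simp add: power_mult_distrib mult_ac)
  finally have "(1 - T)\<^sup>2 * (?f oo T) = (1 - T)\<^sup>2 * ?P\<^sup>2" .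
  moreover have "1 - T \<noteq> 0"
  proof
    assume "1 - T = 0"
    then have "(1 - T) $ 0 = 0" by simp
    then show False using tau_0 by simp
  qed
  ultimately have PP: "?P * ?P = ?f oo T" by (simp add: power2_eq_square)
  have fn: "?f $ j = (if j < 2 then 0 else real (j - 1))" for j
  proof -
    have "inverse ((1 - fps_X)\<^sup>2 :: real fps) = Abs_fps (\<lambda>k. real ((k + 1) choose k))"
      using one_minus_const_fps_X_neg_power'[of 2 "1 :: real"] by (simp add: add.commute)
    then have "inverse ((1 - fps_X)\<^sup>2 :: real fps) = Abs_fps (\<lambda>k. real (k + 1))"
      by simp
    then show ?thesis by (auto simp: fps_X_power_mult_nth of_nat_diff)
  qed
  have "(\<Sum>a\<le>n. real a * \<tau> a * (real (n - a) * \<tau> (n - a))) = (?P * ?P) $ n"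
    by (simp only: fps_mult_nth[of ?P ?P] fps_X_deriv_nth T_nth atMost_atLeast0)
  also have "\<dots> = (\<Sum>j\<le>n. ?f $ j * (T ^ j) $ n)"
    unfolding PP fps_compose_nth by (simp add: atMost_atLeast0)
  also have "\<dots> = (\<Sum>j\<in>{1..n}. ?f $ j * (T ^ j) $ n)"
    by (rule sum.mono_neutral_right) (use fn in \<open>auto simp: not_le\<close>)
  also have "\<dots> = (\<Sum>i<n. ?f $ Suc i * (T ^ Suc i) $ n)"
    by (rule sum.reindex_bij_witness[where i = Suc and j = "\<lambda>j. j - 1"]) auto
  also have "\<dots> = (\<Sum>i<n. real i * (real (i + 1) * (\<Prod>l=1..i. 1 - real l / real n)) * \<tau> n)"
    by (intro sum.cong refl) (simp add: fn T_power_nth[OF assms] del: power_Suc)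
  finally show ?thesis by (simp add: sum_distrib_right)
qed

end

text \<open>For \<open>n \<ge> k\<close>, division by \<open>n choose k\<close> gives the
  probability that the killed process with \<open>k\<close> marks on \<open>n\<close> vertices
  succeeds after exactly \<open>j + k - 1\<close> cuts; at least \<open>k - 1\<close> cuts are
  needed to separate the marks.\<close>

definition killed_coeff :: "nat \<Rightarrow> nat \<Rightarrow> nat \<Rightarrow> real" where
  "killed_coeff n k j = cut_coeff k * real ((j + 2 * k - 2) choose (2 * k - 2)) *
     (real (j + k) * (\<Prod>l=1..j + k - 1. 1 - real l / real n))"

lemma killed_coeff_nonneg:
  assumes "n > 0"
  shows "killed_coeff n k j \<ge> 0"
proof -
  have "(\<Prod>l=1..m. 1 - real l / real n) \<ge> 0" for m
  proof (cases "n \<le> m")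
    case True
    then have "(\<Prod>l=1..m. 1 - real l / real n) = 0"
      using assms by (intro prod_zero) (auto intro!: bexI[of _ n])
    then show ?thesis by (rule eq_refl[OF sym])
  next
    case False
    then show ?thesis by (intro prod_nonneg) auto
  qed
  moreover have "cut_coeff k \<ge> 0" by (simp add: cut_coeff_def)
  ultimately show ?thesis unfolding killed_coeff_def by simp
qed

text \<open>The comparison uses only these recursions and bounds. \<open>w\<close> collects the
  weights at the given \<open>s\<close>; the expressions \<open>W\<close> introduced below are the
  total masses, that is the weights at \<open>s = 1\<close>, and \<open>marks_rec\<close> is their
  recursion.\<close>

locale cut_weights = tree_function +
  fixes s :: real and w :: "nat \<Rightarrow> nat \<Rightarrow> real"
  assumes s_bounds: "0 \<le> s" "s \<le> 1"
    and tau_pos: "\<And>n. n > 0 \<Longrightarrow> \<tau> n > 0"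
    and w_0: "\<And>n. w n 0 = \<tau> n"
    and w_1: "w 1 1 = 1"
    and w_nonneg: "\<And>n k. 0 \<le> w n k"
    and w_le: "\<And>n k. w n k \<le> real (n choose k) * \<tau> n"
    and w_rec: "\<And>n k. k > 0 \<Longrightarrow>
      2 * (real n - 1) * w n k = s * real n * (\<Sum>a\<le>n. \<Sum>j\<le>k. w a j * w (n - a) (k - j))"
    and marks_rec: "\<And>n k. 2 * (real n - 1) * (real (n choose k) * \<tau> n) =
      real n * (\<Sum>a\<le>n. \<Sum>j\<le>k. (real (a choose j) * \<tau> a) * (real ((n - a) choose (k - j)) * \<tau> (n - a)))"
begin

abbreviation W :: "nat \<Rightarrow> nat \<Rightarrow> real" where
  "W n k \<equiv> real (n choose k) * \<tau> n"

lemma tau_nonneg: "\<tau> n \<ge> 0"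
  using tau_pos[of n] tau_0 by (cases n) auto

lemma w_empty [simp]: "w 0 k = 0"
  using w_nonneg[of 0 k] w_le[of 0 k] tau_0 by simp

section \<open>A single mark: sublinear mean number of cuts\<close>

lemma w_1_rec: "(real n - 1) * w n 1 = s * real n * (\<Sum>a\<le>n. \<tau> (n - a) * w a 1)"
proof -
  have "(\<Sum>a\<le>n. \<Sum>j\<le>1. w a j * w (n - a) (1 - j)) = (\<Sum>a\<le>n. \<tau> a * w (n - a) 1) + (\<Sum>a\<le>n. \<tau> (n - a) * w a 1)"
    by (simp add: atMost_Suc w_0 sum.distrib mult.commute)
  also have "(\<Sum>a\<le>n. \<tau> a * w (n - a) 1) = (\<Sum>a\<le>n. \<tau> (n - a) * w a 1)"
    by (rule sum.reindex_bij_witness[where i = "\<lambda>a. n - a" and j = "\<lambda>a. n - a"]) auto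
  finally have "2 * ((real n - 1) * w n 1) = 2 * (s * real n * (\<Sum>a\<le>n. \<tau> (n - a) * w a 1))"
    using w_rec[OF zero_less_one, of n] by (simp only: mult.assoc) simp
  then show ?thesis by simp
qed

lemma W_1_rec: "(real n - 1) * (real n * \<tau> n) = real n * (\<Sum>a\<le>n. \<tau> (n - a) * (real a * \<tau> a))"
proof -
  have "(\<Sum>a\<le>n. \<Sum>j\<le>1. W a j * W (n - a) (1 - j)) = 
     (\<Sum>a\<le>n. \<tau> a * (real (n - a) * \<tau> (n - a))) + (\<Sum>a\<le>n. \<tau> (n - a) * (real a * \<tau> a))"
    by (simp add: atMost_Suc sum.distrib mult.commute)
  also have "(\<Sum>a\<le>n. \<tau> a * (real (n - a) * \<tau> (n - a))) = (\<Sum>a\<le>n. \<tau> (n - a) * (real a * \<tau> a))"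
    by (rule sum.reindex_bij_witness[where i = "\<lambda>a. n - a" and j = "\<lambda>a. n - a"]) auto
  finally have "2 * ((real n - 1) * (real n * \<tau> n)) = 2 * (real n * (\<Sum>a\<le>n. \<tau> (n - a) * (real a * \<tau> a)))"
    using marks_rec[of n 1] by (simp only: mult.assoc binomial_1) simp
  then show ?thesis by simp
qed

text \<open>A drift argument for the mean number of cuts. Since
  \<open>1 - s x \<le> (1 - s) + (1 - x)\<close> on the unit interval, bounds \<open>B a\<close> for
  smaller components give for \<open>n\<close> the bound one plus the mean of \<open>B a\<close>,
  where \<open>a\<close> is the size of the part that keeps the mark, with weights
  \<open>\<tau> (n - a) * (real a * \<tau> a)\<close>. The assumption on the sum says that this is
  at most \<open>C\<close>.\<close>

lemma w_1_lower_step: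
  assumes "n \<ge> 2" "\<And>a. 0 < a \<Longrightarrow> a < n \<Longrightarrow> real a * \<tau> a - w a 1 \<le> (1 - s) * B a * (real a * \<tau> a)"
    and "(\<Sum>a\<le>n. \<tau> (n - a) * (real a * \<tau> a) * (1 + B a - C)) \<le> 0"
    and "\<And>a. B a \<ge> 0"
  shows "real n * \<tau> n - w n 1 \<le> (1 - s) * C * (real n * \<tau> n)"
proof -
  have "(real n - 1) * (real n * \<tau> n - w n 1) = 
      real n * (\<Sum>a\<le>n. \<tau> (n - a) * (real a * \<tau> a - s * w a 1))"
    using w_1_rec[of n] W_1_rec[of n] by (simp add: algebra_simps sum_subtractf sum_distrib_left)
  also have "\<dots> \<le> real n * (\<Sum>a\<le>n. \<tau> (n - a) * ((1 - s) * (1 + B a) * (real a * \<tau> a)))"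
  proof (rule mult_left_mono[OF sum_mono])
    fix a assume a: "a \<in> {..n}"
    show "\<tau> (n - a) * (real a * \<tau> a - s * w a 1) \<le> \<tau> (n - a) * ((1 - s) * (1 + B a) * (real a * \<tau> a))"
    proof (cases "a = 0 \<or> a = n")
      case False
      then have a': "0 < a" "a < n" using a by auto
      have "real a * \<tau> a - s * w a 1 = (1 - s) * (real a * \<tau> a) + s * (real a * \<tau> a - w a 1)"
        by (simp add: algebra_simps)
      also have "\<dots> \<le> (1 - s) * (real a * \<tau> a) + 1 * ((1 - s) * B a * (real a * \<tau> a))"
      proof -
        have "real a * \<tau> a - w a 1 \<ge> 0" using w_le[of a 1] by simp
        then show ?thesis using assms(2)[OF a'] s_bounds by (intro add_left_mono mult_mono) auto
      qed
      finally show ?thesis using tau_nonneg by (intro mult_left_mono) (auto simp: algebra_simps)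
    qed (auto simp: tau_0)
  qed simp
  also have "\<dots> = real n * (1 - s) * ((\<Sum>a\<le>n. \<tau> (n - a) * (real a * \<tau> a) * (1 + B a - C)) + 
       C * (\<Sum>a\<le>n. \<tau> (n - a) * (real a * \<tau> a)))"
    by (simp add: sum_distrib_left sum.distrib[symmetric] algebra_simps)
  also have "\<dots> \<le> real n * (1 - s) * (0 + C * (\<Sum>a\<le>n. \<tau> (n - a) * (real a * \<tau> a)))"
    using assms(3) s_bounds by (intro mult_left_mono add_right_mono) auto
  also have "\<dots> = (1 - s) * C * ((real n - 1) * (real n * \<tau> n))"
    unfolding W_1_rec by simp
  finally have "(real n - 1) * (real n * \<tau> n - w n 1) \<le> (real n - 1) * ((1 - s) * C * (real n * \<tau> n))"
    by (simp only: mult_ac)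
  moreover have "real n - 1 > 0" using assms(1) by simp
  ultimately show ?thesis using mult_le_cancel_left_pos by blast
qed

lemma w_1_lower_trivial:
  assumes "n > 0"
  shows "real n * \<tau> n - w n 1 \<le> (1 - s) * real n * (real n * \<tau> n)"
  using assms
proof (induction n rule: less_induct)
  case (less n)
  show ?case
  proof (cases "n = 1")
    case True
    then show ?thesis using w_1 tau_1 s_bounds by simp
  next
    case False
    show ?thesis
    proof (rule w_1_lower_step[where B = real])
      show "(\<Sum>a\<le>n. \<tau> (n - a) * (real a * \<tau> a) * (1 + real a - real n)) \<le> 0"
      proof (rule sum_nonpos)
        fix a assume "a \<in> {..n}"
        then show "\<tau> (n - a) * (real a * \<tau> a) * (1 + real a - real n) \<le> 0"
          using tau_nonneg by (cases "a = n") (auto simp: tau_0 intro!: mult_nonneg_nonpos mult_nonneg_nonneg)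
      qed
    qed (use less False in auto)
  qed
qed

text \<open>By \<open>W_1_rec\<close> the assumption says that, from size \<open>N\<close> on, a cut
  removes on average at least \<open>1 / \<epsilon>\<close> vertices from the part of the mark. So
  the mean of \<open>\<epsilon>\<close> times the size drops by at least 1, which pays for the cut.
  Up to size \<open>N\<close> the trivial bound by the size is enough.\<close>

lemma w_1_lower:
  assumes "\<epsilon> > 0" "\<And>n. n \<ge> N \<Longrightarrow> 
     (real n - 1) * \<tau> n \<le> \<epsilon> * (\<Sum>a\<le>n. real a * \<tau> a * (real (n - a) * \<tau> (n - a)))" "n > 0"
  shows "real n * \<tau> n - w n 1 \<le> (1 - s) * (\<epsilon> * real n + real N) * (real n * \<tau> n)"
  using assms(3)
proof (induction n rule: less_induct)
  case (less n)
  show ?case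
  proof (cases "n \<le> N \<or> n = 1")
    case True
    have "real n * \<tau> n - w n 1 \<le> (1 - s) * (\<epsilon> * real n + real N) * (real n * \<tau> n)" if "n \<le> N"
    proof -
      have "(1 - s) * real n * (real n * \<tau> n) \<le> (1 - s) * (\<epsilon> * real n + real N) * (real n * \<tau> n)"
        using that s_bounds assms(1) tau_nonneg
        by (intro mult_right_mono mult_left_mono) (auto intro!: add_increasing)
      with w_1_lower_trivial[OF less.prems] show ?thesis by linarith
    qed
    moreover have "real n * \<tau> n - w n 1 \<le> (1 - s) * (\<epsilon> * real n + real N) * (real n * \<tau> n)" if "n = 1"
      using that w_1 tau_1 s_bounds assms(1) by simp
    ultimately show ?thesis using True by blast
  next
    case False
    then have n: "n \<ge> 2" "n \<ge> N" using less.prems by auto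
    show ?thesis
    proof (rule w_1_lower_step[where B = "\<lambda>a. \<epsilon> * real a + real N"])
      have "(\<Sum>a\<le>n. \<tau> (n - a) * (real a * \<tau> a) * (1 + (\<epsilon> * real a + real N) - (\<epsilon> * real n + real N))) =
        (\<Sum>a\<le>n. \<tau> (n - a) * (real a * \<tau> a) - \<epsilon> * (real a * \<tau> a * (real (n - a) * \<tau> (n - a))))"
        by (intro sum.cong refl) (auto simp: algebra_simps of_nat_diff)
      also have "\<dots> = (\<Sum>a\<le>n. \<tau> (n - a) * (real a * \<tau> a)) - \<epsilon> * (\<Sum>a\<le>n. real a * \<tau> a * (real (n - a) * \<tau> (n - a)))"
        by (simp add: sum_subtractf sum_distrib_left)
      also have "(\<Sum>a\<le>n. \<tau> (n - a) * (real a * \<tau> a)) = (real n - 1) * \<tau> n"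
        using W_1_rec[of n] n by simp
      finally show "(\<Sum>a\<le>n. \<tau> (n - a) * (real a * \<tau> a) * (1 + (\<epsilon> * real a + real N) - (\<epsilon> * real n + real N))) \<le> 0"
        using assms(2)[OF n(2)] by simp
    qed (use less n assms(1) in auto)
  qed
qed

section \<open>Two-sided comparison with the killed weights\<close>

lemma killed_weight_empty [simp]: "killed_weight r 0 k = 0"
  using tau_0 by (cases "k = 0") (auto simp: killed_weight_def fps_compose_nth cut_fps_nth)

lemma killed_weight_coeff:
  assumes "k > 0" "n > 0"
  shows "killed_weight r n k = (\<Sum>j\<le>n. killed_coeff n k j * r ^ (j + k - 1)) * \<tau> n"
  unfolding killed_weight_eq[OF assms] killed_coeff_def by (simp add: mult_ac)

lemma killed_weight_nonneg: "0 \<le> r \<Longrightarrow> 0 \<le> killed_weight r n k"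
  using killed_weight_coeff[of k n r] tau_nonneg killed_coeff_nonneg[of n k]
  by (cases "n = 0"; cases "k = 0") (auto intro!: sum_nonneg mult_nonneg_nonneg)

lemma killed_weight_mono: "0 \<le> r \<Longrightarrow> r \<le> 1 \<Longrightarrow> killed_weight r n k \<le> killed_weight 1 n k"
proof (cases "n = 0 \<or> k = 0")
  case False
  assume r: "0 \<le> r" "r \<le> 1"
  have "killed_coeff n k j * r ^ (j + k - 1) \<le> killed_coeff n k j * 1 ^ (j + k - 1)" for j
    using r False killed_coeff_nonneg[of n k j] by (intro mult_left_mono power_mono) auto
  then show ?thesis
    unfolding killed_weight_coeff[OF False[simplified, THEN conjunct2] False[simplified, THEN conjunct1]]
    by (intro mult_right_mono sum_mono tau_nonneg) auto
qed auto

text \<open>At \<open>s = 1\<close> the killed weight is the mass of success. For one mark the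
  source term \<open>\<tau> n\<close> is exactly the share \<open>1 / n\<close> of
  \<open>W n 1\<close> that the factor \<open>n\<close> in place of \<open>n - 1\<close> takes away;
  for more marks this share is lost.\<close>

lemma killed_weight_le_W: "killed_weight 1 n k \<le> W n k"
proof (induction n arbitrary: k rule: less_induct)
  case (less n)
  show ?case
  proof (cases "n = 0 \<or> k = 0")
    case False
    then have n: "n > 0" and k: "k > 0" by auto
    have "killed_weight 1 a j * killed_weight 1 (n - a) (k - j) \<le> W a j * W (n - a) (k - j)" 
      if "a \<le> n" for a j
    proof (cases "a = 0 \<or> a = n")
      case False
      with that show ?thesis
        using less[of a j] less[of "n - a" "k - j"] tau_nonneg by (intro mult_mono killed_weight_nonneg) auto
    qed (auto simp: tau_0)
    then have "(\<Sum>a\<le>n. \<Sum>j\<le>k. killed_weight 1 a j * killed_weight 1 (n - a) (k - j)) \<le>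
       (\<Sum>a\<le>n. \<Sum>j\<le>k. W a j * W (n - a) (k - j))"
      by (intro sum_mono) auto
    then have "2 * real n * (killed_weight 1 n k - (if k = 1 then \<tau> n else 0)) \<le> 2 * (real n - 1) * W n k"
      unfolding marks_rec killed_weight_rec[OF k, of 1 n] using n by simp
    then have "2 * real n * killed_weight 1 n k \<le> 2 * real n * W n k - 2 * W n k + (if k = 1 then 2 * real n * \<tau> n else 0)"
      by (auto simp: algebra_simps)
    also have "\<dots> \<le> 2 * real n * W n k" using tau_nonneg[of n] by auto
    finally show ?thesis using n by simp
  qed (auto simp: tau_0)
qed

text \<open>
  Where the killed process succeeds, it makes at most as many cuts as the original one; the second
  summand is the mass on which it fails.
\<close>

lemma w_upper: "w n k \<le> killed_weight s n k + (W n k - killed_weight 1 n k)"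
proof (induction n arbitrary: k rule: less_induct)
  case (less n)
  show ?case
  proof (cases "n = 0 \<or> k = 0")
    case False
    then have n: "n > 0" and k: "k > 0" by auto
    let ?g = "killed_weight s" and ?h = "killed_weight 1"
    \<comment> \<open>A pair of components fails if the first one fails, or if the first succeeds
      and the second fails. In the second case the first is estimated by its mass of success, with
      \<open>?h a j\<close> in place of \<open>?g a j\<close>.\<close>
    have le: "w a j * w (n - a) (k - j) \<le> ?g a j * ?g (n - a) (k - j) + 
         (W a j * W (n - a) (k - j) - ?h a j * ?h (n - a) (k - j))" if "a \<le> n" for a j
    proof (cases "a = 0 \<or> a = n")
      case False
      then have a: "a < n" "n - a < n" using that by auto
      let ?b = "n - a" and ?i = "k - j"
      have g: "0 \<le> ?g a j" "?g a j \<le> ?h a j" "?h ?b ?i \<le> W ?b ?i" "?h a j \<le> W a j"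
        "0 \<le> ?g ?b ?i" "0 \<le> W ?b ?i"
        using s_bounds tau_nonneg killed_weight_nonneg killed_weight_mono killed_weight_le_W by auto
      have "w a j * w ?b ?i \<le> (?g a j + (W a j - ?h a j)) * w ?b ?i"
        using less[OF a(1)] w_nonneg by (intro mult_right_mono) auto
      also have "\<dots> = ?g a j * w ?b ?i + (W a j - ?h a j) * w ?b ?i" by (simp add: algebra_simps)
      also have "\<dots> \<le> ?g a j * (?g ?b ?i + (W ?b ?i - ?h ?b ?i)) + (W a j - ?h a j) * W ?b ?i"
        using less[OF a(2)] w_le g by (intro add_mono mult_left_mono) auto
      also have "\<dots> = ?g a j * ?g ?b ?i + ?g a j * (W ?b ?i - ?h ?b ?i) + (W a j - ?h a j) * W ?b ?i"
        by (simp add: algebra_simps)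
      also have "\<dots> \<le> ?g a j * ?g ?b ?i + ?h a j * (W ?b ?i - ?h ?b ?i) + (W a j - ?h a j) * W ?b ?i"
        using g by (intro add_mono mult_right_mono) auto
      finally show ?thesis by (simp add: algebra_simps)
    qed (auto simp: tau_0)
    define A B C D where "A = (\<Sum>a\<le>n. \<Sum>j\<le>k. w a j * w (n - a) (k - j))"
      and "B = (\<Sum>a\<le>n. \<Sum>j\<le>k. ?g a j * ?g (n - a) (k - j))"
      and "C = (\<Sum>a\<le>n. \<Sum>j\<le>k. W a j * W (n - a) (k - j))"
      and "D = (\<Sum>a\<le>n. \<Sum>j\<le>k. ?h a j * ?h (n - a) (k - j))"
    define e where "e = (if k = 1 then \<tau> n else 0)"
    have "A \<le> B + (C - D)"
      unfolding A_def B_def C_def D_def sum.distrib[symmetric] sum_subtractf[symmetric]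
      by (intro sum_mono le) auto
    then have "s * A \<le> s * B + s * (C - D)" using s_bounds by (metis distrib_left mult_left_mono)
    also have "s * (C - D) \<le> 1 * (C - D)"
    proof (intro mult_right_mono)
      have "D \<le> C" unfolding C_def D_def
        by (intro sum_mono mult_mono killed_weight_le_W killed_weight_nonneg) (auto simp: tau_nonneg)
      then show "0 \<le> C - D" by simp
    qed (use s_bounds in auto)
    finally have *: "s * A \<le> s * B + C - D" by simp
    have 1: "2 * (real n - 1) * w n k = real n * (s * A)" using w_rec[OF k, of n] by (simp add: A_def)
    have 2: "s * B = 2 * (?g n k - e)" using killed_weight_rec[OF k, of s n] by (simp add: B_def e_def)
    have 3: "D = 2 * (?h n k - e)" using killed_weight_rec[OF k, of 1 n] by (simp add: D_def e_def)
    have 4: "2 * (real n - 1) * W n k = real n * C" using marks_rec[of n k] by (simp add: C_def)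
    have "2 * (real n - 1) * w n k \<le> real n * (s * B + C - D)"
      unfolding 1 using * by (intro mult_left_mono) auto
    \<comment> \<open>The source terms \<open>e\<close> of \<open>?g\<close> and \<open>?h\<close>
      cancel.\<close>
    also have "\<dots> = 2 * real n * (?g n k - ?h n k) + 2 * (real n - 1) * W n k"
      unfolding 2 3 4 by (simp add: algebra_simps)
    finally have "2 * real n * w n k \<le> 2 * real n * (?g n k - ?h n k) + 2 * real n * W n k + 2 * (w n k - W n k)"
      by (simp add: algebra_simps)
    also have "\<dots> \<le> 2 * real n * (?g n k + (W n k - ?h n k))"
      using w_le[of n k] by (simp add: algebra_simps)
    finally show ?thesis using n by simp
  qed (auto simp: tau_0 w_0)
qed

text \<open>
  The error is what the original process still does after a component has stopped: a component on
  \<open>m\<close> vertices stops with probability \<open>1 / m\<close> and then costs at most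
  \<open>(1 - s) * (\<epsilon> * m + N)\<close>. The sizes along a line of descent decrease, which gives the logarithm,
  and the \<open>\<epsilon>\<close>-parts are discounted by powers of \<open>s\<close>, so that they add up to at most \<open>\<epsilon>\<close>.
\<close>

lemma w_lower:
  assumes "\<epsilon> > 0" "\<And>n. n \<ge> N \<Longrightarrow> 
     (real n - 1) * \<tau> n \<le> \<epsilon> * (\<Sum>a\<le>n. real a * \<tau> a * (real (n - a) * \<tau> (n - a)))" "n > 0"
  shows "killed_weight s n k - w n k \<le> real k * (\<epsilon> + (1 - s) * real N * (1 + ln (real n))) * W n k"
  using assms(3)
proof (induction n arbitrary: k rule: less_induct)
  case (less n)
  define E where "E = (\<lambda>x::real. \<epsilon> + (1 - s) * real N * (1 + ln x))"
  have E_nonneg: "E (real n) \<ge> 0" if "n > 0" for n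
    unfolding E_def using that s_bounds assms(1) by (intro add_nonneg_nonneg mult_nonneg_nonneg) auto
  have E_mono: "E x \<le> E y" if "0 < x" "x \<le> y" for x y
    unfolding E_def using that s_bounds by (intro add_left_mono mult_left_mono) auto
  show ?case
  proof (cases "k = 0 \<or> n = 1")
    case True
    have "killed_weight s n k - w n k \<le> 0" if "k = 0" using that by (simp add: w_0)
    moreover have "killed_weight s n k - w n k \<le> 0" if "n = 1"
    proof (cases "k = 0 \<or> k = 1")
      case True
      then show ?thesis
        using w_1 killed_weight_mono[of s 1 1] killed_weight_le_W[of 1 1] s_bounds tau_1 that by (auto simp: w_0)
    next
      case False
      then have "W 1 k = 0" by (simp add: binomial_eq_0)
      moreover have "killed_weight s 1 k \<le> W 1 k"
        using s_bounds by (intro order_trans[OF killed_weight_mono killed_weight_le_W])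
      ultimately have "killed_weight s 1 k \<le> 0" by (simp only: )
      then show ?thesis using w_nonneg[of 1 k] that by simp
    qed
    moreover have "0 \<le> real k * E (real n) * W n k"
      using E_nonneg[OF less.prems] tau_nonneg by (intro mult_nonneg_nonneg) auto
    ultimately show ?thesis using True unfolding E_def by linarith
  next
    case False
    then have n: "n \<ge> 2" and k: "k > 0" using less.prems by auto
    let ?g = "killed_weight s"
    \<comment> \<open>The errors of the two halves enter with multiplicities \<open>j\<close> and
      \<open>k - j\<close>, which is why the bound is linear in \<open>k\<close>. Both halves have
      at most \<open>n - 1\<close> vertices.\<close>
    have le: "?g a j * ?g (n - a) (k - j) - w a j * w (n - a) (k - j) \<le> 
        real k * E (real n - 1) * (W a j * W (n - a) (k - j))" if "a \<le> n" "j \<le> k" for a j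
    proof (cases "a = 0 \<or> a = n")
      case False
      then have a: "a < n" "0 < a" "n - a < n" "0 < n - a" using that by auto
      let ?b = "n - a" and ?i = "k - j"
      have g: "0 \<le> ?g ?b ?i" "?g ?b ?i \<le> W ?b ?i" 
        using s_bounds killed_weight_nonneg killed_weight_mono[of s ?b ?i] killed_weight_le_W[of ?b ?i] by auto
      have "?g a j - w a j \<le> real j * E (real a) * W a j" 
        using less.IH[OF a(1,2), of j] by (simp add: E_def)
      also have "\<dots> \<le> real j * E (real n - 1) * W a j"
        using a n tau_nonneg by (intro mult_right_mono mult_left_mono E_mono) auto
      finally have A: "?g a j - w a j \<le> real j * E (real n - 1) * W a j" .
      have "?g ?b ?i - w ?b ?i \<le> real ?i * E (real ?b) * W ?b ?i" 
        using less.IH[OF a(3,4), of ?i] by (simp add: E_def)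
      also have "\<dots> \<le> real ?i * E (real n - 1) * W ?b ?i"
        using a n tau_nonneg by (intro mult_right_mono mult_left_mono E_mono) (auto simp: of_nat_diff)
      finally have B: "?g ?b ?i - w ?b ?i \<le> real ?i * E (real n - 1) * W ?b ?i" .
      have En: "E (real n - 1) \<ge> 0" using E_nonneg[of "n - 1"] n by (simp add: of_nat_diff)
      have "?g a j * ?g ?b ?i - w a j * w ?b ?i = (?g a j - w a j) * ?g ?b ?i + w a j * (?g ?b ?i - w ?b ?i)"
        by (simp add: algebra_simps)
      also have "\<dots> \<le> (real j * E (real n - 1) * W a j) * ?g ?b ?i + w a j * (real ?i * E (real n - 1) * W ?b ?i)"
        using A B g w_nonneg by (intro add_mono mult_right_mono mult_left_mono) auto
      also have "\<dots> \<le> (real j * E (real n - 1) * W a j) * W ?b ?i + W a j * (real ?i * E (real n - 1) * W ?b ?i)"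
        using g w_le tau_nonneg En by (intro add_mono mult_right_mono mult_left_mono) auto
      also have "\<dots> = (real j + real ?i) * E (real n - 1) * (W a j * W ?b ?i)"
        by (simp add: algebra_simps)
      also have "real j + real ?i = real k" using that by (simp add: of_nat_diff)
      finally show ?thesis .
    qed (auto simp: tau_0)
    define A B C where "A = (\<Sum>a\<le>n. \<Sum>j\<le>k. w a j * w (n - a) (k - j))"
      and "B = (\<Sum>a\<le>n. \<Sum>j\<le>k. ?g a j * ?g (n - a) (k - j))"
      and "C = (\<Sum>a\<le>n. \<Sum>j\<le>k. W a j * W (n - a) (k - j))"
    define F where "F = real k * E (real n - 1)"
    have "B - A \<le> F * C"
      unfolding A_def B_def C_def F_def sum_subtractf[symmetric] sum_distrib_left
      by (intro sum_mono le) auto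
    then have BA: "s * B - s * A \<le> s * (F * C)" using s_bounds by (metis mult_left_mono right_diff_distrib)
    define e where "e = (if k = 1 then \<tau> n else 0)"
    have 1: "2 * (real n - 1) * w n k = real n * (s * A)" using w_rec[OF k, of n] by (simp add: A_def)
    have 2: "s * B = 2 * (?g n k - e)" using killed_weight_rec[OF k, of s n] by (simp add: B_def e_def)
    have 4: "2 * (real n - 1) * W n k = real n * C" using marks_rec[of n k] by (simp add: C_def)
    have En: "E (real n - 1) \<ge> 0" using E_nonneg[of "n - 1"] n by (simp add: of_nat_diff)
    have "real n * (s * B) - real n * (s * A) \<le> real n * (s * (F * C))"
      using BA by (metis mult_left_mono of_nat_0_le_iff right_diff_distrib)
    then have "2 * real n * (?g n k - e) - 2 * (real n - 1) * w n k \<le> s * F * (2 * (real n - 1) * W n k)"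
      unfolding 1 2 4 by (simp add: mult_ac)
    also have "\<dots> \<le> s * F * (2 * real n * W n k)"
      using En s_bounds tau_nonneg unfolding F_def by (intro mult_left_mono mult_right_mono) auto
    finally have main: "2 * real n * (?g n k - w n k) \<le> 2 * real n * (s * F * W n k) + 2 * (real n * e - w n k)"
      by (simp add: algebra_simps)
    have rn: "real n > 0" using n by simp
    have "?g n k - w n k \<le> real k * E (real n) * W n k"
    \<comment> \<open>Only a component with a single mark can stop successfully, so a new error
      arises only for \<open>k = 1\<close>.\<close>
    proof (cases "k = 1")
      case False
      then have "2 * (real n * e - w n k) \<le> 0" using w_nonneg[of n k] by (simp add: e_def)
      with main have "2 * real n * (?g n k - w n k) \<le> 2 * real n * (s * F * W n k)" by linarith
      then have "?g n k - w n k \<le> s * F * W n k" using rn by simp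
      also have "\<dots> \<le> 1 * F * W n k"
        using s_bounds En tau_nonneg unfolding F_def by (intro mult_right_mono) auto
      also have "\<dots> \<le> real k * E (real n) * W n k"
        unfolding F_def mult_1 using n tau_nonneg by (intro mult_right_mono mult_left_mono E_mono) auto
      finally show ?thesis .
    next
      case True
      have "real n * e - w n k \<le> (1 - s) * (\<epsilon> * real n + real N) * W n k"
        using w_1_lower[OF assms(1,2) less.prems] True by (simp add: e_def)
      then have "2 * real n * (?g n k - w n k) \<le> 2 * real n * (s * F * W n k) + 
           2 * ((1 - s) * (\<epsilon> * real n + real N) * W n k)"
        by (intro order_trans[OF main] add_left_mono mult_left_mono) auto
      also have "\<dots> = 2 * real n * ((s * F + (1 - s) * (\<epsilon> + real N / real n)) * W n k)"
        using rn by (simp add: field_simps)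
      finally have "?g n k - w n k \<le> (s * F + (1 - s) * (\<epsilon> + real N / real n)) * W n k"
        using rn by simp
      also have "\<dots> \<le> real k * E (real n) * W n k"
      proof (intro mult_right_mono)
        \<comment> \<open>The new share \<open>real N / real n\<close> is absorbed by the increase
          of the logarithm from \<open>n - 1\<close> to \<open>n\<close>, and the rest by
          \<open>s * \<epsilon> + (1 - s) * \<epsilon> = \<epsilon>\<close>.\<close>
        have "ln (real n - 1) - ln (real n) = ln (1 - 1 / real n)"
        proof -
          have "ln ((real n - 1) / real n) = ln (real n - 1) - ln (real n)"
            using n by (intro ln_divide_pos) auto
          moreover have "(real n - 1) / real n = 1 - 1 / real n" using n by (simp add: field_simps)
          ultimately show ?thesis by simp
        qed
        also have "\<dots> \<le> - (1 / real n)"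
          using ln_le_minus_one[of "1 - 1 / real n"] n by (simp add: field_simps)
        finally have ln: "ln (real n - 1) + 1 / real n \<le> ln (real n)" by simp
        have l0: "1 + ln (real n - 1) \<ge> 0" using n by (intro add_nonneg_nonneg) auto
        have "s * F + (1 - s) * (\<epsilon> + real N / real n) = 
           \<epsilon> + (1 - s) * real N * (s * (1 + ln (real n - 1)) + 1 / real n)"
          unfolding F_def E_def True by (simp add: algebra_simps diff_divide_distrib)
        also have "\<dots> \<le> \<epsilon> + (1 - s) * real N * (1 * (1 + ln (real n - 1)) + 1 / real n)"
          using s_bounds l0 by (intro add_mono mult_left_mono mult_right_mono) auto
        also have "\<dots> \<le> \<epsilon> + (1 - s) * real N * (1 + ln (real n))"
        proof (intro add_left_mono mult_left_mono)
          show "1 * (1 + ln (real n - 1)) + 1 / real n \<le> 1 + ln (real n)" using ln by simp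
        qed (use s_bounds in auto)
        finally show "s * F + (1 - s) * (\<epsilon> + real N / real n) \<le> real k * E (real n)"
          by (simp add: E_def True)
      qed (use tau_nonneg in auto)
      finally show ?thesis .
    qed
    then show ?thesis by (simp add: E_def)
  qed
qed

end

section \<open>The chi limit of the killed process\<close>

lemma sum_upto_divide: "(\<Sum>l=1..m. real l / c) = real m * (real m + 1) / (2 * c)"
proof -
  have *: "(\<Sum>l=1..m. real l) = real m * (real m + 1) / 2"
    by (induction m) (auto simp: field_simps)
  show ?thesis unfolding sum_divide_distrib[symmetric] * by simp
qed

text \<open>In \<open>weighted_split_eq\<close> the products with \<open>i\<close> below
  \<open>sqrt n\<close> are at least \<open>1 / 2\<close>, so the sum is at least of order
  \<open>n * sqrt n * \<tau> n\<close>. The threshold guarantees \<open>I \<ge> 9 * c + 1\<close>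
  for \<open>I + 1\<close> the integer part of \<open>sqrt n\<close>, which yields
  \<open>6 * c * (I + 2) \<le> I * (I + 1)\<close>, while
  \<open>n \<le> (I + 2)\<^sup>2\<close>.\<close>

lemma (in cut_weights) weighted_split_large:
  assumes "n \<ge> (9 * c + 2)\<^sup>2"
  shows "real c * (real n * \<tau> n) \<le> (\<Sum>a\<le>n. real a * \<tau> a * (real (n - a) * \<tau> (n - a)))"
proof -
  have n: "n > 0" using assms by (auto intro: Nat.gr0I)
  define m where "m = nat \<lfloor>sqrt (real n)\<rfloor>"
  have m: "real m \<le> sqrt (real n)" "sqrt (real n) < real m + 1"
    unfolding m_def by (auto simp: of_nat_nat)
  have mn: "(real m)\<^sup>2 \<le> real n" "real n < (real m + 1)\<^sup>2"
  proof -
    show "(real m)\<^sup>2 \<le> real n" using power_mono[OF m(1), of 2] by simp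
    show "real n < (real m + 1)\<^sup>2" using power_strict_mono[OF m(2), of 2] by simp
  qed
  have "9 * c + 2 \<le> m"
  proof (rule ccontr)
    assume "\<not> 9 * c + 2 \<le> m"
    then have "(m + 1)\<^sup>2 \<le> (9 * c + 2)\<^sup>2" by (intro power_mono) auto
    moreover have "n < (m + 1)\<^sup>2" using mn(2) by (metis of_nat_1 of_nat_add of_nat_less_iff of_nat_power)
    ultimately show False using assms by linarith
  qed
  then obtain I where I: "m = Suc I" "9 * c + 1 \<le> I" by (cases m) auto
  have In: "I < n"
  proof -
    have "real m * 1 \<le> (real m)\<^sup>2" unfolding power2_eq_square using I by (intro mult_left_mono) auto
    then show ?thesis using mn I by simp
  qed
  define p where "p = (\<lambda>i. \<Prod>l=1..i. 1 - real l / real n)"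
  have p0: "p i \<ge> 0" if "i < n" for i
    unfolding p_def using that by (intro prod_nonneg) auto
  have p: "p i \<ge> 1 / 2" if "i \<le> I" for i
  proof -
    have "1 - (\<Sum>l=1..i. real l / real n) \<le> p i"
      unfolding p_def using that In by (intro prod_ge_one_minus_sum) auto
    moreover have "(\<Sum>l=1..i. real l / real n) = real i * (real i + 1) / 2 / real n"
      using sum_upto_divide[of "real n" i] by simp
    moreover have "real i * (real i + 1) \<le> real m * real m"
      using that I by (intro mult_mono) auto
    then have "real i * (real i + 1) \<le> real n" using mn by (simp add: power2_eq_square)
    then have "real i * (real i + 1) / 2 / real n \<le> 1 / 2" using n by (simp add: field_simps)
    ultimately show ?thesis by linarith
  qed
  have sumI: "(\<Sum>i\<le>I. real i * (real i + 1)) = real I * (real I + 1) * (real I + 2) / 3" for I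
    by (induction I) (auto simp: field_simps)
  have "real c * real n \<le> real c * ((real I + 2) * (real I + 2))"
    using mn(2) unfolding I(1) power2_eq_square by (intro mult_left_mono) (auto simp: algebra_simps)
  also have "\<dots> = (real c * (real I + 2)) * (real I + 2)" by simp
  also have "\<dots> \<le> (real I * (real I + 1) / 6) * (real I + 2)"
  proof (intro mult_right_mono)
    have c: "9 * real c + 1 \<le> real I" using I(2) by linarith
    have "6 * (real c * (real I + 2)) \<le> 9 * real c * (real I + 1)"
      using c mult_nonneg_nonneg[of "real c" "3 * real I - 3"] by (simp add: algebra_simps)
    also have "\<dots> \<le> real I * (real I + 1)" using c by (intro mult_right_mono) auto
    finally show "real c * (real I + 2) \<le> real I * (real I + 1) / 6" by simp
  qed simp
  also have "\<dots> = (\<Sum>i\<le>I. real i * (real i + 1) / 2)"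
    unfolding sum_divide_distrib[symmetric] sumI by simp
  also have "\<dots> \<le> (\<Sum>i\<le>I. real i * (real (i + 1) * p i))"
  proof (rule sum_mono)
    fix i assume "i \<in> {..I}"
    then have "real i * (real (i + 1) * (1 / 2)) \<le> real i * (real (i + 1) * p i)"
      using p[of i] by (intro mult_left_mono) auto
    then show "real i * (real i + 1) / 2 \<le> real i * (real (i + 1) * p i)" by (simp add: add.commute)
  qed
  also have "\<dots> \<le> (\<Sum>i<n. real i * (real (i + 1) * p i))"
    using In p0 by (intro sum_mono2) auto
  finally have "real c * real n * \<tau> n \<le> (\<Sum>i<n. real i * (real (i + 1) * p i)) * \<tau> n"
    using tau_nonneg by (rule mult_right_mono)
  then show ?thesis
    unfolding weighted_split_eq[OF n] p_def by (simp add: mult_ac)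
qed

section \<open>The chi density with an even number of degrees of freedom\<close>

lemma chi_density_even:
  assumes "k \<ge> 1"
  shows "chi_density (2 * k) x = (if x < 0 then 0 else x ^ (2 * k - 1) * exp (- x\<^sup>2 / 2) / (2 ^ (k - 1) * fact (k - 1)))"
proof -
  have "Gamma (real (2 * k) / 2) = fact (k - 1)"
    using Gamma_fact[of "k - 1", where 'a = real] assms by (simp add: of_nat_diff)
  moreover have "2 powr (real (2 * k) / 2 - 1) = (2 :: real) ^ (k - 1)"
    using assms by (subst powr_realpow[symmetric]) (auto simp: of_nat_diff)
  ultimately show ?thesis by (simp add: chi_density_def)
qed

text \<open>The substitution of \<open>x / sqrt 2\<close> into the Gaussian moment of odd order
  \<open>2 * k - 1\<close> over the half-line.\<close>

lemma chi_density_integral: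
  assumes "k \<ge> 1"
  shows "has_bochner_integral lborel (chi_density (2 * k)) 1"
proof -
  define c :: real where "c = 1 / sqrt 2"
  have c: "c > 0" by (simp add: c_def)
  have "has_bochner_integral lborel (\<lambda>x::real. indicator {0..} x *\<^sub>R (exp (- x\<^sup>2) * x ^ (2 * (k - 1) + 1))) (fact (k - 1) / 2)"
    by (rule gaussian_moment_odd_pos)
  then have "has_bochner_integral lborel (\<lambda>x. indicator {0..} (0 + c * x) *\<^sub>R (exp (- (0 + c * x)\<^sup>2) * (0 + c * x) ^ (2 * (k - 1) + 1)))
       ((fact (k - 1) / 2) /\<^sub>R \<bar>c\<bar>)"
    using c by (subst (asm) lborel_has_bochner_integral_real_affine_iff[where c = c and t = 0]) auto
  then have "has_bochner_integral lborel (\<lambda>x. (2 / (c * fact (k - 1))  * c\<^sup>2) * 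
       (indicator {0..} (0 + c * x) *\<^sub>R (exp (- (0 + c * x)\<^sup>2) * (0 + c * x) ^ (2 * (k - 1) + 1))))
       ((2 / (c * fact (k - 1)) * c\<^sup>2) * ((fact (k - 1) / 2) /\<^sub>R \<bar>c\<bar>))"
    by (intro has_bochner_integral_mult_right)
  also have "(2 / (c * fact (k - 1)) * c\<^sup>2) * ((fact (k - 1) / 2) /\<^sub>R \<bar>c\<bar>) = 1"
    using c by (simp add: field_simps power2_eq_square)
  also have "(\<lambda>x. (2 / (c * fact (k - 1)) * c\<^sup>2) * 
       (indicator {0..} (0 + c * x) *\<^sub>R (exp (- (0 + c * x)\<^sup>2) * (0 + c * x) ^ (2 * (k - 1) + 1)))) = chi_density (2 * k)"
  proof
    fix x :: real
    have c2: "c ^ 2 = 1 / 2" by (simp add: c_def power_divide)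
    have "Suc (2 * (k - 1) + 1) = 2 * k" using assms by simp
    then have "c * c ^ (2 * (k - 1) + 1) = (c ^ 2) ^ k"
      by (metis power_Suc power_mult)
    also have "\<dots> = 1 / (2 * 2 ^ (k - 1))"
      using assms unfolding c2 power_one_over by (cases k) auto
    finally have ck: "c * c ^ (2 * (k - 1) + 1) = 1 / (2 * 2 ^ (k - 1))" .
    have e: "2 * k - 1 = 2 * (k - 1) + 1" using assms by simp
    show "(2 / (c * fact (k - 1)) * c\<^sup>2) * 
       (indicator {0..} (0 + c * x) *\<^sub>R (exp (- (0 + c * x)\<^sup>2) * (0 + c * x) ^ (2 * (k - 1) + 1))) = chi_density (2 * k) x"
    proof (cases "x < 0")
      case True
      then show ?thesis using c by (simp add: chi_density_even[OF assms] zero_le_mult_iff)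
    next
      case False
      have "(2 / (c * fact (k - 1)) * c\<^sup>2) * (exp (- (c * x)\<^sup>2) * (c * x) ^ (2 * (k - 1) + 1)) =
         2 / fact (k - 1) * (c * c ^ (2 * (k - 1) + 1)) * exp (- (c * x)\<^sup>2) * x ^ (2 * (k - 1) + 1)"
        using c by (simp add: power_mult_distrib power2_eq_square field_simps)
      also have "\<dots> = chi_density (2 * k) x"
        unfolding ck chi_density_even[OF assms] e power_mult_distrib c2 using False by (simp add: mult_ac)
      finally show ?thesis using False c by simp
    qed
  qed
  finally show ?thesis .
qed

lemma chi_density_nonneg: "k \<ge> 1 \<Longrightarrow> chi_density (2 * k) x \<ge> 0"
  by (simp add: chi_density_even)

section \<open>Local lower bound for the law of the killed process\<close>

lemma power_le_fact_binomial: "(j + 1) ^ r \<le> fact r * ((j + r) choose r)"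
proof (induction r)
  case (Suc r)
  have "(j + 1) ^ Suc r \<le> (j + 1 + r) * (fact r * ((j + r) choose r))"
    using Suc unfolding power_Suc by (intro mult_mono) auto
  also have "\<dots> = fact r * (Suc (j + r) * ((j + r) choose r))" by (simp add: algebra_simps)
  also have "\<dots> = fact (Suc r) * ((j + Suc r) choose Suc r)"
    by (simp only: Suc_times_binomial_eq fact_Suc add_Suc_right of_nat_id mult_ac)
  finally show ?case .
qed simp

text \<open>From \<open>ln (1 - x) \<ge> - x - 2 x\<^sup>2\<close> for
  \<open>0 \<le> x \<le> 1 / 2\<close>. The sums are rounded up to powers of \<open>m + 1\<close>,
  which is \<open>j + k\<close> in the application.\<close>

lemma prod_one_minus_ge_exp:
  assumes "2 * m \<le> n" "n > 0"
  shows "(\<Prod>l=1..m. 1 - real l / real n) \<ge> exp (- (real (m + 1))\<^sup>2 / (2 * real n) - 2 * real (m + 1) ^ 3 / (real n)\<^sup>2)"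
proof -
  have x: "0 \<le> real l / real n \<and> real l / real n \<le> 1 / 2" if "l \<in> {1..m}" for l
    using that assms by (auto simp: field_simps)
  have "(real (m + 1))\<^sup>2 / (2 * real n) + 2 * real (m + 1) ^ 3 / (real n)\<^sup>2 \<ge> 
    (\<Sum>l=1..m. real l / real n + 2 * (real l / real n)\<^sup>2)"
  proof -
    have "(\<Sum>l=1..m. real l / real n) = real m * (real m + 1) / (2 * real n)"
      by (rule sum_upto_divide)
    also have "\<dots> \<le> (real (m + 1))\<^sup>2 / (2 * real n)"
      unfolding power2_eq_square using assms by (intro divide_right_mono mult_mono) auto
    finally have 1: "(\<Sum>l=1..m. real l / real n) \<le> (real (m + 1))\<^sup>2 / (2 * real n)" .
    have "(\<Sum>l=1..m. 2 * (real l / real n)\<^sup>2) \<le> (\<Sum>l=1..m. 2 * (real (m + 1) / real n)\<^sup>2)"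
      by (intro sum_mono mult_left_mono power_mono divide_right_mono) auto
    also have "\<dots> = real m * (2 * (real (m + 1))\<^sup>2 / (real n)\<^sup>2)"
      by (simp add: power_divide)
    also have "\<dots> \<le> real (m + 1) * (2 * (real (m + 1))\<^sup>2 / (real n)\<^sup>2)"
      by (intro mult_right_mono) auto
    also have "\<dots> = 2 * real (m + 1) ^ 3 / (real n)\<^sup>2"
      by (simp add: power3_eq_cube power2_eq_square)
    finally show ?thesis using 1 by (simp add: sum.distrib)
  qed
  moreover have "(\<Sum>l=1..m. - (real l / real n) - 2 * (real l / real n)\<^sup>2) =
      - (\<Sum>l=1..m. real l / real n + 2 * (real l / real n)\<^sup>2)"
    unfolding sum_negf[symmetric] by (intro sum.cong refl) simp
  ultimately have "exp (- (real (m + 1))\<^sup>2 / (2 * real n) - 2 * real (m + 1) ^ 3 / (real n)\<^sup>2) \<le>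
      exp (\<Sum>l=1..m. - (real l / real n) - 2 * (real l / real n)\<^sup>2)"
    unfolding exp_le_cancel_iff minus_divide_left[symmetric] by linarith
  also have "\<dots> = (\<Prod>l=1..m. exp (- (real l / real n) - 2 * (real l / real n)\<^sup>2))"
    by (simp add: exp_sum)
  also have "\<dots> \<le> (\<Prod>l=1..m. 1 - real l / real n)"
  proof (intro prod_mono conjI)
    fix l assume "l \<in> {1..m}"
    then have l: "0 \<le> real l / real n" "real l / real n \<le> 1 / 2" using x by auto
    have "exp (- (real l / real n) - 2 * (real l / real n)\<^sup>2) \<le> exp (ln (1 - real l / real n))"
      using ln_one_minus_pos_lower_bound[OF l] by simp
    also have "\<dots> = 1 - real l / real n" using l by (intro exp_ln) linarith
    finally show "exp (- (real l / real n) - 2 * (real l / real n)\<^sup>2) \<le> 1 - real l / real n" .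
  qed simp
  finally show ?thesis .
qed

text \<open>The lower half of a local limit theorem. The polynomial factors are bounded below
  through \<open>x * sqrt n < j + 1\<close>, the product through
  \<open>j + k \<le> y * sqrt n\<close>; so the power is in \<open>x\<close> and the exponential in
  \<open>y\<close>, which tends to \<open>x\<close>. The powers of \<open>n\<close> cancel against
  \<open>n choose k\<close>, which is at most \<open>n ^ k / fact k\<close>.\<close>

lemma killed_coeff_lower:
  assumes "k \<ge> 1" "n > 0" "0 \<le> x" "x * sqrt n + k \<le> n / 2" "k \<le> n"
  defines "j \<equiv> nat \<lfloor>x * sqrt n\<rfloor>" and "y \<equiv> x + k / sqrt n"
  shows "sqrt n * (killed_coeff n k j / real (n choose k)) \<ge> 
    x ^ (2 * k - 1) * exp (- y\<^sup>2 / 2 - 2 * y ^ 3 / sqrt n) / (2 ^ (k - 1) * fact (k - 1))"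
proof -
  define r where "r = sqrt (real n)"
  have r: "r > 0" "r\<^sup>2 = real n" using assms by (auto simp: r_def)
  have j: "real j \<le> x * r" "x * r < real j + 1"
    using assms(3) r by (auto simp: j_def r_def of_nat_nat)
  define m where "m = j + k - 1"
  have m1: "m + 1 = j + k" using assms(1) by (simp add: m_def)
  have yr: "y * r = x * r + k" using r by (simp add: y_def r_def[symmetric] distrib_right)
  have jk: "real (m + 1) \<le> y * r" unfolding m1 yr using j by simp
  have m2: "2 * m \<le> n"
  proof -
    have "real (m + 1) \<le> n / 2" using jk yr assms(4) by (simp add: r_def[symmetric])
    then show ?thesis by linarith
  qed
  have E: "exp (- y\<^sup>2 / 2 - 2 * y ^ 3 / r) \<le> (\<Prod>l=1..m. 1 - real l / real n)"
  proof -
    have "(real (m + 1))\<^sup>2 / (2 * real n) \<le> (y * r)\<^sup>2 / (2 * real n)"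
      using jk by (intro divide_right_mono power_mono) auto
    also have "\<dots> = y\<^sup>2 / 2" using r assms(2) by (simp add: power_mult_distrib)
    finally have 1: "(real (m + 1))\<^sup>2 / (2 * real n) \<le> y\<^sup>2 / 2" .
    have "2 * real (m + 1) ^ 3 / (real n)\<^sup>2 \<le> 2 * (y * r) ^ 3 / (real n)\<^sup>2"
      using jk by (intro divide_right_mono mult_left_mono power_mono) auto
    also have "\<dots> = 2 * y ^ 3 / r" unfolding r(2)[symmetric] using r(1) 
      by (simp add: power_mult_distrib field_simps eval_nat_numeral)
    finally have "2 * real (m + 1) ^ 3 / (real n)\<^sup>2 \<le> 2 * y ^ 3 / r" .
    with 1 have "exp (- y\<^sup>2 / 2 - 2 * y ^ 3 / r) \<le> exp (- (real (m + 1))\<^sup>2 / (2 * real n) - 2 * real (m + 1) ^ 3 / (real n)\<^sup>2)"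
      by simp
    also have "\<dots> \<le> (\<Prod>l=1..m. 1 - real l / real n)"
      by (rule prod_one_minus_ge_exp[OF m2 assms(2)])
    finally show ?thesis .
  qed
  define b where "b = real ((j + 2 * k - 2) choose (2 * k - 2))"
  have b: "(x * r) ^ (2 * k - 2) / fact (2 * k - 2) \<le> b"
  proof -
    have "(x * r) ^ (2 * k - 2) \<le> (real (j + 1)) ^ (2 * k - 2)"
      using j assms(3) r by (intro power_mono) auto
    also have "\<dots> \<le> fact (2 * k - 2) * real ((j + (2 * k - 2)) choose (2 * k - 2))"
    proof -
      have "real ((j + 1) ^ (2 * k - 2)) \<le> real (fact (2 * k - 2) * ((j + (2 * k - 2)) choose (2 * k - 2)))"
        using power_le_fact_binomial by (simp only: of_nat_le_iff)
      then show ?thesis by simp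
    qed
    also have "j + (2 * k - 2) = j + 2 * k - 2" using assms(1) by simp
    finally show ?thesis by (simp add: b_def divide_le_eq mult.commute)
  qed
  have nk: "real (n choose k) \<le> real n ^ k / fact k" "real (n choose k) > 0"
  proof -
    have "fact k * (n choose k) \<le> n ^ k"
      using binomial_fact_pow[of n k] by (simp add: mult.commute)
    then have "real (fact k * (n choose k)) \<le> real (n ^ k)" by (simp only: of_nat_le_iff)
    then show "real (n choose k) \<le> real n ^ k / fact k" by (simp add: field_simps)
    show "real (n choose k) > 0" using assms by simp
  qed
  have cc: "cut_coeff k = fact (2 * k - 2) / (2 ^ (k - 1) * fact (k - 1) * fact k)"
    using assms(1) by (simp add: cut_coeff_def)
  have rk: "r * ((r ^ (2 * k - 2)) * r) = real n ^ k"
  proof -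
    have "r * ((r ^ (2 * k - 2)) * r) = r ^ (2 * k - 2 + 2)" unfolding power_add by (simp add: power2_eq_square)
    also have "2 * k - 2 + 2 = 2 * k" using assms(1) by simp
    finally show ?thesis using r by (simp add: power_mult)
  qed
  have xk: "x ^ (2 * k - 2) * x = x ^ (2 * k - 1)"
  proof -
    have "2 * k - 1 = Suc (2 * k - 2)" using assms(1) by simp
    then show ?thesis by simp
  qed
  let ?E = "exp (- y\<^sup>2 / 2 - 2 * y ^ 3 / r)"
  have "killed_coeff n k j = cut_coeff k * b * (real (j + k) * (\<Prod>l=1..m. 1 - real l / real n))"
    by (simp add: killed_coeff_def b_def m_def)
  also have "\<dots> \<ge> cut_coeff k * ((x * r) ^ (2 * k - 2) / fact (2 * k - 2)) * (x * r * ?E)"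
  proof (intro mult_mono b E)
    show "x * r \<le> real (j + k)" using j assms(1) by linarith
  qed (use assms(3) r in \<open>auto simp: cut_coeff_def b_def intro!: mult_nonneg_nonneg\<close>)
  finally have kc: "cut_coeff k * ((x * r) ^ (2 * k - 2) / fact (2 * k - 2)) * (x * r * ?E) \<le> killed_coeff n k j" .
  have L0: "0 \<le> cut_coeff k * ((x * r) ^ (2 * k - 2) / fact (2 * k - 2)) * (x * r * ?E)"
    using assms(3) r by (auto simp: cut_coeff_def intro!: mult_nonneg_nonneg)
  have "x ^ (2 * k - 1) * ?E / (2 ^ (k - 1) * fact (k - 1)) = 
      r * ((cut_coeff k * ((x * r) ^ (2 * k - 2) / fact (2 * k - 2)) * (x * r * ?E)) / (real n ^ k / fact k))"
    unfolding cc xk[symmetric] rk[symmetric] using r(1) by (simp add: power_mult_distrib field_simps)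
  also have "\<dots> \<le> r * (killed_coeff n k j / real (n choose k))"
    using nk kc r L0 by (intro mult_left_mono frac_le) auto
  finally show ?thesis by (simp add: r_def)
qed

text \<open>Turns a sum into an integral over steps of length \<open>1 / sqrt n\<close>, so that
  dominated convergence can replace an estimate of Riemann sums.\<close>

lemma step_integral:
  fixes a :: "nat \<Rightarrow> real"
  assumes "n > 0"
  shows "has_bochner_integral lborel
     (\<lambda>x. \<Sum>j\<le>n. indicator {j / sqrt n..<(real j + 1) / sqrt n} x * (sqrt n * a j)) (\<Sum>j\<le>n. a j)"
proof -
  have "has_bochner_integral lborel (\<lambda>x. indicator {j / sqrt n..<(real j + 1) / sqrt n} x * (sqrt n * a j)) (a j)" for j :: nat
  proof -
    have "has_bochner_integral lborel (indicator {j / sqrt n..<(real j + 1) / sqrt n} :: real \<Rightarrow> real)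
       (measure lborel {j / sqrt n..<(real j + 1) / sqrt n})"
      by (intro has_bochner_integral_real_indicator) (auto simp: divide_right_mono)
    also have "measure lborel {j / sqrt n..<(real j + 1) / sqrt n} = 1 / sqrt n"
      by (simp add: divide_right_mono add_divide_distrib)
    finally show ?thesis using has_bochner_integral_mult_left[of "sqrt n * a j" lborel _ "1 / sqrt n"] assms by simp
  qed
  then show ?thesis by (intro has_bochner_integral_sum)
qed

text \<open>
  Only lower bounds with the right limit are needed: they are applied to \<open>v\<close> and to \<open>1 - v\<close>,
  and the total mass is at most 1.
\<close>

lemma killed_coeff_sum_tendsto:
  fixes v :: "real \<Rightarrow> real"
  assumes k: "k \<ge> 1" and le: "\<And>n. n \<ge> k \<Longrightarrow> (\<Sum>j\<le>n. killed_coeff n k j) \<le> real (n choose k)"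
    and v: "continuous_on UNIV v" "\<And>x. 0 \<le> v x" "\<And>x. v x \<le> 1"
  shows "(\<lambda>n. (\<Sum>j\<le>n. killed_coeff n k j * v (real (j + k - 1) / sqrt n)) / real (n choose k))
    \<longlonglongrightarrow> (LINT x|lborel. chi_density (2 * k) x * v x)"
proof -
  define S where "S = (\<lambda>u n. \<Sum>j\<le>n. killed_coeff n k j / real (n choose k) * u (real (j + k - 1) / sqrt n))"
  have f: "integrable lborel (chi_density (2 * k))" "(LINT x|lborel. chi_density (2 * k) x) = 1"
    using chi_density_integral[OF k] by (auto simp: has_bochner_integral_iff)
  have fm: "chi_density (2 * k) \<in> borel_measurable borel" using f(1) by simp
  have lower: "\<exists>L. L \<longlonglongrightarrow> (LINT x|lborel. chi_density (2 * k) x * u x) \<and> (\<forall>n\<ge>k. L n \<le> S u n)"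
    if u: "continuous_on UNIV u" "\<And>x. 0 \<le> u x" "\<And>x. u x \<le> 1" for u :: "real \<Rightarrow> real"
  proof -
    define y where "y = (\<lambda>n x. x + k / sqrt (real n))"
    \<comment> \<open>The bound of \<open>killed_coeff_lower\<close> times \<open>u\<close>, and 0
      where \<open>x\<close> is out of its range. For \<open>n \<ge> k\<close> it lies below the
      step function that integrates to \<open>S u n\<close>; since \<open>y n x \<ge> x\<close> and
      \<open>u \<le> 1\<close>, it is also dominated by the chi density.\<close>
    define l where "l = (\<lambda>n x. if 0 \<le> x \<and> x * sqrt n + k \<le> n / 2 then
       x ^ (2 * k - 1) * exp (- (y n x)\<^sup>2 / 2 - 2 * (y n x) ^ 3 / sqrt n) / (2 ^ (k - 1) * fact (k - 1))
         * u (real (nat \<lfloor>x * sqrt n\<rfloor> + k - 1) / sqrt n) else 0)"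
    have um [measurable]: "u \<in> borel_measurable borel"
      using u(1) by (simp add: borel_measurable_continuous_onI)
    have lm: "l n \<in> borel_measurable lborel" for n
      unfolding l_def y_def by measurable
    have l_le: "\<bar>l n x\<bar> \<le> chi_density (2 * k) x" for n x
    proof (cases "0 \<le> x \<and> x * sqrt n + k \<le> n / 2")
      case True
      have xy: "x \<le> y n x" by (simp add: y_def)
      have "x\<^sup>2 \<le> (y n x)\<^sup>2" "0 \<le> 2 * (y n x) ^ 3 / sqrt n"
        using xy True by (auto intro: power_mono)
      then have "exp (- (y n x)\<^sup>2 / 2 - 2 * (y n x) ^ 3 / sqrt n) \<le> exp (- x\<^sup>2 / 2)" by simp
      then have "x ^ (2 * k - 1) * exp (- (y n x)\<^sup>2 / 2 - 2 * (y n x) ^ 3 / sqrt n) / (2 ^ (k - 1) * fact (k - 1))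
         * u (real (nat \<lfloor>x * sqrt n\<rfloor> + k - 1) / sqrt n) \<le> 
         x ^ (2 * k - 1) * exp (- x\<^sup>2 / 2) / (2 ^ (k - 1) * fact (k - 1)) * 1"
        using u True by (intro mult_mono divide_right_mono mult_left_mono) auto
      moreover have "0 \<le> x ^ (2 * k - 1) * exp (- (y n x)\<^sup>2 / 2 - 2 * (y n x) ^ 3 / sqrt n) / (2 ^ (k - 1) * fact (k - 1))
         * u (real (nat \<lfloor>x * sqrt n\<rfloor> + k - 1) / sqrt n)"
        using u True by (intro mult_nonneg_nonneg divide_nonneg_nonneg) auto
      moreover have "l n x = x ^ (2 * k - 1) * exp (- (y n x)\<^sup>2 / 2 - 2 * (y n x) ^ 3 / sqrt n) / (2 ^ (k - 1) * fact (k - 1))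
         * u (real (nat \<lfloor>x * sqrt n\<rfloor> + k - 1) / sqrt n)" using True by (simp add: l_def)
      ultimately have "0 \<le> l n x" "l n x \<le> x ^ (2 * k - 1) * exp (- x\<^sup>2 / 2) / (2 ^ (k - 1) * fact (k - 1)) * 1"
        by (simp_all only:)
      then show ?thesis using True by (simp add: chi_density_even[OF k])
    qed (use chi_density_nonneg[OF k] in \<open>auto simp: l_def\<close>)
    have sq: "filterlim (\<lambda>n. sqrt (real n)) at_top sequentially"
      by (rule filterlim_compose[OF sqrt_at_top filterlim_real_sequentially])
    have l_lim: "(\<lambda>n. l n x) \<longlonglongrightarrow> chi_density (2 * k) x * u x" for x
    proof (cases "x < 0")
      case True
      then show ?thesis by (simp add: l_def chi_density_even[OF k])
    next
      case False
      then have x: "x \<ge> 0" by simp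
      have ks: "(\<lambda>n. c / sqrt (real n)) \<longlonglongrightarrow> 0" for c :: real
        by (rule tendsto_divide_0[OF tendsto_const filterlim_at_top_imp_at_infinity[OF sq]])
      have yl: "(\<lambda>n. y n x) \<longlonglongrightarrow> x"
        unfolding y_def using tendsto_add[OF tendsto_const ks, of x] by simp
      have y3: "(\<lambda>n. 2 * (y n x) ^ 3 / sqrt n) \<longlonglongrightarrow> 0"
        using tendsto_mult[OF tendsto_mult[OF tendsto_const[of 2] tendsto_power[OF yl, of 3]] ks[of 1]] by simp
      have el: "(\<lambda>n. exp (- (y n x)\<^sup>2 / 2 - 2 * (y n x) ^ 3 / sqrt n)) \<longlonglongrightarrow> exp (- x\<^sup>2 / 2 - 0)"
        by (intro tendsto_intros yl y3) auto
      have jl: "(\<lambda>n. real (nat \<lfloor>x * sqrt n\<rfloor> + k - 1) / sqrt n) \<longlonglongrightarrow> x"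
      proof (rule real_tendsto_sandwich)
        show "\<forall>\<^sub>F n in sequentially. x - 1 / sqrt n \<le> real (nat \<lfloor>x * sqrt n\<rfloor> + k - 1) / sqrt n"
          using eventually_gt_at_top[of 0]
        proof eventually_elim
          case (elim n)
          have "x * sqrt n - 1 \<le> real (nat \<lfloor>x * sqrt n\<rfloor> + k - 1)" using k x 
            by (simp add: of_nat_diff of_nat_nat) linarith
          then have "(x * sqrt n - 1) / sqrt n \<le> real (nat \<lfloor>x * sqrt n\<rfloor> + k - 1) / sqrt n"
            by (intro divide_right_mono) auto
          then show ?case using elim by (simp add: diff_divide_distrib)
        qed
        show "\<forall>\<^sub>F n in sequentially. real (nat \<lfloor>x * sqrt n\<rfloor> + k - 1) / sqrt n \<le> x + k / sqrt n"
          using eventually_gt_at_top[of 0]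
        proof eventually_elim
          case (elim n)
          have "real (nat \<lfloor>x * sqrt n\<rfloor> + k - 1) \<le> x * sqrt n + k" using k x 
            by (simp add: of_nat_diff of_nat_nat) linarith
          then have "real (nat \<lfloor>x * sqrt n\<rfloor> + k - 1) / sqrt n \<le> (x * sqrt n + k) / sqrt n"
            by (intro divide_right_mono) auto
          then show ?case using elim by (simp add: add_divide_distrib)
        qed
        show "(\<lambda>n. x - 1 / sqrt n) \<longlonglongrightarrow> x" using tendsto_diff[OF tendsto_const ks, of x 1] by simp
        show "(\<lambda>n. x + k / sqrt n) \<longlonglongrightarrow> x" using tendsto_add[OF tendsto_const ks, of x] by simp
      qed
      have ul: "(\<lambda>n. u (real (nat \<lfloor>x * sqrt n\<rfloor> + k - 1) / sqrt n)) \<longlonglongrightarrow> u x"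
        using continuous_on_tendsto_compose[OF u(1) jl] by simp
      have "(\<lambda>n. x ^ (2 * k - 1) * exp (- (y n x)\<^sup>2 / 2 - 2 * (y n x) ^ 3 / sqrt n) / (2 ^ (k - 1) * fact (k - 1))
         * u (real (nat \<lfloor>x * sqrt n\<rfloor> + k - 1) / sqrt n)) \<longlonglongrightarrow> 
        x ^ (2 * k - 1) * exp (- x\<^sup>2 / 2 - 0) / (2 ^ (k - 1) * fact (k - 1)) * u x"
        by (intro tendsto_intros el ul) auto
      moreover have "\<forall>\<^sub>F n in sequentially. x * sqrt n + k \<le> n / 2"
      proof -
        have "\<forall>\<^sub>F n in sequentially. sqrt (real n) \<ge> 2 * (x + k) \<and> sqrt (real n) \<ge> 1"
          using sq by (auto simp: filterlim_at_top eventually_conj_iff)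
        then show ?thesis
        proof eventually_elim
          case (elim n)
          have "real k * 1 \<le> real k * sqrt n" using elim by (intro mult_left_mono) simp_all
          then have "x * sqrt n + k \<le> x * sqrt n + k * sqrt n" by simp
          also have "\<dots> = (2 * (x + k)) * sqrt n / 2" by (simp add: algebra_simps)
          also have "\<dots> \<le> sqrt n * sqrt n / 2" using elim by (intro divide_right_mono mult_right_mono) auto
          finally show ?case by simp
        qed
      qed
      ultimately show ?thesis
        using x unfolding l_def chi_density_even[OF k]
        by (simp) (erule Lim_transform_eventually, auto elim!: eventually_mono)
    qed
    have l_int: "integrable lborel (l n)" for n
      by (rule Bochner_Integration.integrable_bound[OF f(1) lm]) (use l_le chi_density_nonneg[OF k] in auto)
    have "(\<lambda>n. LINT x|lborel. l n x) \<longlonglongrightarrow> (LINT x|lborel. chi_density (2 * k) x * u x)"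
    proof (rule integral_dominated_convergence[OF _ _ f(1)])
      show "(\<lambda>x. chi_density (2 * k) x * u x) \<in> borel_measurable lborel" using fm by measurable
    qed (use lm l_lim l_le in auto)
    moreover have "(LINT x|lborel. l n x) \<le> S u n" if n: "n \<ge> k" for n
    proof -
      have n0: "n > 0" using n k by simp
      let ?a = "\<lambda>j. killed_coeff n k j / real (n choose k) * u (real (j + k - 1) / sqrt n)"
      have a0: "?a j \<ge> 0" for j using u killed_coeff_nonneg[OF n0] by auto
      have ind0: "0 \<le> indicator {j / sqrt n..<(real j + 1) / sqrt n} x * (sqrt n * ?a j)" for j and x :: real
        by (intro mult_nonneg_nonneg a0) auto
      have "l n x \<le> (\<Sum>j\<le>n. indicator {j / sqrt n..<(real j + 1) / sqrt n} x * (sqrt n * ?a j))" for x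
      proof (cases "0 \<le> x \<and> x * sqrt n + k \<le> n / 2")
        case True
        define j where "j = nat \<lfloor>x * sqrt n\<rfloor>"
        have j: "real j \<le> x * sqrt n" "x * sqrt n < real j + 1"
          using True by (auto simp: j_def of_nat_nat)
        have xj: "x \<in> {j / sqrt n..<(real j + 1) / sqrt n}"
          using j n0 by (auto simp: field_simps)
        have "real j \<le> real n" using j True by linarith
        then have jn: "j \<in> {..n}" by simp
        have "l n x = x ^ (2 * k - 1) * exp (- (y n x)\<^sup>2 / 2 - 2 * (y n x) ^ 3 / sqrt n) / (2 ^ (k - 1) * fact (k - 1))
             * u (real (j + k - 1) / sqrt n)"
          using True by (simp add: l_def j_def)
        also have "\<dots> \<le> sqrt n * (killed_coeff n k j / real (n choose k)) * u (real (j + k - 1) / sqrt n)"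
          using killed_coeff_lower[OF k n0 True[THEN conjunct1] True[THEN conjunct2] n] u
          unfolding j_def y_def by (intro mult_right_mono) auto
        also have "\<dots> = indicator {j / sqrt n..<(real j + 1) / sqrt n} x * (sqrt n * ?a j)"
          using xj by simp
        also have "\<dots> \<le> (\<Sum>j\<le>n. indicator {j / sqrt n..<(real j + 1) / sqrt n} x * (sqrt n * ?a j))"
          by (rule member_le_sum[OF jn]) (rule ind0, simp)
        finally show ?thesis .
      next
        case False
        then have "l n x = 0" by (auto simp: l_def)
        then show ?thesis using sum_nonneg[of "{..n}", OF ind0] by simp
      qed
      moreover have "has_bochner_integral lborel
         (\<lambda>x. \<Sum>j\<le>n. indicator {j / sqrt n..<(real j + 1) / sqrt n} x * (sqrt n * ?a j)) (S u n)"
        unfolding S_def by (rule step_integral[OF n0])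
      ultimately show ?thesis
        using l_int by (metis (no_types, lifting) has_bochner_integral_iff integral_mono)
    qed
    ultimately show ?thesis by blast
  qed
  obtain L1 where L1: "L1 \<longlonglongrightarrow> (LINT x|lborel. chi_density (2 * k) x * v x)" "\<And>n. n \<ge> k \<Longrightarrow> L1 n \<le> S v n"
    using lower[OF v] by blast
  have "continuous_on UNIV (\<lambda>x. 1 - v x)" by (intro continuous_intros v)
  then obtain L2 where L2: "L2 \<longlonglongrightarrow> (LINT x|lborel. chi_density (2 * k) x * (1 - v x))" 
    "\<And>n. n \<ge> k \<Longrightarrow> L2 n \<le> S (\<lambda>x. 1 - v x) n"
    using lower[of "\<lambda>x. 1 - v x"] v by auto
  have "v \<in> borel_measurable borel" using v(1) by (simp add: borel_measurable_continuous_onI)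
  then have iv: "integrable lborel (\<lambda>x. chi_density (2 * k) x * v x)"
    using v fm chi_density_nonneg[OF k]
    by (intro Bochner_Integration.integrable_bound[OF f(1)]) (auto simp: abs_mult intro!: mult_left_le)
  have "(LINT x|lborel. chi_density (2 * k) x * (1 - v x)) = 1 - (LINT x|lborel. chi_density (2 * k) x * v x)"
    using Bochner_Integration.integral_diff[OF f(1) iv] f(2) by (simp add: algebra_simps)
  then have L2': "(\<lambda>n. 1 - L2 n) \<longlonglongrightarrow> (LINT x|lborel. chi_density (2 * k) x * v x)"
    using tendsto_diff[OF tendsto_const L2(1), of 1] by simp
  have "S v n \<le> 1 - L2 n" if "n \<ge> k" for n
  proof -
    have "S v n + S (\<lambda>x. 1 - v x) n = (\<Sum>j\<le>n. killed_coeff n k j) / real (n choose k)"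
      unfolding S_def sum.distrib[symmetric] sum_divide_distrib
      by (intro sum.cong refl) (simp add: algebra_simps)
    also have "\<dots> \<le> 1" using le[OF that] that by (simp add: divide_le_eq)
    finally show ?thesis using L2(2)[OF that] by linarith
  qed
  then have "S v \<longlonglongrightarrow> (LINT x|lborel. chi_density (2 * k) x * v x)"
    using L1 L2' by (intro real_tendsto_sandwich[OF _ _ L1(1) L2']) (auto simp: eventually_at_top_linorder)
  then show ?thesis by (simp add: S_def sum_divide_distrib)
qed

section \<open>Laplace transforms and weak convergence\<close>

text \<open>On \<open>x \<ge> 0\<close> a continuous step function is a continuous function of
  \<open>exp (- x)\<close> on the closed unit interval, because it vanishes for large
  \<open>x\<close>. Polynomials approximating it uniformly are combinations of the
  \<open>exp (- i x)\<close> with natural \<open>i\<close>, and the error is the same for all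
  measures involved.\<close>

lemma laplace_tendsto_imp_weak_conv:
  fixes M :: "real measure" and M_seq :: "nat \<Rightarrow> real measure"
  assumes M: "real_distribution M" "AE x in M. 0 \<le> x"
    and Ms: "\<And>n. real_distribution (M_seq n)" "\<And>n. AE x in M_seq n. 0 \<le> x"
    and L: "\<And>i :: nat. (\<lambda>n. LINT x|M_seq n. exp (- (real i * x))) \<longlonglongrightarrow> (LINT x|M. exp (- (real i * x)))"
  shows "weak_conv_m M_seq M"
proof (rule integral_cts_step_conv_imp_weak_conv[OF Ms(1) M(1)])
  fix a b :: real assume ab: "a < b"
  let ?f = "cts_step a b"
  \<comment> \<open>The cut-off at \<open>exp (- b - 1)\<close> keeps away from \<open>ln 0\<close>
    and changes no value, since \<open>?f\<close> vanishes from \<open>b\<close> on.\<close>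
  define h where "h = (\<lambda>v. ?f (- ln (max v (exp (- b - 1)))))"
  have contf: "continuous_on UNIV ?f"
    using cts_step_uniformly_continuous[OF ab] by (rule uniformly_continuous_imp_continuous)
  have pos: "max v (exp (- b - 1)) > 0" for v by (simp add: less_max_iff_disj)
  have "continuous_on {0..1} h"
    unfolding h_def
    by (intro continuous_on_compose2[OF contf] continuous_intros) (auto simp: less_imp_neq[OF pos, symmetric])
  have hx: "h (exp (- x)) = ?f x" for x
  proof (cases "x \<le> b + 1")
    case True
    then have "max (exp (- x)) (exp (- b - 1)) = exp (- x)" by (simp add: max_def)
    then show ?thesis by (simp add: h_def)
  next
    case False
    then have "max (exp (- x)) (exp (- b - 1)) = exp (- b - 1)" by (simp add: max_def)
    then show ?thesis using False ab by (simp add: h_def cts_step_def)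
  qed
  have int: "integrable N (\<lambda>x. exp (- (real i * x)))" if "real_distribution N" "AE x in N. 0 \<le> x" for N i
  proof -
    interpret real_distribution N by fact
    show ?thesis
    proof (rule integrable_const_bound[of _ 1])
      show "AE x in N. norm (exp (- (real i * x))) \<le> 1" using that(2) by (auto elim!: eventually_mono)
    qed simp
  qed
  show "(\<lambda>n. integral\<^sup>L (M_seq n) ?f) \<longlonglongrightarrow> integral\<^sup>L M ?f"
  proof (rule LIMSEQ_I)
    fix r :: real assume r: "r > 0"
    define e where "e = r / 3"
    have e: "e > 0" using r by (simp add: e_def)
    obtain g where g: "real_polynomial_function g" "\<And>x. x \<in> {0..1} \<Longrightarrow> \<bar>h x - g x\<bar> < e"
      using Stone_Weierstrass_real_polynomial_function[OF compact_Icc \<open>continuous_on {0..1} h\<close> e] by blast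
    obtain c d where gc: "g = (\<lambda>x. \<Sum>i\<le>d. c i * x ^ i)"
      using g(1) unfolding real_polynomial_function_iff_sum by blast
    define G where "G = (\<lambda>x. \<Sum>i\<le>d. c i * exp (- (real i * x)))"
    have Gx: "G x = g (exp (- x))" for x
      by (simp add: G_def gc exp_of_nat_mult[symmetric])
    have G: "(LINT x|N. G x) = (\<Sum>i\<le>d. c i * (LINT x|N. exp (- (real i * x))))" "integrable N G"
      if "real_distribution N" "AE x in N. 0 \<le> x" for N
      unfolding G_def using int[OF that] by (simp_all add: Bochner_Integration.integral_sum)
    have close: "\<bar>integral\<^sup>L N ?f - integral\<^sup>L N G\<bar> \<le> e" if N: "real_distribution N" "AE x in N. 0 \<le> x" for N
    proof -
      interpret real_distribution N by fact
      have f: "integrable N ?f" by (rule integrable_cts_step[OF ab])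
      have "\<bar>integral\<^sup>L N ?f - integral\<^sup>L N G\<bar> = \<bar>LINT x|N. ?f x - G x\<bar>"
        using f G(2)[OF N] by simp
      also have "\<dots> \<le> (LINT x|N. \<bar>?f x - G x\<bar>)" by (rule integral_abs_bound)
      also have "\<dots> \<le> (LINT x|N. e)"
      proof (rule integral_mono_AE)
        show "AE x in N. \<bar>?f x - G x\<bar> \<le> e"
          using N(2)
        proof eventually_elim
          case (elim x)
          then have "\<bar>h (exp (- x)) - g (exp (- x))\<bar> < e" by (intro g(2)) auto
          then show ?case by (simp add: hx Gx)
        qed
      qed (use f G(2)[OF N] in auto)
      also have "\<dots> = e" using prob_space by simp
      finally show ?thesis .
    qed
    have "(\<lambda>n. integral\<^sup>L (M_seq n) G) \<longlonglongrightarrow> integral\<^sup>L M G"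
      unfolding G(1)[OF M] G(1)[OF Ms] by (intro tendsto_sum tendsto_mult tendsto_const L)
    from LIMSEQ_D[OF this e] obtain n0 where n0: "\<And>n. n \<ge> n0 \<Longrightarrow> \<bar>integral\<^sup>L (M_seq n) G - integral\<^sup>L M G\<bar> < e"
      by auto
    have "norm (integral\<^sup>L (M_seq n) ?f - integral\<^sup>L M ?f) < r" if "n \<ge> n0" for n
      using n0[OF that] close[OF M] close[OF Ms, of n] unfolding e_def real_norm_def by linarith
    then show "\<exists>n0. \<forall>n\<ge>n0. norm (integral\<^sup>L (M_seq n) ?f - integral\<^sup>L M ?f) < r" by blast
  qed
qed

section \<open>The cuts of a uniform tree\<close>

lemma cut_weights_tree_weight:
  assumes "0 \<le> s" "s \<le> 1"
  shows "cut_weights (\<lambda>n. tree_weight 1 n 0) s (tree_weight s)"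
proof unfold_locales
  show "tree_weight 1 1 0 = 1" by (simp add: tree_weight_1)
  show "tree_weight s 1 1 = 1" by (simp add: tree_weight_1)
  show "2 * (real n - 1) * tree_weight 1 n 0 = real n * (\<Sum>a\<le>n. tree_weight 1 a 0 * tree_weight 1 (n - a) 0)" for n
    using tree_weight_rec[of n 1 0] by simp
  show "0 < tree_weight 1 n 0" if "0 < n" for n using that by (rule tree_weight_pos)
  show "tree_weight s n 0 = tree_weight 1 n 0" for n by (rule tree_weight_unmarked)
  show "0 \<le> tree_weight s n k" for n k using assms by (rule tree_weight_nonneg)
  show "tree_weight s n k \<le> real (n choose k) * tree_weight 1 n 0" for n k
    using tree_weight_le[OF assms, of n k] by (simp add: tree_weight_marks[of n k])
  show "2 * (real n - 1) * tree_weight s n k =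
       s * real n * (\<Sum>a\<le>n. \<Sum>j\<le>k. tree_weight s a j * tree_weight s (n - a) (k - j))" if "0 < k" for n k
    using tree_weight_rec[of n s k] that by simp
  show "2 * (real n - 1) * (real (n choose k) * tree_weight 1 n 0) =
       real n * (\<Sum>a\<le>n. \<Sum>j\<le>k. real (a choose j) * tree_weight 1 a 0 *
          (real (n - a choose (k - j)) * tree_weight 1 (n - a) 0))" for n k
    using tree_weight_rec[of n 1 k] by (simp only: tree_weight_marks[symmetric] if_cancel mult_1_left)
qed (use assms in auto)

text \<open>Each set of the right size is the image of \<open>fact (card I)\<close> injective
  samples. This links ordered samples to the sets of marks in \<open>tree_sum\<close>.\<close>

lemma sum_injective_images:
  fixes F :: "'b set \<Rightarrow> real"
  assumes "finite I" "finite V"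
  shows "(\<Sum>u | u \<in> I \<rightarrow>\<^sub>E V \<and> inj_on u I. F (u ` I)) = fact (card I) * (\<Sum>S\<in>ksubsets V (card I). F S)"
proof -
  let ?A = "{u. u \<in> I \<rightarrow>\<^sub>E V \<and> inj_on u I}"
  have finA: "finite ?A" using finite_PiE[of I "\<lambda>_. V"] assms by simp
  have "(\<Sum>u\<in>?A. F (u ` I)) = (\<Sum>S\<in>ksubsets V (card I). \<Sum>u | u \<in> ?A \<and> u ` I = S. F (u ` I))"
    using finA assms by (intro sum.group[symmetric]) (auto simp: ksubsets_def card_image)
  also have "\<dots> = (\<Sum>S\<in>ksubsets V (card I). fact (card I) * F S)"
  proof (intro sum.cong refl)
    fix S assume S: "S \<in> ksubsets V (card I)"
    then have finS: "finite S" and cS: "card S = card I" and SV: "S \<subseteq> V" 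
      using assms finite_subset by (auto simp: ksubsets_def)
    have "{u. u \<in> ?A \<and> u ` I = S} = {u \<in> I \<rightarrow>\<^sub>E S. inj_on u I}"
    proof (intro equalityI subsetI)
      fix u assume u: "u \<in> {u \<in> I \<rightarrow>\<^sub>E S. inj_on u I}"
      then have "u ` I \<subseteq> S" "card (u ` I) = card S" using cS by (auto simp: card_image)
      then have "u ` I = S" using finS by (intro card_subset_eq)
      then show "u \<in> {u. u \<in> ?A \<and> u ` I = S}" using u SV by (auto simp: PiE_iff)
    qed (auto simp: PiE_iff)
    moreover have "card {u \<in> I \<rightarrow>\<^sub>E S. inj_on u I} = fact (card I)"
      using card_inj_on_subset_funcset[OF assms(1) finS order_refl] cS by (simp add: fact_prod_rev)
    ultimately have c: "card {u. u \<in> ?A \<and> u ` I = S} = fact (card I)" by simp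
    have "(\<Sum>u | u \<in> ?A \<and> u ` I = S. F (u ` I)) = (\<Sum>u | u \<in> ?A \<and> u ` I = S. F S)"
      by (intro sum.cong refl) auto
    also have "\<dots> = real (card {u. u \<in> ?A \<and> u ` I = S}) * F S" by simp
    finally show "(\<Sum>u | u \<in> ?A \<and> u ` I = S. F (u ` I)) = fact (card I) * F S" unfolding c by simp
  qed
  finally show ?thesis by (simp add: sum_distrib_left)
qed

lemma X_pmf_expectation:
  assumes "k \<ge> 1" "n \<ge> 1"
  shows "measure_pmf.expectation (X_pmf n k) (\<lambda>m. s ^ m) =
    (\<Sum>E\<in>trees {1..n}. \<Sum>u\<in>{1..k} \<rightarrow>\<^sub>E {1..n}. forest_pgf s (u ` {1..k}) E) / (real (card (trees {1..n})) * real n ^ k)"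
proof -
  let ?U = "{1..k} \<rightarrow>\<^sub>E {1..n}" and ?f = "\<lambda>T U. num_cuts (U ` {1..k}) {1..n} T"
  have "trees {1..n} \<noteq> {}"
    using tree_weight_pos[of n] assms by (auto simp: tree_weight_def tree_sum_def)
  moreover have "finite (trees {1..n})" by (simp add: finite_trees)
  moreover have "?U \<noteq> {}" "finite ?U" using assms by (auto simp: PiE_eq_empty_iff intro: finite_PiE)
  moreover have "Pi_pmf {1..k} undefined (\<lambda>_. pmf_of_set {1..n}) = pmf_of_set ?U"
  proof -
    have "PiE_dflt {1..k} undefined (\<lambda>_. {1..n}) = ?U"
      by (auto simp: PiE_dflt_def PiE_def Pi_def extensional_def)
    then show ?thesis using assms by (subst Pi_pmf_of_set) auto
  qed
  moreover have "cayley_trees n = trees {1..n}" by (simp add: cayley_trees_def trees_def)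
  ultimately have X: "X_pmf n k = bind_pmf (pmf_of_set (trees {1..n})) (\<lambda>T. bind_pmf (pmf_of_set ?U) (?f T))"
    and ne: "trees {1..n} \<noteq> {}" "?U \<noteq> {}" and fin: "finite (trees {1..n})" "finite ?U"
    by (simp_all add: X_pmf_def pair_pmf_def bind_assoc_pmf bind_return_pmf)
  have inner: "measure_pmf.expectation (bind_pmf (pmf_of_set ?U) (?f T)) (\<lambda>m. s ^ m) =
      (\<Sum>u\<in>?U. forest_pgf s (u ` {1..k}) T) / real n ^ k" if T: "T \<in> trees {1..n}" for T
  proof -
    have "measure_pmf.expectation (bind_pmf (pmf_of_set ?U) (?f T)) (\<lambda>m. s ^ m) =
       (\<Sum>u\<in>?U. measure_pmf.expectation (?f T u) (\<lambda>m. s ^ m) /\<^sub>R real (card ?U))"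
      by (rule pmf_expectation_bind_pmf_of_set[OF ne(2) fin(2) finite_set_num_cuts])
    also have "\<dots> = (\<Sum>u\<in>?U. forest_pgf s (u ` {1..k}) T /\<^sub>R real (card ?U))"
    proof (rule sum.cong[OF refl])
      fix u assume u: "u \<in> ?U"
      have tr: "is_tree {1..n} T" using T by (simp add: trees_def)
      have "u ` {1..k} \<subseteq> {1..n}" using u by (auto simp: PiE_iff)
      moreover have "u ` {1..k} \<noteq> {}" using assms by simp
      ultimately have "alive (u ` {1..k}) T = T" by (rule alive_tree[OF tr])
      then show "measure_pmf.expectation (?f T u) (\<lambda>m. s ^ m) /\<^sub>R real (card ?U) =
          forest_pgf s (u ` {1..k}) T /\<^sub>R real (card ?U)"
        using cut_pgf_eq[OF is_tree_edges2[OF tr] is_tree_Union[OF tr]] by (simp add: forest_pgf_def)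
    qed
    also have "card ?U = n ^ k" by (simp add: card_funcsetE)
    finally show ?thesis by (simp add: sum_distrib_left divide_inverse_commute)
  qed
  have "finite (set_pmf (bind_pmf (pmf_of_set ?U) (?f T)))" for T
    using fin ne by (simp add: finite_set_num_cuts)
  from pmf_expectation_bind_pmf_of_set[OF ne(1) fin(1) this, where h = "\<lambda>m. s ^ m"]
  have "measure_pmf.expectation (X_pmf n k) (\<lambda>m. s ^ m) = 
     (\<Sum>T\<in>trees {1..n}. ((\<Sum>u\<in>?U. forest_pgf s (u ` {1..k}) T) / real n ^ k) /\<^sub>R real (card (trees {1..n})))"
    unfolding X using inner by simp
  then show ?thesis
    by (simp only: sum_distrib_left[symmetric] real_scaleR_def sum_divide_distrib[symmetric])
       (simp add: divide_inverse mult_ac)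
qed

text \<open>\<open>\<rho>\<close> is the probability that the samples are distinct, and
  \<open>\<phi>\<close> is the expectation given that they are. On the remaining event the
  expectation lies between 0 and 1.\<close>

lemma X_pmf_bounds:
  assumes "k \<ge> 1" "n \<ge> k" "0 \<le> s" "s \<le> 1"
  defines "\<rho> \<equiv> fact k * real (n choose k) / real n ^ k"
  defines "\<phi> \<equiv> tree_weight s n k / (real (n choose k) * tree_weight 1 n 0)"
  shows "\<rho> * \<phi> \<le> measure_pmf.expectation (X_pmf n k) (\<lambda>m. s ^ m)"
    and "measure_pmf.expectation (X_pmf n k) (\<lambda>m. s ^ m) \<le> \<rho> * \<phi> + (1 - \<rho>)"
proof -
  have n: "n \<ge> 1" using assms by simp
  let ?U = "{1..k} \<rightarrow>\<^sub>E {1..n}" and ?I = "{u. u \<in> {1..k} \<rightarrow>\<^sub>E {1..n} \<and> inj_on u {1..k}}"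
  let ?F = "\<lambda>E u. forest_pgf s (u ` {1..k}) E"
  define t where "t = real (card (trees {1..n}))"
  have finU: "finite ?U" by (intro finite_PiE) auto
  have IU: "?I \<subseteq> ?U" by auto
  have tw: "tree_weight 1 n 0 = real n / fact n * t"
    by (simp add: tree_weight_def tree_sum_def ksubsets_0 t_def)
  have t: "t > 0"
  proof -
    have "t \<noteq> 0" using tree_weight_pos[of n] n unfolding tw by auto
    moreover have "t \<ge> 0" by (simp add: t_def)
    ultimately show ?thesis by simp
  qed
  have inj: "(\<Sum>u\<in>?I. ?F E u) = fact k * (\<Sum>S\<in>ksubsets {1..n} k. forest_pgf s S E)" for E
    using sum_injective_images[of "{1..k}" "{1..n}" "\<lambda>S. forest_pgf s S E"] by simp
  have cI: "real (card ?I) = fact k * real (n choose k)"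
  proof -
    have "real (card ?I) = fact k * (\<Sum>S\<in>ksubsets {1..n} k. 1)"
      using sum_injective_images[of "{1..k}" "{1..n}" "\<lambda>S. 1"] by simp
    also have "card (ksubsets {1..n} k) = n choose k" unfolding ksubsets_def by (subst n_subsets) auto
    then have "(\<Sum>S\<in>ksubsets {1..n} k. 1) = real (n choose k)" by simp
    finally show ?thesis .
  qed
  have cU: "real (card ?U) = real n ^ k" by (simp add: card_funcsetE)
  have P: "\<rho> * \<phi> = (\<Sum>E\<in>trees {1..n}. \<Sum>u\<in>?I. ?F E u) / (t * real n ^ k)"
  proof -
    have "(\<Sum>E\<in>trees {1..n}. \<Sum>u\<in>?I. ?F E u) = fact k * tree_sum s {1..n} k"
      unfolding inj by (simp add: tree_sum_def sum_distrib_left)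
    moreover have "real (n choose k) > 0" using assms by simp
    ultimately show ?thesis
      unfolding \<rho>_def \<phi>_def tw unfolding tree_weight_def using n t by (simp add: field_simps)
  qed
  have d: "t * real n ^ k > 0" using t n by simp
  have E: "measure_pmf.expectation (X_pmf n k) (\<lambda>m. s ^ m) = (\<Sum>E\<in>trees {1..n}. \<Sum>u\<in>?U. ?F E u) / (t * real n ^ k)"
    unfolding t_def by (rule X_pmf_expectation[OF assms(1) n])
  have "(\<Sum>u\<in>?I. ?F E u) \<le> (\<Sum>u\<in>?U. ?F E u)" for E
    by (rule sum_mono2[OF finU IU]) (rule forest_pgf_bounds[OF assms(3,4)])
  then show "\<rho> * \<phi> \<le> measure_pmf.expectation (X_pmf n k) (\<lambda>m. s ^ m)"
    unfolding P E using d by (intro divide_right_mono sum_mono) auto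
  have "(\<Sum>u\<in>?U. ?F E u) \<le> (\<Sum>u\<in>?I. ?F E u) + (real n ^ k - fact k * real (n choose k))" for E
  proof -
    have "(\<Sum>u\<in>?U. ?F E u) = (\<Sum>u\<in>?U - ?I. ?F E u) + (\<Sum>u\<in>?I. ?F E u)"
      by (rule sum.subset_diff[OF IU finU])
    moreover have "(\<Sum>u\<in>?U - ?I. ?F E u) \<le> (\<Sum>u\<in>?U - ?I. 1)"
      by (rule sum_mono) (rule forest_pgf_bounds[OF assms(3,4)])
    moreover have "(\<Sum>u\<in>?U - ?I. 1) = real n ^ k - fact k * real (n choose k)"
      using card_Diff_subset[OF finite_subset[OF IU finU] IU] card_mono[OF finU IU] cU cI by (simp add: of_nat_diff)
    ultimately show ?thesis by linarith
  qed
  then have "(\<Sum>E\<in>trees {1..n}. \<Sum>u\<in>?U. ?F E u) \<le> 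
      (\<Sum>E\<in>trees {1..n}. (\<Sum>u\<in>?I. ?F E u) + (real n ^ k - fact k * real (n choose k)))"
    by (rule sum_mono)
  also have "\<dots> = (\<Sum>E\<in>trees {1..n}. \<Sum>u\<in>?I. ?F E u) + t * (real n ^ k - fact k * real (n choose k))"
    by (simp add: sum.distrib t_def)
  finally have "measure_pmf.expectation (X_pmf n k) (\<lambda>m. s ^ m) \<le> 
     ((\<Sum>E\<in>trees {1..n}. \<Sum>u\<in>?I. ?F E u) + t * (real n ^ k - fact k * real (n choose k))) / (t * real n ^ k)"
    unfolding E using d by (intro divide_right_mono) auto
  also have "\<dots> = \<rho> * \<phi> + t * (real n ^ k - fact k * real (n choose k)) / (t * real n ^ k)"
    unfolding P by (simp add: add_divide_distrib)
  also have "t * (real n ^ k - fact k * real (n choose k)) / (t * real n ^ k) = 1 - \<rho>"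
    unfolding \<rho>_def using t n by (simp add: diff_divide_distrib)
  finally show "measure_pmf.expectation (X_pmf n k) (\<lambda>m. s ^ m) \<le> \<rho> * \<phi> + (1 - \<rho>)" .
qed

lemma fact_binomial_asymp:
  "(\<lambda>n. fact k * real (n choose k) / real n ^ k) \<longlonglongrightarrow> 1"
proof -
  have *: "fact k * real (n choose k) / real n ^ k = (\<Prod>i = 0..<k. 1 - real i / real n)" if "n > 0" for n
  proof -
    have "fact k * real (n choose k) = (\<Prod>i = 0..<k. real n - real i)"
      using gbinomial_mult_fact[of k "real n"] by (simp add: binomial_gbinomial)
    also have "\<dots> = (\<Prod>i = 0..<k. real n * (1 - real i / real n))"
      using that by (intro prod.cong refl) (simp add: field_simps)
    finally show ?thesis using that by (simp add: prod.distrib)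
  qed
  have "(\<lambda>n. \<Prod>i = 0..<k. 1 - real i / real n) \<longlonglongrightarrow> (\<Prod>i = 0..<k. 1 - 0)"
    by (intro tendsto_prod tendsto_diff tendsto_const lim_const_over_n)
  then have "(\<lambda>n. \<Prod>i = 0..<k. 1 - real i / real n) \<longlonglongrightarrow> 1" by simp
  then show ?thesis
    by (rule Lim_transform_eventually)
       (use eventually_gt_at_top[of 0] in eventually_elim, simp add: *)
qed

text \<open>For \<open>s = exp (- c / sqrt n)\<close> the factor \<open>1 - s\<close> is at most
  \<open>c / sqrt n\<close>, which outweighs the logarithm in \<open>w_lower\<close>.\<close>

lemma exp_sqrt_asymp:
  assumes "c \<ge> 0"
  shows "(\<lambda>n. (1 - exp (- (c / sqrt (real n)))) * (1 + ln (real n))) \<longlonglongrightarrow> 0"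
proof (rule real_tendsto_sandwich)
  show "\<forall>\<^sub>F n in sequentially. 0 \<le> (1 - exp (- (c / sqrt (real n)))) * (1 + ln (real n))"
    using eventually_ge_at_top[of 1] by eventually_elim (use assms in \<open>auto intro!: mult_nonneg_nonneg add_nonneg_nonneg\<close>)
  show "\<forall>\<^sub>F n in sequentially. (1 - exp (- (c / sqrt (real n)))) * (1 + ln (real n)) \<le> c * ((1 + ln (real n)) / sqrt (real n))"
    using eventually_ge_at_top[of 1]
  proof eventually_elim
    case (elim n)
    have "1 - exp (- (c / sqrt (real n))) \<le> c / sqrt (real n)"
      using exp_ge_add_one_self[of "- (c / sqrt (real n))"] by simp
    then have "(1 - exp (- (c / sqrt (real n)))) * (1 + ln (real n)) \<le> c / sqrt (real n) * (1 + ln (real n))"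
      using elim by (intro mult_right_mono) (auto intro!: add_nonneg_nonneg)
    then show ?case by simp
  qed
  have "((\<lambda>x::real. (1 + ln x) / sqrt x) \<longlongrightarrow> 0) at_top" by real_asymp
  from filterlim_compose[OF this filterlim_real_sequentially] 
  show "(\<lambda>n. c * ((1 + ln (real n)) / sqrt (real n))) \<longlonglongrightarrow> 0"
    using tendsto_mult_right_zero by blast
qed simp

lemma killed_weight_tendsto:
  assumes k: "k \<ge> 1" and c: "c \<ge> 0"
  shows "(\<lambda>n. tree_function.killed_weight (\<lambda>n. tree_weight 1 n 0) (exp (- (c / sqrt (real n)))) n k /
     (real (n choose k) * tree_weight 1 n 0)) \<longlonglongrightarrow> (LINT x|lborel. chi_density (2 * k) x * exp (- (c * x)))"
proof -
  \<comment> \<open>The function \<open>killed_weight\<close> depends on \<open>\<tau>\<close>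
    alone, so this instance covers every value of its first argument.\<close>
  interpret cut_weights "\<lambda>n. tree_weight 1 n 0" 1 "tree_weight 1"
    by (rule cut_weights_tree_weight) auto
  \<comment> \<open>\<open>max x 0\<close> ensures \<open>v \<le> 1\<close> on the whole line; on
    the negative half the chi density is 0.\<close>
  define v where "v = (\<lambda>x::real. exp (- (c * max x 0)))"
  have "(\<lambda>n. (\<Sum>j\<le>n. killed_coeff n k j * v (real (j + k - 1) / sqrt n)) / real (n choose k))
    \<longlonglongrightarrow> (LINT x|lborel. chi_density (2 * k) x * v x)"
  proof (rule killed_coeff_sum_tendsto[OF k])
    fix n assume n: "n \<ge> k"
    have "(\<Sum>j\<le>n. killed_coeff n k j) * tree_weight 1 n 0 \<le> real (n choose k) * tree_weight 1 n 0"
      using killed_weight_le_W[of n k] killed_weight_coeff[of k n 1] k n by simp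
    then show "(\<Sum>j\<le>n. killed_coeff n k j) \<le> real (n choose k)"
      using tau_pos[of n] n k by simp
  qed (use c in \<open>auto simp: v_def intro!: continuous_intros\<close>)
  also have "(LINT x|lborel. chi_density (2 * k) x * v x) = (LINT x|lborel. chi_density (2 * k) x * exp (- (c * x)))"
    by (intro Bochner_Integration.integral_cong refl) (auto simp: v_def chi_density_def max_def)
  finally show ?thesis
  proof (rule Lim_transform_eventually)
    show "\<forall>\<^sub>F n in sequentially. (\<Sum>j\<le>n. killed_coeff n k j * v (real (j + k - 1) / sqrt n)) / real (n choose k) =
      killed_weight (exp (- (c / sqrt (real n)))) n k / (real (n choose k) * tree_weight 1 n 0)"
      using eventually_gt_at_top[of 0]
    proof eventually_elim
      case (elim n)
      have "v (real (j + k - 1) / sqrt n) = exp (- (c / sqrt (real n))) ^ (j + k - 1)" for j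
        by (simp add: v_def exp_of_nat_mult[symmetric])
      then show ?case using tau_pos[OF elim] killed_weight_coeff[of k n] k elim by simp
    qed
  qed
qed

lemma X_pmf_laplace:
  assumes k: "k \<ge> 1" and c: "c \<ge> 0"
  shows "(\<lambda>n. measure_pmf.expectation (X_pmf n k) (\<lambda>m. exp (- (c * (real m / sqrt (real n))))))
     \<longlonglongrightarrow> (LINT x|lborel. chi_density (2 * k) x * exp (- (c * x)))"
proof -
  let ?\<tau> = "\<lambda>n. tree_weight 1 n 0"
  define s where "s = (\<lambda>n. exp (- (c / sqrt (real n))))"
  have s: "0 \<le> s n" "s n \<le> 1" for n using c by (auto simp: s_def)
  define E where "E = (\<lambda>n. measure_pmf.expectation (X_pmf n k) (\<lambda>m. s n ^ m))"
  define g where "g = (\<lambda>r n. tree_function.killed_weight ?\<tau> r n k / (real (n choose k) * ?\<tau> n))"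
  define \<phi> where "\<phi> = (\<lambda>n. tree_weight (s n) n k / (real (n choose k) * ?\<tau> n))"
  define \<rho> where "\<rho> = (\<lambda>n. fact k * real (n choose k) / real n ^ k)"
  define L where "L = (LINT x|lborel. chi_density (2 * k) x * exp (- (c * x)))"
  have gs: "(\<lambda>n. g (s n) n) \<longlonglongrightarrow> L"
    unfolding g_def s_def L_def by (rule killed_weight_tendsto[OF k c])
  \<comment> \<open>The case \<open>c = 0\<close>, in which the limit is the total chi mass: the
    killed process succeeds with probability tending to 1.\<close>
  have g1: "(\<lambda>n. g 1 n) \<longlonglongrightarrow> 1"
    using killed_weight_tendsto[OF k order_refl] chi_density_integral[OF k]
    by (simp add: g_def has_bochner_integral_iff)
  have W: "real (n choose k) * ?\<tau> n > 0" if "n \<ge> k" for n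
    using tree_weight_pos[of n] that k by simp
  have up: "\<phi> n \<le> g (s n) n + (1 - g 1 n)" if "n \<ge> k" for n
  proof -
    interpret cut_weights ?\<tau> "s n" "tree_weight (s n)"
      by (rule cut_weights_tree_weight[OF s])
    have "\<phi> n \<le> (killed_weight (s n) n k + (W n k - killed_weight 1 n k)) / W n k"
      unfolding \<phi>_def using W[OF that] by (intro divide_right_mono w_upper) auto
    moreover have "W n k / W n k = 1" using W[OF that] by (intro divide_self) (metis less_irrefl)
    ultimately show ?thesis unfolding g_def add_divide_distrib diff_divide_distrib by linarith
  qed
  have lo: "\<exists>N. \<forall>n\<ge>k. g (s n) n - real k * (\<epsilon> + (1 - s n) * real N * (1 + ln (real n))) \<le> \<phi> n"
    if \<epsilon>: "\<epsilon> > 0" for \<epsilon>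
  proof -
    \<comment> \<open>\<open>q\<close> is the mean loss of vertices per cut that
      \<open>w_1_lower\<close> requires, and \<open>N\<close> the size from which
      \<open>weighted_split_large\<close> provides it.\<close>
    obtain q :: nat where q: "1 / \<epsilon> \<le> real q" using real_arch_simple by blast
    define N where "N = (9 * q + 2)\<^sup>2"
    have "g (s n) n - real k * (\<epsilon> + (1 - s n) * real N * (1 + ln (real n))) \<le> \<phi> n" if n: "n \<ge> k" for n
    proof -
      interpret cut_weights ?\<tau> "s n" "tree_weight (s n)"
        by (rule cut_weights_tree_weight[OF s])
      have "killed_weight (s n) n k - tree_weight (s n) n k \<le> 
         real k * (\<epsilon> + (1 - s n) * real N * (1 + ln (real n))) * W n k"
      proof (rule w_lower[OF \<epsilon>])
        fix m assume m: "m \<ge> N"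
        let ?D = "\<Sum>a\<le>m. real a * ?\<tau> a * (real (m - a) * ?\<tau> (m - a))"
        have "(real m - 1) * ?\<tau> m \<le> (real m) * ?\<tau> m" using tau_nonneg by (intro mult_right_mono) auto
        also have "\<dots> \<le> (\<epsilon> * real q) * (real m * ?\<tau> m)"
        proof -
          have "1 \<le> \<epsilon> * real q" using q \<epsilon> by (simp add: field_simps)
          from mult_right_mono[OF this, of "real m * ?\<tau> m"] show ?thesis using tau_nonneg by simp
        qed
        also have "\<dots> = \<epsilon> * (real q * (real m * ?\<tau> m))" by simp
        also have "\<dots> \<le> \<epsilon> * ?D"
          using weighted_split_large[of q m] m \<epsilon> by (intro mult_left_mono) (auto simp: N_def)
        finally show "(real m - 1) * ?\<tau> m \<le> \<epsilon> * ?D" .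
      qed (use n k in auto)
      then have "(killed_weight (s n) n k - tree_weight (s n) n k) / W n k \<le> 
         real k * (\<epsilon> + (1 - s n) * real N * (1 + ln (real n)))"
        using W[OF n] by (simp add: pos_divide_le_eq)
      then show ?thesis by (simp add: g_def \<phi>_def diff_divide_distrib)
    qed
    then show ?thesis by blast
  qed
  have \<phi>: "\<phi> \<longlonglongrightarrow> L"
  proof (rule LIMSEQ_I)
    fix r :: real assume r: "r > 0"
    define \<epsilon> where "\<epsilon> = r / (3 * real k)"
    have \<epsilon>: "\<epsilon> > 0" "real k * \<epsilon> = r / 3" using r k by (auto simp: \<epsilon>_def)
    \<comment> \<open>\<open>N\<close> depends on \<open>\<epsilon>\<close> only and is fixed before
      \<open>n\<close> tends to infinity, so the logarithmic term tends to 0.\<close>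
    obtain N where N: "\<And>n. n \<ge> k \<Longrightarrow> g (s n) n - real k * (\<epsilon> + (1 - s n) * real N * (1 + ln (real n))) \<le> \<phi> n"
      using lo[OF \<epsilon>(1)] by blast
    have "(\<lambda>n. real k * real N * ((1 - s n) * (1 + ln (real n)))) \<longlonglongrightarrow> real k * real N * 0"
      unfolding s_def by (intro tendsto_mult tendsto_const exp_sqrt_asymp c)
    then have "\<forall>\<^sub>F n in sequentially. real k * real N * ((1 - s n) * (1 + ln (real n))) < r / 3"
      using r by (auto dest!: order_tendstoD(2)[of _ _ _ "r / 3"])
    moreover have "\<forall>\<^sub>F n in sequentially. \<bar>g (s n) n - L\<bar> < r / 3"
      using tendstoD[OF gs, of "r / 3"] r by (simp add: dist_real_def)
    moreover have "\<forall>\<^sub>F n in sequentially. \<bar>g 1 n - 1\<bar> < r / 3"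
      using tendstoD[OF g1, of "r / 3"] r by (simp add: dist_real_def)
    ultimately have "\<forall>\<^sub>F n in sequentially. norm (\<phi> n - L) < r"
      using eventually_ge_at_top[of k]
    proof eventually_elim
      case (elim n)
      have "real k * (\<epsilon> + (1 - s n) * real N * (1 + ln (real n))) = r / 3 + real k * real N * ((1 - s n) * (1 + ln (real n)))"
        using \<epsilon>(2) by (simp add: algebra_simps)
      then have "g (s n) n - (r / 3 + real k * real N * ((1 - s n) * (1 + ln (real n)))) \<le> \<phi> n"
        using N[OF elim(4)] by simp
      moreover have "\<phi> n \<le> g (s n) n + (1 - g 1 n)" by (rule up[OF elim(4)])
      ultimately show ?case using elim unfolding real_norm_def by linarith
    qed
    then show "\<exists>n0. \<forall>n\<ge>n0. norm (\<phi> n - L) < r" by (simp add: eventually_at_top_linorder)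
  qed
  have \<rho>: "\<rho> \<longlonglongrightarrow> 1" unfolding \<rho>_def by (rule fact_binomial_asymp)
  have "E \<longlonglongrightarrow> L"
  proof (rule real_tendsto_sandwich)
    show "\<forall>\<^sub>F n in sequentially. \<rho> n * \<phi> n \<le> E n"
      using eventually_ge_at_top[of k]
      by eventually_elim (use X_pmf_bounds(1)[OF k _ s] in \<open>simp add: E_def \<phi>_def \<rho>_def\<close>)
    show "\<forall>\<^sub>F n in sequentially. E n \<le> \<rho> n * \<phi> n + (1 - \<rho> n)"
      using eventually_ge_at_top[of k]
      by eventually_elim (use X_pmf_bounds(2)[OF k _ s] in \<open>simp add: E_def \<phi>_def \<rho>_def\<close>)
    show "(\<lambda>n. \<rho> n * \<phi> n) \<longlonglongrightarrow> L" using tendsto_mult[OF \<rho> \<phi>] by simp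
    show "(\<lambda>n. \<rho> n * \<phi> n + (1 - \<rho> n)) \<longlonglongrightarrow> L"
      using tendsto_add[OF tendsto_mult[OF \<rho> \<phi>] tendsto_diff[OF tendsto_const \<rho>, of 1]] by simp
  qed
  moreover have "s n ^ m = exp (- (c * (real m / sqrt (real n))))" for n m
    by (simp add: s_def exp_of_nat_mult[symmetric] mult_ac)
  ultimately show ?thesis by (simp add: E_def L_def)
qed

theorem lemma1:
  fixes k :: nat
  assumes "k \<ge> 1"
  shows "weak_conv_m
           (\<lambda>n. distr (measure_pmf (X_pmf n k)) borel (\<lambda>m. real m / sqrt (real n)))
           (chi_distribution (2 * k))
         \<and> (\<forall>x\<ge>0. chi_density (2 * k) x =
              2 powr (1 - real k) / fact (k - 1) * x ^ (2 * k - 1) * exp (- x\<^sup>2 / 2))"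
proof
  let ?M = "chi_distribution (2 * k)"
  let ?Ms = "\<lambda>n. distr (measure_pmf (X_pmf n k)) borel (\<lambda>m. real m / sqrt (real n))"
  have chi: "integrable lborel (chi_density (2 * k))" "(LINT x|lborel. chi_density (2 * k) x) = 1"
    using chi_density_integral[OF assms] by (auto simp: has_bochner_integral_iff)
  have nonneg: "\<And>x. 0 \<le> chi_density (2 * k) x" by (rule chi_density_nonneg[OF assms])
  have meas [measurable]: "chi_density (2 * k) \<in> borel_measurable borel" using chi(1) by simp
  show "weak_conv_m ?Ms ?M"
  proof (rule laplace_tendsto_imp_weak_conv)
    have "prob_space ?M"
    proof
      have "emeasure ?M (space ?M) = (\<integral>\<^sup>+x. ennreal (chi_density (2 * k) x) \<partial>lborel)"
        by (simp add: chi_distribution_def emeasure_density)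
      also have "\<dots> = 1" using nn_integral_eq_integral[OF chi(1)] nonneg chi(2) by simp
      finally show "emeasure ?M (space ?M) = 1" .
    qed
    then show "real_distribution ?M"
      unfolding real_distribution_def real_distribution_axioms_def by (simp add: chi_distribution_def)
    show "AE x in ?M. 0 \<le> x"
      unfolding chi_distribution_def by (subst AE_density) (auto simp: chi_density_def)
    show "real_distribution (?Ms n)" for n
      by (intro prob_space.real_distribution_distr prob_space_measure_pmf) simp
    show "AE x in ?Ms n. 0 \<le> x" for n
      by (subst AE_distr_iff) auto
    fix i :: nat
    have "(LINT x|?Ms n. exp (- (real i * x))) = 
        measure_pmf.expectation (X_pmf n k) (\<lambda>m. exp (- (real i * (real m / sqrt (real n)))))" for n
      by (subst integral_distr) auto
    moreover have "(LINT x|?M. exp (- (real i * x))) = (LINT x|lborel. chi_density (2 * k) x * exp (- (real i * x)))"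
      unfolding chi_distribution_def using nonneg by (subst integral_density) auto
    ultimately show "(\<lambda>n. LINT x|?Ms n. exp (- (real i * x))) \<longlonglongrightarrow> (LINT x|?M. exp (- (real i * x)))"
      using X_pmf_laplace[OF assms, of "real i"] by simp
  qed
  have "2 powr (1 - real k) = 1 / (2 :: real) ^ (k - 1)"
    using assms by (simp add: powr_diff powr_realpow power_diff)
  then show "\<forall>x\<ge>0. chi_density (2 * k) x =
      2 powr (1 - real k) / fact (k - 1) * x ^ (2 * k - 1) * exp (- x\<^sup>2 / 2)"
    by (simp add: chi_density_even[OF assms])
qed

end
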